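(* Fix an integer $b\geq 1$. Then for every closed oriented 3-manifold $Y$ with first Betti number $b_1(Y)=b$ we have $$L(b)\leq h(Y)\leq 2^{b-1},$$ where $$L(b)=\begin{cases}3^{\frac{b-1}{2}} & \text{if } b \text{ is odd}\\ 2\cdot 3^{\frac b2-1} & \text{if } b\text{ is even.}\end{cases}$$
   Context: Let $Y$ be a closed oriented 3-manifold and $H=H^1(Y;\mathbb Z)$, with dual $H^*=\mathrm{Hom}(H,\mathbb Z)$. Let $\mu_Y\in\Lambda^3H^*$ be the 3-form $\mu_Y(a,b,c)=\langle a\cup b\cup c,[Y]\rangle$. For $\omega\in H^*$ let $\omega\angle\cdot:\Lambda^kH\to\Lambda^{k-1}H$ be the interior product (contraction) induced by the duality between $H^*$ and $H$; it satisfies $\omega\angle(\omega\angle\alpha)=0$ and extends to maps $\Lambda^pH^*\otimes\Lambda^kH\to\Lambda^{k-p}H$ with $(\omega\wedge\eta)\angle\alpha=\omega\angle(\eta\angle\alpha)$. The cup complex $C^\infty_*(Y)$ is $\Lambda^*H\otimes\mathbb Z[U,U^{-1}]$, where $U$ is a formal variable of degree $-2$ and $\Lambda^\ell H$ has degree $\ell$, with differential $\partial:C^\infty_k\to C^\infty_{k-1}$, $\partial(\alpha\otimes U^n)=(\mu_Y\angle\alpha)\otimes U^{n-1}$. Its homology is denoted $HC^\infty_*(Y)$. Multiplication by $U$ gives $HC^\infty_k(Y)\cong HC^\infty_{k-2}(Y)$. If $b_1(Y)\ge1$, the rank $\mathrm{rk}_{\mathbb Z}HC^\infty_k(Y)$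 is the same for all $k\in\mathbb Z$, and $h(Y)$ is defined to be this common rank. If $b_1(Y)=0$, one sets $h(Y)=\frac12$. *)

theory Defs
  imports "HOL-Homology.Homology" "HOL-Combinatorics.Permutations" "HOL-Library.Extended_Nat"
begin

section \<open>Abelian groups\<close>

text \<open>Abelian groups are multiplicatively written records, as in the homology library.\<close>

definition int_independent :: "('a, 'm) monoid_scheme \<Rightarrow> 'a set \<Rightarrow> bool" where
  "int_independent G S \<longleftrightarrow> finite S \<and> S \<subseteq> carrier G \<and>
     (\<forall>n :: 'a \<Rightarrow> int. finprod G (\<lambda>x. x [^]\<^bsub>G\<^esub> n x) S = \<one>\<^bsub>G\<^esub> \<longrightarrow> (\<forall>x\<in>S. n x = 0))"

definition group_rank :: "('a, 'm) monoid_scheme \<Rightarrow> enat" where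
  "group_rank G = (SUP S \<in> {S. int_independent G S}. enat (card S))"

definition dual_group :: "('a, 'm) monoid_scheme \<Rightarrow> ('a \<Rightarrow> int) monoid" where
  "dual_group G =
     \<lparr>carrier = hom G integer_group \<inter> extensional (carrier G),
      monoid.mult = (\<lambda>\<phi> \<psi>. \<lambda>x\<in>carrier G. \<phi> x + \<psi> x),
      one = (\<lambda>x\<in>carrier G. 0)\<rparr>"

text \<open>The linear extension of an integer-valued function on generators.\<close>

definition frag_eval :: "('a \<Rightarrow> int) \<Rightarrow> ('a \<Rightarrow>\<^sub>0 int) \<Rightarrow> int" where
  "frag_eval f c = (\<Sum>x\<in>Poly_Mapping.keys c. Poly_Mapping.lookup c x * f x)"


section \<open>Singular cohomology with integer coefficients\<close>

definition cochain_group :: "nat \<Rightarrow> 'a topology \<Rightarrow> ('a chain \<Rightarrow> int) monoid" where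
  "cochain_group p X = dual_group (chain_group p X)"

definition coboundary :: "nat \<Rightarrow> 'a topology \<Rightarrow> ('a chain \<Rightarrow> int) \<Rightarrow> ('a chain \<Rightarrow> int)" where
  "coboundary p X \<phi> = restrict (\<phi> \<circ> chain_boundary (Suc p)) (carrier (chain_group (Suc p) X))"

definition cocycle_set :: "nat \<Rightarrow> 'a topology \<Rightarrow> ('a chain \<Rightarrow> int) set" where
  "cocycle_set p X = kernel (cochain_group p X) (cochain_group (Suc p) X) (coboundary p X)"

definition coboundary_set :: "nat \<Rightarrow> 'a topology \<Rightarrow> ('a chain \<Rightarrow> int) set" where
  "coboundary_set p X =
     (if p = 0 then {\<one>\<^bsub>cochain_group 0 X\<^esub>}
      else coboundary (p - 1) X ` carrier (cochain_group (p - 1) X))"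

definition cohomology_group :: "nat \<Rightarrow> 'a topology \<Rightarrow> ('a chain \<Rightarrow> int) set monoid" where
  "cohomology_group p X =
     subgroup_generated (cochain_group p X) (cocycle_set p X) Mod coboundary_set p X"

text \<open>
  The cohomological form of the Betti number, the rank of $H^p(X; \mathbb{Z})$; for closed manifolds
  it is also the rank of $H_p(X; \mathbb{Z})$.
\<close>

definition betti_number :: "nat \<Rightarrow> 'a topology \<Rightarrow> enat" where
  "betti_number p X = group_rank (cohomology_group p X)"

definition front_face :: "nat \<Rightarrow> ((nat \<Rightarrow> real) \<Rightarrow> 'a) \<Rightarrow> ((nat \<Rightarrow> real) \<Rightarrow> 'a)" where
  "front_face p \<sigma> = restrict \<sigma> (standard_simplex p)"

text \<open>The face of a $(p+q)$-simplex spanned by its vertices $p, \dots, p+q$.\<close>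

definition back_face :: "nat \<Rightarrow> nat \<Rightarrow> ((nat \<Rightarrow> real) \<Rightarrow> 'a) \<Rightarrow> ((nat \<Rightarrow> real) \<Rightarrow> 'a)" where
  "back_face p q \<sigma> =
     restrict (\<lambda>x. \<sigma> (\<lambda>i. if i < p then 0 else x (i - p))) (standard_simplex q)"

definition cup_cochain ::
    "nat \<Rightarrow> nat \<Rightarrow> 'a topology \<Rightarrow> ('a chain \<Rightarrow> int) \<Rightarrow> ('a chain \<Rightarrow> int) \<Rightarrow> ('a chain \<Rightarrow> int)" where
  "cup_cochain p q X \<phi> \<psi> =
     restrict (frag_eval (\<lambda>\<sigma>. \<phi> (frag_of (front_face p \<sigma>)) * \<psi> (frag_of (back_face p q \<sigma>))))
       (carrier (chain_group (p + q) X))"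

text \<open>
  Operations on quotients are given on cosets by \<open>the_elem\<close> of the set of all values on
  representatives; that set is a singleton because the operations are well defined.
\<close>

definition cup_product ::
    "nat \<Rightarrow> nat \<Rightarrow> 'a topology \<Rightarrow> ('a chain \<Rightarrow> int) set \<Rightarrow> ('a chain \<Rightarrow> int) set
      \<Rightarrow> ('a chain \<Rightarrow> int) set" where
  "cup_product p q X A B = the_elem
     {coboundary_set (p + q) X #>\<^bsub>cochain_group (p + q) X\<^esub> cup_cochain p q X \<phi> \<psi> | \<phi> \<psi>.
       \<phi> \<in> A \<and> \<psi> \<in> B}"

definition kronecker_pairing :: "('a chain \<Rightarrow> int) set \<Rightarrow> 'a chain set \<Rightarrow> int" where
  "kronecker_pairing A \<zeta> = the_elem {\<phi> z | \<phi> z. \<phi> \<in> A \<and> z \<in> \<zeta>}"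


section \<open>Closed oriented manifolds\<close>

text \<open>Connectedness is not required.\<close>

definition closed_manifold :: "nat \<Rightarrow> 'a topology \<Rightarrow> bool" where
  "closed_manifold n Y \<longleftrightarrow> compact_space Y \<and> Hausdorff_space Y \<and>
     (\<forall>x\<in>topspace Y. \<exists>U V. openin Y U \<and> x \<in> U \<and> openin (Euclidean_space n) V \<and>
        subtopology Y U homeomorphic_space subtopology (Euclidean_space n) V)"

text \<open>
  An orientation of a closed \<open>n\<close>-manifold is given by its fundamental class, that is, by a class
  in $H_n(Y)$ restricting to a generator of every local homology group $H_n(Y, Y - x)$.
\<close>

definition fundamental_class :: "nat \<Rightarrow> 'a topology \<Rightarrow> 'a chain set \<Rightarrow> bool" where
  "fundamental_class n Y \<zeta> \<longleftrightarrow> \<zeta> \<in> carrier (homology_group (int n) Y) \<and>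
     (\<forall>x\<in>topspace Y.
        generate (relative_homology_group (int n) Y (topspace Y - {x}))
          {hom_induced (int n) Y {} Y (topspace Y - {x}) id \<zeta>}
        = carrier (relative_homology_group (int n) Y (topspace Y - {x})))"

definition closed_oriented_manifold :: "nat \<Rightarrow> 'a topology \<Rightarrow> 'a chain set \<Rightarrow> bool" where
  "closed_oriented_manifold n Y \<zeta> \<longleftrightarrow> closed_manifold n Y \<and> fundamental_class n Y \<zeta>"


section \<open>Exterior powers and interior products\<close>

text \<open>
  The list \<open>[x\<^sub>1, \<dots>, x\<^sub>l]\<close> stands for the decomposable element $x_1 \wedge \dots \wedge x_l$.
  The degree is an integer, so that exterior powers of negative degree are trivial.
\<close>

definition wedge_words :: "('h, 'm) monoid_scheme \<Rightarrow> int \<Rightarrow> 'h list set" where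
  "wedge_words H l = {xs. set xs \<subseteq> carrier H \<and> int (length xs) = l}"

abbreviation wedge_chains :: "('h, 'm) monoid_scheme \<Rightarrow> int \<Rightarrow> ('h list \<Rightarrow>\<^sub>0 int) monoid" where
  "wedge_chains H l \<equiv> free_Abelian_group (wedge_words H l)"

definition wedge_relations :: "('h, 'm) monoid_scheme \<Rightarrow> int \<Rightarrow> ('h list \<Rightarrow>\<^sub>0 int) set" where
  "wedge_relations H l = generate (wedge_chains H l)
     ({frag_of (xs @ (x \<otimes>\<^bsub>H\<^esub> y) # ys) - frag_of (xs @ x # ys) - frag_of (xs @ y # ys) | xs x y ys.
         xs @ x # ys \<in> wedge_words H l \<and> xs @ y # ys \<in> wedge_words H l} \<union>
      {frag_of (xs @ x # ys @ x # zs) | xs x ys zs. xs @ x # ys @ x # zs \<in> wedge_words H l})"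

definition ext_power :: "('h, 'm) monoid_scheme \<Rightarrow> int \<Rightarrow> ('h list \<Rightarrow>\<^sub>0 int) set monoid" where
  "ext_power H l = wedge_chains H l Mod wedge_relations H l"

text \<open>
  The antiderivation
  $\omega \angle (x_0 \wedge \dots \wedge x_{l-1})
    = \sum_i (-1)^i \omega(x_i)\, x_0 \wedge \dots \widehat{x_i} \dots \wedge x_{l-1}$.
\<close>

definition interior :: "('h \<Rightarrow> int) \<Rightarrow> ('h list \<Rightarrow>\<^sub>0 int) \<Rightarrow> ('h list \<Rightarrow>\<^sub>0 int)" where
  "interior \<omega> = frag_extend (\<lambda>xs. \<Sum>i<length xs.
     frag_cmul ((-1) ^ i * \<omega> (xs ! i)) (frag_of (take i xs @ drop (Suc i) xs)))"

text \<open>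
  The extension to multivectors:
  $(\omega_1 \wedge \dots \wedge \omega_p) \angle \alpha
    = \omega_1 \angle (\omega_2 \angle \cdots (\omega_p \angle \alpha))$.
\<close>

definition contract_chain ::
    "(('h \<Rightarrow> int) list \<Rightarrow>\<^sub>0 int) \<Rightarrow> ('h list \<Rightarrow>\<^sub>0 int) \<Rightarrow> ('h list \<Rightarrow>\<^sub>0 int)" where
  "contract_chain m c = frag_extend (\<lambda>\<omega>s. foldr interior \<omega>s c) m"

text \<open>The contraction $\Lambda^p H^* \otimes \Lambda^k H \to \Lambda^{k-p} H$.\<close>

definition contraction ::
    "('h, 'm) monoid_scheme \<Rightarrow> int \<Rightarrow> int \<Rightarrow> (('h \<Rightarrow> int) list \<Rightarrow>\<^sub>0 int) set \<Rightarrow> ('h list \<Rightarrow>\<^sub>0 int) set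
      \<Rightarrow> ('h list \<Rightarrow>\<^sub>0 int) set" where
  "contraction H p k M A = the_elem
     {wedge_relations H (k - p) #>\<^bsub>wedge_chains H (k - p)\<^esub> contract_chain m c | m c.
       m \<in> M \<and> c \<in> A}"

text \<open>
  An element of $\Lambda^p H^*$ is identified with an alternating \<open>p\<close>-form on \<open>H\<close> by
  $(\omega_1 \wedge \dots \wedge \omega_p)(x_1, \dots, x_p) = \det (\omega_i(x_j))$;
  a factor $1/p!$ would not be integral.
\<close>

definition form_value :: "(('h \<Rightarrow> int) list \<Rightarrow>\<^sub>0 int) set \<Rightarrow> 'h list \<Rightarrow> int" where
  "form_value M xs = the_elem
     {frag_eval (\<lambda>\<omega>s. \<Sum>\<pi> | \<pi> permutes {..<length xs}.
        sign \<pi> * (\<Prod>i<length xs. (\<omega>s ! i) (xs ! \<pi> i))) m | m. m \<in> M}"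


section \<open>The cup complex\<close>

definition triple_cup_form :: "'a topology \<Rightarrow> 'a chain set \<Rightarrow>
    ((('a chain \<Rightarrow> int) set \<Rightarrow> int) list \<Rightarrow>\<^sub>0 int) set" where
  "triple_cup_form Y \<zeta> = (THE M. M \<in> carrier (ext_power (dual_group (cohomology_group 1 Y)) 3) \<and>
     (\<forall>a\<in>carrier (cohomology_group 1 Y). \<forall>b\<in>carrier (cohomology_group 1 Y).
      \<forall>c\<in>carrier (cohomology_group 1 Y).
        form_value M [a, b, c]
        = kronecker_pairing (cup_product 2 1 Y (cup_product 1 1 Y a b) c) \<zeta>))"

text \<open>
  The degree \<open>k\<close> part of $\Lambda^* H \otimes \mathbb{Z}[U, U^{-1}]$ consists of the finite sums
  $\sum_n \alpha_n \otimes U^n$ with $\alpha_n \in \Lambda^{k+2n} H$, encoded as the finitely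
  supported functions $n \mapsto \alpha_n$.
\<close>

definition cup_complex :: "('h, 'm) monoid_scheme \<Rightarrow> int \<Rightarrow> (int \<Rightarrow> ('h list \<Rightarrow>\<^sub>0 int) set) monoid" where
  "cup_complex H k = sum_group UNIV (\<lambda>n. ext_power H (k + 2 * n))"

text \<open>
  Since $\partial (\alpha \otimes U^{n+1}) = (\mu \angle \alpha) \otimes U^n$, the coefficient of
  $U^n$ in the image comes from that of $U^{n+1}$.
\<close>

definition cup_differential ::
    "('h, 'm) monoid_scheme \<Rightarrow> (('h \<Rightarrow> int) list \<Rightarrow>\<^sub>0 int) set \<Rightarrow> int
      \<Rightarrow> (int \<Rightarrow> ('h list \<Rightarrow>\<^sub>0 int) set) \<Rightarrow> (int \<Rightarrow> ('h list \<Rightarrow>\<^sub>0 int) set)" where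
  "cup_differential H \<mu> k \<alpha> = (\<lambda>n. contraction H 3 (k + 2 * (n + 1)) \<mu> (\<alpha> (n + 1)))"

definition cup_homology :: "'a topology \<Rightarrow> 'a chain set \<Rightarrow> int \<Rightarrow>
    (int \<Rightarrow> (('a chain \<Rightarrow> int) set list \<Rightarrow>\<^sub>0 int) set) set monoid" where
  "cup_homology Y \<zeta> k =
     (let H = cohomology_group 1 Y; d = cup_differential H (triple_cup_form Y \<zeta>)
      in subgroup_generated (cup_complex H k) (kernel (cup_complex H k) (cup_complex H (k - 1)) (d k))
           Mod (d (k + 1) ` carrier (cup_complex H (k + 1))))"

text \<open>
  \<open>cup_rank\<close> is $h(Y)$. The groups $HC^\infty_k(Y)$ all have the same rank if $b_1(Y) \geq 1$.
\<close>

definition cup_rank :: "'a topology \<Rightarrow> 'a chain set \<Rightarrow> real" where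
  "cup_rank Y \<zeta> =
     (if betti_number 1 Y = 0 then 1 / 2
      else real (the_enat (THE r. \<forall>k. group_rank (cup_homology Y \<zeta> k) = r)))"

definition cup_rank_bound :: "nat \<Rightarrow> real" where
  "cup_rank_bound b = (if odd b then 3 ^ ((b - 1) div 2) else 2 * 3 ^ (b div 2 - 1))"

end

theory Submission
  imports Defs "HOL-Library.Function_Algebras"
begin

text \<open>
  Write \<open>H\<close> for first cohomology, a free group of rank \<open>b\<close>, and \<open>D\<close> for the contraction with the
  triple cup product \<open>\<mu>\<close> on the exterior algebra of \<open>H\<close>. The inequalities hold for the complex built
  from any trivector \<open>\<mu>\<close>. The operator \<open>D\<close> lowers the exterior degree by 3, and \<open>D \<circ> D = 0\<close> because
  \<open>\<mu>\<close> has odd degree.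

  Upper bound. The degree \<open>k\<close> part of the cup complex is the sum of the exterior powers whose degree
  has the parity of \<open>k\<close>, a free group of rank \<open>2 ^ (b - 1)\<close>. Its homology therefore has rank
  \<open>2 ^ (b - 1)\<close> minus the ranks of \<open>D\<close> on the even and on the odd part
  (\<open>group_rank_cup_homology\<close>), whatever \<open>k\<close> is.

  Lower bound. Sort the exterior powers by degree modulo 6 into classes of dimensions \<open>n\<^sub>j\<close>. The
  operator exchanges the classes \<open>j\<close> and \<open>j + 3\<close> and has square zero, so its two ranks on such a
  pair add up to at most the smaller dimension (\<open>contract_rank_pair\<close>). Hence the homology has rank at
  least half of the sum of \<open>\<bar>n\<^sub>j - n\<^sub>j\<^sub>+\<^sub>3\<bar>\<close> over \<open>j = 0, 1, 2\<close>. By Pascal's rule these differences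
  satisfy a recursion in \<open>b\<close> that multiplies them by 3 every two steps (\<open>sum_abs_excess\<close>), and half
  of their sum is exactly \<open>L(b)\<close>.

  It remains to see that the topological definitions produce such a complex. First cohomology is
  torsionless, since a cocycle vanishing on all cycles is a coboundary
  (\<open>cocycle_vanishing_on_cycles\<close>); a torsionless group of finite rank has a basis
  (\<open>torsionless_finite_rank_has_basis\<close>). Cocycles of degree one anticommute under the cup product up
  to an explicit coboundary, and cup products are compatible with coboundaries by the Leibniz rule,
  so the triple cup product evaluated on a homology class is an alternating trilinear form
  (\<open>triple_cup_alternating\<close>). Over the integers such a form is represented by one and only one
  trivector (\<open>alternating_trilinear_form_unique\<close>), so that the definite description defining the
  triple cup form denotes.

  Exterior powers are presented by generators and relations. Computations in them are
  carried out in coordinates: a class becomes a rational function on finite sets of basis indices,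
  wedging with a vector becomes a creation operator and contraction with a form an annihilation
  operator (\<open>annihilate_create\<close>). These coordinates are faithful (\<open>chain_coords_eq_0_iff\<close>), and
  ranks of groups become dimensions over the rationals (\<open>group_rank_eq_dim\<close>).
\<close>

section \<open>Ranks of abelian groups as dimensions over the rationals\<close>

context vector_space
begin

lemma dim_mono_finite:
  assumes "A \<subseteq> span B" "B \<subseteq> span W" "finite W"
  shows "dim A \<le> dim B"
proof -
  obtain C where C: "C \<subseteq> B" "independent C" "B \<subseteq> span C" "card C = dim B"
    using basis_exists by blast
  have "finite C"
    using independent_span_bound[OF \<open>finite W\<close> C(2)] C(1) assms(2) by blast
  moreover have "A \<subseteq> span C"
    using assms(1) C(3) by (meson order.trans span_minimal subspace_span)
  ultimately show ?thesis
    using dim_le_card C(4) by metis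
qed

lemma dim_Un_le:
  assumes "A \<subseteq> span W" "B \<subseteq> span W" "finite W"
  shows "dim (A \<union> B) \<le> dim A + dim B"
proof -
  obtain C where C: "C \<subseteq> A" "independent C" "A \<subseteq> span C" "card C = dim A"
    using basis_exists by blast
  obtain D where D: "D \<subseteq> B" "independent D" "B \<subseteq> span D" "card D = dim B"
    using basis_exists by blast
  have "finite C" "finite D"
    using independent_span_bound[OF \<open>finite W\<close> C(2)] C(1) assms(1)
      independent_span_bound[OF \<open>finite W\<close> D(2)] D(1) assms(2) by (meson order.trans)+
  moreover have "A \<union> B \<subseteq> span (C \<union> D)"
    using C(3) D(3) span_mono[of C "C \<union> D"] span_mono[of D "C \<union> D"] by blast
  ultimately have "dim (A \<union> B) \<le> card (C \<union> D)"
    using dim_le_card by blast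
  then show ?thesis
    using card_Un_le[of C D] C(4) D(4) by linarith
qed

lemma rank_nullity:
  assumes f: "Vector_Spaces.linear scale scale f" and S: "subspace S"
    and fin: "S \<subseteq> span W" "finite W"
  shows "dim {x \<in> S. f x = 0} + dim (f ` S) = dim S"
proof -
  interpret f: Vector_Spaces.linear scale scale f by (fact f)
  define K where "K = {x \<in> S. f x = 0}"
  have "subspace K"
    unfolding K_def using S by (auto simp: subspace_def f.zero f.add f.scale)
  obtain K0 where K0: "K0 \<subseteq> K" "independent K0" "K \<subseteq> span K0" "card K0 = dim K"
    using basis_exists by blast
  have "K0 \<subseteq> S"
    using K0(1) K_def by auto
  obtain B where B: "K0 \<subseteq> B" "B \<subseteq> S" "independent B" "S \<subseteq> span B"
    using maximal_independent_subset_extend[OF \<open>K0 \<subseteq> S\<close> K0(2)] by blast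
  have finB: "finite B"
    using independent_span_bound[OF \<open>finite W\<close> B(3)] B(2) fin by blast
  have spanB: "span B = S"
    using B S by (simp add: span_subspace)
  let ?T = "B - K0"
  have kern: "x = 0" if x: "x \<in> span ?T" "f x = 0" for x
  proof -
    have "x \<in> S"
      using x(1) spanB span_mono[of ?T B] by blast
    then have "x \<in> span K0"
      using x(2) K0(3) K_def by auto
    then obtain r where r: "x = (\<Sum>v\<in>K0. scale (r v) v)"
      using span_finite[of K0] finB B(1) finite_subset by (metis (no_types, lifting) imageE)
    obtain s where s: "x = (\<Sum>v\<in>?T. scale (s v) v)"
      using x(1) span_finite[of ?T] finB by auto
    \<comment> \<open>Two expansions of \<open>x\<close> in disjoint parts of the basis \<open>B\<close> combine to a relation.\<close>
    define u where "u v = (if v \<in> K0 then r v else - s v)" for v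
    have "(\<Sum>v\<in>B. scale (u v) v) = (\<Sum>v\<in>K0. scale (u v) v) + (\<Sum>v\<in>?T. scale (u v) v)"
      using finB B(1) by (metis (no_types, lifting) add.commute sum.subset_diff)
    also have "\<dots> = x - x"
      unfolding u_def by (subst (2) s, subst r) (simp add: sum_negf)
    finally have "\<forall>v\<in>B. u v = 0"
      using independentD[OF B(3) finB subset_refl] by auto
    then have "\<forall>v\<in>K0. r v = 0"
      using B(1) unfolding u_def by (metis subsetD)
    then show "x = 0"
      using r by simp
  qed
  have inj: "inj_on f (span ?T)"
    using f.inj_on_iff_eq_0[OF subspace_span[of ?T]] kern by blast
  have indT: "independent ?T"
    using B(3) independent_mono by blast
  have ind: "independent (f ` ?T)"
    by (rule f.independent_injective_image[OF indT inj])
  have "f ` S \<subseteq> span (f ` ?T)"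
  proof
    fix y assume "y \<in> f ` S"
    then obtain x where x: "x \<in> span B" "y = f x"
      using spanB by auto
    then have "y \<in> span (f ` B)"
      by (simp add: f.span_image)
    moreover have "f ` B \<subseteq> span (f ` ?T)"
    proof
      fix z assume "z \<in> f ` B"
      then obtain v where v: "v \<in> B" "z = f v" by auto
      show "z \<in> span (f ` ?T)"
        using v K0(1) by (cases "v \<in> K0") (auto simp: K_def span_zero intro: span_base)
    qed
    ultimately show "y \<in> span (f ` ?T)"
      by (meson span_minimal subspace_span subsetD)
  qed
  then have "dim (f ` S) = card (f ` ?T)"
    using B(2) ind by (intro dim_unique[of "f ` ?T"]) auto
  also have "\<dots> = card ?T"
    using inj by (intro card_image) (meson inj_on_subset span_superset)
  also have "\<dots> = card B - card K0"
    using finB B(1) by (meson card_Diff_subset finite_subset)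
  finally show ?thesis
    using B K0(4) card_mono[OF finB B(1)] basis_card_eq_dim[OF B(2,4,3)]
    unfolding K_def[symmetric] by linarith
qed

text \<open>
  Linear projections with prescribed kernel stand in for quotient spaces.
\<close>

lemma exists_linear_kernel:
  assumes "subspace U"
  obtains p where "Vector_Spaces.linear scale scale p" "\<And>x. p x = 0 \<longleftrightarrow> x \<in> U"
proof -
  interpret vp: vector_space_pair scale scale ..
  have id: "Vector_Spaces.linear scale scale (\<lambda>x. x)"
    using vector_space_axioms by (simp add: Vector_Spaces.linear_iff)
  obtain g where g: "g ` UNIV \<subseteq> U" "Vector_Spaces.linear scale scale g" "\<forall>v\<in>U. g v = v"
    using vp.linear_exists_left_inverse_on[OF id assms] by auto
  have "Vector_Spaces.linear scale scale (\<lambda>x. x - g x)"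
    by (rule vp.linear_compose_sub[OF id g(2)])
  moreover have "x - g x = 0 \<longleftrightarrow> x \<in> U" for x
    using g(1,3) by (metis eq_iff_diff_eq_0 rangeI subsetD)
  ultimately show ?thesis
    using that by blast
qed

text \<open>
  Independence is tested with coefficients indexed by \<open>S\<close>, since integral relations in a group
  are indexed by group elements and not by their images.
\<close>

lemma independent_family:
  assumes "finite S" and ind: "\<And>q. (\<Sum>x\<in>S. scale (q x) (v x)) = 0 \<Longrightarrow> \<forall>x\<in>S. q x = 0"
  shows "inj_on v S" "independent (v ` S)"
proof -
  show inj: "inj_on v S"
  proof (rule inj_onI, rule ccontr)
    fix x y assume xy: "x \<in> S" "y \<in> S" "v x = v y" "x \<noteq> y"
    define q where "q z = (if z = x then 1 else if z = y then -1 else (0::'a))" for z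
    have "(\<Sum>z\<in>S. scale (q z) (v z)) = (\<Sum>z\<in>{x, y}. scale (q z) (v z))"
      using xy assms(1) by (intro sum.mono_neutral_right) (auto simp: q_def)
    also have "\<dots> = 0"
      using xy by (simp add: q_def)
    finally show False
      using ind[of q] xy(1) by (auto simp: q_def)
  qed
  show "independent (v ` S)"
  proof
    assume "dependent (v ` S)"
    then obtain u where u: "\<exists>w\<in>v ` S. u w \<noteq> 0" "(\<Sum>w\<in>v ` S. scale (u w) w) = 0"
      using dependent_finite[of "v ` S"] assms(1) by auto
    then have "(\<Sum>x\<in>S. scale (u (v x)) (v x)) = 0"
      by (simp add: sum.reindex[OF inj])
    then show False
      using ind[of "u \<circ> v"] u(1) by auto
  qed
qed

end

lemma common_denominator:
  fixes q :: "'a \<Rightarrow> rat"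
  assumes "finite S"
  obtains N :: int and m where "N > 0" "\<And>x. x \<in> S \<Longrightarrow> of_int N * q x = of_int (m x)"
proof -
  have "\<exists>N>0. \<forall>x\<in>S. \<exists>m. of_int N * q x = (of_int m :: rat)"
    using assms
  proof (induction S)
    case empty
    show ?case by (rule exI[of _ 1]) auto
  next
    case (insert a S)
    then obtain N where N: "N > 0" "\<forall>x\<in>S. \<exists>m. of_int N * q x = of_int m" by auto
    obtain c d where cd: "q a = of_int c / of_int d" "d > 0"
      by (metis Rat_cases Fract_of_int_quotient)
    have "\<exists>m. of_int (d * N) * q x = of_int m" if "x \<in> insert a S" for x
    proof (cases "x = a")
      case True
      then show ?thesis
        using cd by (intro exI[of _ "N * c"]) (simp add: field_simps)
    next
      case False
      then obtain m where "of_int N * q x = of_int m"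
        using N(2) \<open>x \<in> insert a S\<close> by auto
      then show ?thesis
        by (intro exI[of _ "d * m"]) (simp add: mult.assoc)
    qed
    then show ?case
      using N(1) cd(2) by (intro exI[of _ "d * N"]) auto
  qed
  then show ?thesis
    using that by metis
qed

locale rational_space = vector_space scale for scale :: "rat \<Rightarrow> 'v::ab_group_add \<Rightarrow> 'v"
begin

text \<open>
  An additive map to a rational vector space whose kernel is the torsion subgroup turns integral
  independence into linear independence: a rational relation among the images becomes integral
  after clearing denominators, hence holds in the group up to torsion, and multiplying it by the
  order of that torsion element gives an honest relation. All ranks below are computed this way.
\<close>

lemma group_rank_eq_dim:
  assumes "comm_group G"
    and add: "\<And>x y. x \<in> carrier G \<Longrightarrow> y \<in> carrier G \<Longrightarrow> \<Psi> (x \<otimes>\<^bsub>G\<^esub> y) = \<Psi> x + \<Psi> y"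
    and tors: "\<And>x. x \<in> carrier G \<Longrightarrow> \<Psi> x = 0 \<Longrightarrow> \<exists>n>0. x [^]\<^bsub>G\<^esub> (n::int) = \<one>\<^bsub>G\<^esub>"
    and fin: "\<Psi> ` carrier G \<subseteq> span W" "finite W"
  shows "group_rank G = enat (dim (\<Psi> ` carrier G))"
proof -
  interpret G: comm_group G by (fact assms(1))
  have one: "\<Psi> \<one>\<^bsub>G\<^esub> = 0"
    using add[of "\<one>\<^bsub>G\<^esub>" "\<one>\<^bsub>G\<^esub>"] by simp
  have inv: "\<Psi> (inv\<^bsub>G\<^esub> x) = - \<Psi> x" if "x \<in> carrier G" for x
    using add[of x "inv\<^bsub>G\<^esub> x"] that one by (simp add: eq_neg_iff_add_eq_0 add.commute)
  have npow: "\<Psi> (x [^]\<^bsub>G\<^esub> (n::nat)) = scale (of_nat n) (\<Psi> x)" if "x \<in> carrier G" for x n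
    by (induction n) (use that one in \<open>auto simp: add scale_left_distrib\<close>)
  have pow: "\<Psi> (x [^]\<^bsub>G\<^esub> (n::int)) = scale (of_int n) (\<Psi> x)" if "x \<in> carrier G" for x n
  proof (cases n)
    case (neg k)
    then show ?thesis
      using that by (simp only: G.int_pow_neg int_pow_int inv npow G.nat_pow_closed)
        (simp flip: scale_minus_left)
  qed (use that in \<open>simp add: npow int_pow_int\<close>)
  have fprod: "\<Psi> (finprod G g S) = (\<Sum>x\<in>S. \<Psi> (g x))" if "finite S" "g \<in> S \<rightarrow> carrier G" for g S
    using that by (induction S) (auto simp: one add Pi_iff G.finprod_closed)
  have indep: "inj_on \<Psi> S" "independent (\<Psi> ` S)" if "int_independent G S" for S
  proof -
    have S: "finite S" "S \<subseteq> carrier G"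
      and ind: "\<And>n::_\<Rightarrow>int. finprod G (\<lambda>x. x [^]\<^bsub>G\<^esub> n x) S = \<one>\<^bsub>G\<^esub> \<Longrightarrow> (\<forall>x\<in>S. n x = 0)"
      using that by (auto simp: int_independent_def)
    have "\<forall>x\<in>S. q x = 0" if q: "(\<Sum>x\<in>S. scale (q x) (\<Psi> x)) = 0" for q
    proof -
      obtain N m where Nm: "N > 0" "\<And>x. x \<in> S \<Longrightarrow> of_int N * q x = of_int (m x)"
        using common_denominator[OF S(1), of q] by metis
      have "(\<Sum>x\<in>S. scale (of_int (m x)) (\<Psi> x)) = (\<Sum>x\<in>S. scale (of_int N) (scale (q x) (\<Psi> x)))"
        using Nm(2) by (intro sum.cong) auto
      also have "\<dots> = 0"
        using q by (simp only: scale_sum_right[symmetric] scale_zero_right)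
      finally have "\<Psi> (finprod G (\<lambda>x. x [^]\<^bsub>G\<^esub> m x) S) = 0"
        using S by (subst fprod) (auto simp: pow subset_iff)
      then obtain n :: int where n: "n > 0" "finprod G (\<lambda>x. x [^]\<^bsub>G\<^esub> m x) S [^]\<^bsub>G\<^esub> n = \<one>\<^bsub>G\<^esub>"
        using tors[of "finprod G (\<lambda>x. x [^]\<^bsub>G\<^esub> m x) S"] S by (force intro: G.finprod_closed)
      have "finprod G (\<lambda>x. x [^]\<^bsub>G\<^esub> (m x * n)) S = finprod G (\<lambda>x. (x [^]\<^bsub>G\<^esub> m x) [^]\<^bsub>G\<^esub> n) S"
        using S by (intro G.finprod_cong') (auto simp: G.int_pow_pow)
      also have "\<dots> = finprod G (\<lambda>x. x [^]\<^bsub>G\<^esub> m x) S [^]\<^bsub>G\<^esub> n"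
        using S
      proof (induction S)
        case (insert a S)
        then have "(\<lambda>x. x [^]\<^bsub>G\<^esub> m x) \<in> S \<rightarrow> carrier G" "(\<lambda>x. (x [^]\<^bsub>G\<^esub> m x) [^]\<^bsub>G\<^esub> n) \<in> S \<rightarrow> carrier G"
          by auto
        then show ?case
          using insert by (simp add: G.int_pow_distrib)
      qed simp
      finally have "\<forall>x\<in>S. m x * n = 0"
        using n(2) ind[of "\<lambda>x. m x * n"] by simp
      then show ?thesis
        using Nm n(1) by fastforce
    qed
    then show "inj_on \<Psi> S" "independent (\<Psi> ` S)"
      using independent_family[OF S(1), of \<Psi>] by blast+
  qed
  have upper: "enat (card S) \<le> enat (dim (\<Psi> ` carrier G))" if S: "int_independent G S" for S
  proof -
    have "card S = dim (\<Psi> ` S)"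
      using indep[OF S] by (simp add: card_image dim_eq_card_independent)
    also have "\<dots> \<le> dim (\<Psi> ` carrier G)"
      using S fin by (intro dim_mono_finite[of _ _ W])
        (auto simp: int_independent_def intro!: span_base)
    finally show ?thesis by simp
  qed
  obtain T where T: "T \<subseteq> \<Psi> ` carrier G" "independent T" "card T = dim (\<Psi> ` carrier G)"
    by (rule basis_exists[of "\<Psi> ` carrier G"])
  obtain S where S: "S \<subseteq> carrier G" "inj_on \<Psi> S" "T = \<Psi> ` S"
    using T(1) by (meson subset_image_inj)
  have finS: "finite S"
    using independent_span_bound[OF fin(2) T(2)] T(1) fin(1) S finite_image_iff
    by (metis order.trans)
  have "int_independent G S"
    unfolding int_independent_def
  proof (intro conjI allI impI finS S(1))
    fix n :: "_ \<Rightarrow> int" assume "finprod G (\<lambda>x. x [^]\<^bsub>G\<^esub> n x) S = \<one>\<^bsub>G\<^esub>"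
    then have "0 = \<Psi> (finprod G (\<lambda>x. x [^]\<^bsub>G\<^esub> n x) S)"
      using one by simp
    also have "\<dots> = (\<Sum>x\<in>S. scale (of_int (n x)) (\<Psi> x))"
      using S finS by (subst fprod) (auto simp: pow subset_iff)
    also have "\<dots> = (\<Sum>w\<in>T. scale (of_int (n (the_inv_into S \<Psi> w))) w)"
      by (simp add: S(3) sum.reindex[OF S(2)] the_inv_into_f_f[OF S(2)])
    finally have "of_int (n (the_inv_into S \<Psi> w)) = (0::rat)" if "w \<in> T" for w
      using independentD[OF T(2), of T "\<lambda>w. of_int (n (the_inv_into S \<Psi> w))"] that finS S(3)
      by force
    then show "\<forall>x\<in>S. n x = 0"
      using S(2,3) by (force simp: the_inv_into_f_f)
  qed
  moreover have "card S = dim (\<Psi> ` carrier G)"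
    using S T by (metis card_image)
  ultimately show ?thesis
    unfolding group_rank_def using upper
    by (intro antisym SUP_least SUP_upper2[of S]) auto
qed

end

section \<open>Creation and annihilation operators on the exterior algebra\<close>

text \<open>
  The linear extension of a function on generators, with values in any commutative ring: integers
  for the values of forms, rationals for coordinates.
\<close>

definition frag_linear :: "('a \<Rightarrow> 'r::comm_ring_1) \<Rightarrow> ('a \<Rightarrow>\<^sub>0 int) \<Rightarrow> 'r" where
  "frag_linear f c = (\<Sum>x\<in>Poly_Mapping.keys c. of_int (Poly_Mapping.lookup c x) * f x)"

lemma frag_linear_superset:
  assumes "finite A" "Poly_Mapping.keys c \<subseteq> A"
  shows "frag_linear f c = (\<Sum>x\<in>A. of_int (Poly_Mapping.lookup c x) * f x)"
  unfolding frag_linear_def using assms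
  by (intro sum.mono_neutral_left) (auto simp: in_keys_iff)

lemma frag_linear_0 [simp]: "frag_linear f 0 = 0"
  by (simp add: frag_linear_def)

lemma frag_linear_of [simp]: "frag_linear f (frag_of x) = f x"
  by (simp add: frag_linear_def)

lemma frag_linear_add [simp]: "frag_linear f (c + d) = frag_linear f c + frag_linear f d"
proof -
  let ?A = "Poly_Mapping.keys c \<union> Poly_Mapping.keys d"
  have "Poly_Mapping.keys (c + d) \<subseteq> ?A"
    by (rule keys_add)
  then show ?thesis
    by (simp add: frag_linear_superset[of ?A] lookup_add distrib_right sum.distrib)
qed

lemma frag_linear_minus [simp]: "frag_linear f (- c) = - frag_linear f c"
  by (simp add: frag_linear_def sum_negf)

lemma frag_linear_diff [simp]: "frag_linear f (c - d) = frag_linear f c - frag_linear f d"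
  using frag_linear_add[of f c "- d"] by simp

lemma frag_linear_cmul [simp]: "frag_linear f (frag_cmul k c) = of_int k * frag_linear f c"
  by (subst frag_linear_superset[of "Poly_Mapping.keys c"])
    (auto simp: frag_linear_def sum_distrib_left mult.assoc)

lemma frag_linear_sum: "frag_linear f (\<Sum>i\<in>I. c i) = (\<Sum>i\<in>I. frag_linear f (c i))"
  by (induction I rule: infinite_finite_induct) auto

lemma frag_linear_extend: "frag_linear f (frag_extend g c) = frag_linear (\<lambda>x. frag_linear f (g x)) c"
  by (simp add: frag_extend_def frag_linear_sum) (simp add: frag_linear_def)

lemma frag_linear_cong:
  "(\<And>x. x \<in> Poly_Mapping.keys c \<Longrightarrow> f x = g x) \<Longrightarrow> frag_linear f c = frag_linear g c"
  by (simp add: frag_linear_def)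

lemma frag_eval_eq_linear: "frag_eval = frag_linear"
  by (simp add: fun_eq_iff frag_eval_def frag_linear_def)

text \<open>
  Rational coordinates on the exterior algebra of a free group with basis \<open>e\<^sub>0, e\<^sub>1, \<dots>\<close>: the
  function \<open>F\<close> stands for the sum of \<open>F S\<close> times \<open>e\<^sub>S\<close>, where \<open>e\<^sub>S\<close> is the wedge of the \<open>e\<^sub>i\<close> with
  \<open>i \<in> S\<close> in increasing order. Left multiplication by a vector and contraction with a covector
  are the creation and annihilation operators of a fermionic Fock space, which gives the exterior
  relations without any determinant.
\<close>

type_synonym fock = "nat set \<Rightarrow> rat"

text \<open>
  The sign of moving \<open>e\<^sub>i\<close> from the front to its place in \<open>e\<^sub>S\<close>.
\<close>

definition shuffle_sign :: "nat \<Rightarrow> nat set \<Rightarrow> rat" where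
  "shuffle_sign i S = (-1) ^ card {j \<in> S. j < i}"

text \<open>
  Left multiplication by the vector with coordinates \<open>v\<close>.
\<close>

definition create :: "nat \<Rightarrow> (nat \<Rightarrow> int) \<Rightarrow> fock \<Rightarrow> fock" where
  "create b v F = (\<lambda>S. \<Sum>i<b. of_int (v i) * (if i \<in> S then shuffle_sign i S * F (S - {i}) else 0))"

text \<open>
  Contraction with the covector with coordinates \<open>w\<close>.
\<close>

definition annihilate :: "nat \<Rightarrow> (nat \<Rightarrow> int) \<Rightarrow> fock \<Rightarrow> fock" where
  "annihilate b w F = (\<lambda>S. \<Sum>i<b. of_int (w i) * (if i \<in> S then 0 else shuffle_sign i S * F (insert i S)))"

definition vacuum :: fock where
  "vacuum = (\<lambda>S. if S = {} then 1 else 0)"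

lemma shuffle_sign_insert:
  assumes "j \<notin> S"
  shows "shuffle_sign i (insert j S) = (if j < i then - shuffle_sign i S else shuffle_sign i S)"
proof -
  have "{k \<in> insert j S. k < i} = (if j < i then insert j {k \<in> S. k < i} else {k \<in> S. k < i})"
    by auto
  then show ?thesis
    using assms by (auto simp: shuffle_sign_def)
qed

lemma shuffle_sign_remove:
  assumes "j \<in> S"
  shows "shuffle_sign i (S - {j}) = (if j < i then - shuffle_sign i S else shuffle_sign i S)"
  using shuffle_sign_insert[of j "S - {j}" i] assms by (auto simp: insert_absorb)

lemma shuffle_sign_self [simp]: "shuffle_sign i S * (shuffle_sign i S * x) = x"
  by (simp add: shuffle_sign_def flip: mult.assoc power_mult_distrib)

text \<open>
  The contributions of \<open>(i, j)\<close> and \<open>(j, i)\<close> remove the same two indices, and the two signs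
  differ because the smaller index is counted in exactly one of the two orders.
\<close>

lemma create_create_swap: "create b v (create b w F) = - create b w (create b v F)"
proof
  fix S
  define t where "t i j = (if i \<in> S \<and> j \<in> S \<and> i \<noteq> j then
      shuffle_sign i S * (shuffle_sign j (S - {i}) * F (S - {i} - {j})) else 0)" for i j
  have anti: "t i j = - t j i" for i j
    by (cases "i < j") (auto simp: t_def shuffle_sign_remove insert_commute Diff_insert2[symmetric])
  have expand: "create b v (create b w F) S = (\<Sum>i<b. \<Sum>j<b. of_int (v i) * of_int (w j) * t i j)" for v w
    unfolding create_def sum_distrib_left
    by (auto simp: t_def sum_distrib_left mult_ac intro!: sum.cong)
  have "create b v (create b w F) S = (\<Sum>j<b. \<Sum>i<b. of_int (v i) * of_int (w j) * t i j)"
    unfolding expand by (rule sum.swap)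
  also have "\<dots> = - (\<Sum>j<b. \<Sum>i<b. of_int (w j) * of_int (v i) * t j i)"
    by (subst anti) (simp add: sum_negf mult_ac)
  finally show "create b v (create b w F) S = (- create b w (create b v F)) S"
    by (simp add: expand)
qed

lemma annihilate_annihilate_swap:
  "annihilate b v (annihilate b w F) = - annihilate b w (annihilate b v F)"
proof
  fix S
  define t where "t i j = (if i \<notin> S \<and> j \<notin> S \<and> i \<noteq> j then
      shuffle_sign i S * (shuffle_sign j (insert i S) * F (insert j (insert i S))) else 0)" for i j
  have anti: "t i j = - t j i" for i j
    by (cases "i < j") (auto simp: t_def shuffle_sign_insert insert_commute)
  have expand: "annihilate b v (annihilate b w F) S = (\<Sum>i<b. \<Sum>j<b. of_int (v i) * of_int (w j) * t i j)" for v w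
    unfolding annihilate_def sum_distrib_left
    by (auto simp: t_def sum_distrib_left mult_ac intro!: sum.cong)
  have "annihilate b v (annihilate b w F) S = (\<Sum>j<b. \<Sum>i<b. of_int (v i) * of_int (w j) * t i j)"
    unfolding expand by (rule sum.swap)
  also have "\<dots> = - (\<Sum>j<b. \<Sum>i<b. of_int (w j) * of_int (v i) * t j i)"
    by (subst anti) (simp add: sum_negf mult_ac)
  finally show "annihilate b v (annihilate b w F) S = (- annihilate b w (annihilate b v F)) S"
    by (simp add: expand)
qed

text \<open>
  The canonical anticommutation relation. Off the diagonal the two orders of inserting \<open>i\<close> and
  removing \<open>j\<close> cancel; on the diagonal exactly one of the two orders is possible.
\<close>

lemma annihilate_create:
  "annihilate b w (create b v F) S = of_int (\<Sum>i<b. w i * v i) * F S - create b v (annihilate b w F) S"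
proof -
  define t where "t i j = (if i \<notin> S \<and> j \<in> insert i S then
      shuffle_sign i S * (shuffle_sign j (insert i S) * F (insert i S - {j})) else 0)" for i j
  define u where "u j i = (if j \<in> S \<and> i \<notin> S - {j} then
      shuffle_sign j S * (shuffle_sign i (S - {j}) * F (insert i (S - {j}))) else 0)" for i j
  have tu: "t i j + u j i = (if i = j then F S else 0)" for i j
  proof (cases "i = j")
    case True
    then show ?thesis
      by (auto simp: t_def u_def shuffle_sign_insert shuffle_sign_remove insert_absorb)
  next
    case False
    show ?thesis
    proof (cases "i \<notin> S \<and> j \<in> S")
      case True
      then have "insert i S - {j} = insert i (S - {j})"
        using False by auto
      then show ?thesis
        using True False by (auto simp: t_def u_def shuffle_sign_insert shuffle_sign_remove)
    qed (use False in \<open>auto simp: t_def u_def\<close>)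
  qed
  have 1: "annihilate b w (create b v F) S = (\<Sum>i<b. \<Sum>j<b. of_int (w i) * of_int (v j) * t i j)"
    unfolding annihilate_def create_def sum_distrib_left
    by (auto simp: t_def sum_distrib_left mult_ac intro!: sum.cong)
  have "create b v (annihilate b w F) S = (\<Sum>j<b. \<Sum>i<b. of_int (w i) * of_int (v j) * u j i)"
    unfolding annihilate_def create_def sum_distrib_left
    by (auto simp: u_def sum_distrib_left mult_ac intro!: sum.cong)
  then have 2: "create b v (annihilate b w F) S = (\<Sum>i<b. \<Sum>j<b. of_int (w i) * of_int (v j) * u j i)"
    by (subst sum.swap)
  have "annihilate b w (create b v F) S + create b v (annihilate b w F) S =
      (\<Sum>i<b. \<Sum>j<b. of_int (w i) * of_int (v j) * (t i j + u j i))"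
    by (simp add: 1 2 distrib_left sum.distrib)
  also have "\<dots> = (\<Sum>i<b. of_int (w i) * of_int (v i) * F S)"
    by (simp add: tu if_distrib cong: if_cong)
  also have "\<dots> = of_int (\<Sum>i<b. w i * v i) * F S"
    by (simp add: sum_distrib_right)
  finally show ?thesis by simp
qed

lemma create_square [simp]: "create b v (create b v F) = 0"
proof
  fix S
  show "create b v (create b v F) S = 0 S"
    using fun_cong[OF create_create_swap[of b v v F], of S] by simp
qed

lemma annihilate_square [simp]: "annihilate b v (annihilate b v F) = 0"
proof
  fix S
  show "annihilate b v (annihilate b v F) S = 0 S"
    using fun_cong[OF annihilate_annihilate_swap[of b v v F], of S] by simp
qed

lemma create_0 [simp]: "create b v 0 = 0"
  by (simp add: create_def fun_eq_iff cong: if_cong)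

lemma annihilate_0 [simp]: "annihilate b v 0 = 0"
  by (simp add: annihilate_def fun_eq_iff cong: if_cong)

lemma create_uminus [simp]: "create b v (- F) = - create b v F"
  by (simp add: create_def fun_eq_iff sum_negf[symmetric] if_distrib cong: if_cong)

lemma annihilate_uminus [simp]: "annihilate b v (- F) = - annihilate b v F"
  by (simp add: annihilate_def fun_eq_iff sum_negf[symmetric] if_distrib cong: if_cong)

lemma create_add [simp]: "create b v (F + G) = create b v F + create b v G"
  by (simp add: create_def fun_eq_iff sum.distrib[symmetric]) (auto intro!: sum.cong simp: algebra_simps)

lemma annihilate_add [simp]: "annihilate b v (F + G) = annihilate b v F + annihilate b v G"
  by (simp add: annihilate_def fun_eq_iff sum.distrib[symmetric]) (auto intro!: sum.cong simp: algebra_simps)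

text \<open>
  Anticommuting operators of square zero kill every word with a repeated letter. Applied to
  creation operators this shows that coordinates respect the exterior relations of \<open>H\<close>; applied to
  annihilation operators, that contraction respects those of the dual group.
\<close>

lemma foldr_repeated_letter:
  fixes op :: "'x \<Rightarrow> fock \<Rightarrow> fock"
  assumes "\<And>x y F. op x (op y F) = - op y (op x F)" "\<And>x F. op x (op x F) = 0"
    and "\<And>x. op x 0 = 0" "\<And>x F. op x (- F) = - op x F"
  shows "foldr op (xs @ x # ys @ x # zs) F = 0"
proof -
  have "op x (foldr op (ys @ x # zs) F) = 0"
  proof (induction ys)
    case (Cons y ys)
    have "op x (op y (foldr op (ys @ x # zs) F)) = - op y (op x (foldr op (ys @ x # zs) F))"
      by (rule assms(1))
    then show ?case
      unfolding Cons assms(3) by (simp del: foldr_append)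
  qed (simp add: assms(2))
  moreover have "foldr op xs 0 = 0"
    by (induction xs) (simp_all only: foldr.simps id_apply o_apply assms(3))
  ultimately show ?thesis by simp
qed

section \<open>Coordinates on exterior powers\<close>

definition wedge_class :: "('h, 'm) monoid_scheme \<Rightarrow> int \<Rightarrow> ('h list \<Rightarrow>\<^sub>0 int) \<Rightarrow> ('h list \<Rightarrow>\<^sub>0 int) set" where
  "wedge_class H l c = wedge_relations H l #>\<^bsub>wedge_chains H l\<^esub> c"

lemma wedge_relations_gens_subset:
  assumes "monoid H"
  shows "{frag_of (xs @ (x \<otimes>\<^bsub>H\<^esub> y) # ys) - frag_of (xs @ x # ys) - frag_of (xs @ y # ys) | xs x y ys.
         xs @ x # ys \<in> wedge_words H l \<and> xs @ y # ys \<in> wedge_words H l} \<union>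
      {frag_of (xs @ x # ys @ x # zs) | xs x ys zs. xs @ x # ys @ x # zs \<in> wedge_words H l}
    \<subseteq> carrier (wedge_chains H l)"
proof -
  interpret monoid H by (fact assms)
  have "xs @ (x \<otimes>\<^bsub>H\<^esub> y) # ys \<in> wedge_words H l"
    if "xs @ x # ys \<in> wedge_words H l" "xs @ y # ys \<in> wedge_words H l" for xs x y ys
    using that by (auto simp: wedge_words_def)
  then show ?thesis
    by (auto dest!: subsetD[OF keys_diff])
qed

lemma subgroup_wedge_relations:
  assumes "monoid H"
  shows "subgroup (wedge_relations H l) (wedge_chains H l)"
  unfolding wedge_relations_def
  by (intro group.generate_is_subgroup group_free_Abelian_group wedge_relations_gens_subset assms)

lemma wedge_relations_closed:
  assumes "monoid H"
  shows "0 \<in> wedge_relations H l"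
    and "c \<in> wedge_relations H l \<Longrightarrow> Poly_Mapping.keys c \<subseteq> wedge_words H l"
    and "c \<in> wedge_relations H l \<Longrightarrow> d \<in> wedge_relations H l \<Longrightarrow> c + d \<in> wedge_relations H l"
    and "c \<in> wedge_relations H l \<Longrightarrow> - c \<in> wedge_relations H l"
    and "c \<in> wedge_relations H l \<Longrightarrow> d \<in> wedge_relations H l \<Longrightarrow> c - d \<in> wedge_relations H l"
proof -
  interpret subgroup "wedge_relations H l" "wedge_chains H l"
    by (rule subgroup_wedge_relations[OF assms])
  show "0 \<in> wedge_relations H l"
    using one_closed by simp
  show keys: "Poly_Mapping.keys c \<subseteq> wedge_words H l" if "c \<in> wedge_relations H l" for c
    using mem_carrier[OF that] by simp
  show add: "c + d \<in> wedge_relations H l" if "c \<in> wedge_relations H l" "d \<in> wedge_relations H l" for c d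
    using m_closed[OF that] by simp
  show neg: "- c \<in> wedge_relations H l" if "c \<in> wedge_relations H l" for c
    using m_inv_closed[OF that] keys[OF that] by simp
  show "c - d \<in> wedge_relations H l" if "c \<in> wedge_relations H l" "d \<in> wedge_relations H l" for c d
    using add[OF that(1) neg[OF that(2)]] by simp
qed

lemma mem_wedge_class:
  assumes "monoid H"
  shows "d \<in> wedge_class H l c \<longleftrightarrow> d - c \<in> wedge_relations H l"
proof -
  have "d \<in> wedge_class H l c \<longleftrightarrow> (\<exists>r\<in>wedge_relations H l. d = r + c)"
    by (auto simp: wedge_class_def r_coset_def)
  then show ?thesis
    by (metis diff_add_cancel add_diff_cancel_right')
qed

lemma wedge_class_eq_iff:
  assumes "monoid H"
  shows "wedge_class H l c = wedge_class H l d \<longleftrightarrow> c - d \<in> wedge_relations H l"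
proof
  assume "wedge_class H l c = wedge_class H l d"
  then show "c - d \<in> wedge_relations H l"
    using mem_wedge_class[OF assms, of c l c] mem_wedge_class[OF assms, of c l d]
      wedge_relations_closed(1)[OF assms, of l] by simp
next
  assume cd: "c - d \<in> wedge_relations H l"
  have "x - c \<in> wedge_relations H l \<longleftrightarrow> x - d \<in> wedge_relations H l" for x
    using wedge_relations_closed(3,5)[OF assms _ cd, of "x - c"]
      wedge_relations_closed(5)[OF assms _ cd, of "x - d"] by auto
  then show "wedge_class H l c = wedge_class H l d"
    by (auto simp: mem_wedge_class[OF assms])
qed

lemma carrier_ext_power: "carrier (ext_power H l) = wedge_class H l ` carrier (wedge_chains H l)"
  by (auto simp: ext_power_def FactGroup_def RCOSETS_def wedge_class_def)

lemma ext_powerE: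
  assumes "A \<in> carrier (ext_power H l)"
  obtains c where "Poly_Mapping.keys c \<subseteq> wedge_words H l" "A = wedge_class H l c"
  using assms by (auto simp: carrier_ext_power)

lemma wedge_class_in_ext_power:
  "Poly_Mapping.keys c \<subseteq> wedge_words H l \<Longrightarrow> wedge_class H l c \<in> carrier (ext_power H l)"
  by (auto simp: carrier_ext_power)

lemma normal_wedge_relations:
  assumes "monoid H"
  shows "wedge_relations H l \<lhd> wedge_chains H l"
  by (rule comm_group.normal_iff_subgroup[THEN iffD2, OF abelian_free_Abelian_group
        subgroup_wedge_relations[OF assms]])

lemma comm_group_ext_power:
  assumes "monoid H"
  shows "comm_group (ext_power H l)"
  unfolding ext_power_def
  by (intro comm_group.abelian_FactGroup abelian_free_Abelian_group subgroup_wedge_relations assms)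

lemma mult_wedge_class:
  assumes "monoid H" "Poly_Mapping.keys c \<subseteq> wedge_words H l" "Poly_Mapping.keys d \<subseteq> wedge_words H l"
  shows "wedge_class H l c \<otimes>\<^bsub>ext_power H l\<^esub> wedge_class H l d = wedge_class H l (c + d)"
  using normal.rcos_sum[OF normal_wedge_relations[OF assms(1)], of c l d] assms
  by (simp add: ext_power_def wedge_class_def)

lemma one_ext_power:
  assumes "monoid H"
  shows "\<one>\<^bsub>ext_power H l\<^esub> = wedge_class H l 0"
  using mem_wedge_class[OF assms, of _ l 0] by (auto simp: ext_power_def)

text \<open>
  The universal property of exterior powers in the form used throughout: to be well defined on
  classes, a function on words has to be additive in each letter and to vanish on repetitions.
\<close>

lemma frag_linear_wedge_relation:
  fixes f :: "'h list \<Rightarrow> 'r::comm_ring_1"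
  assumes "monoid H"
    and add: "\<And>xs x y ys. xs @ x # ys \<in> wedge_words H l \<Longrightarrow> xs @ y # ys \<in> wedge_words H l \<Longrightarrow>
      f (xs @ (x \<otimes>\<^bsub>H\<^esub> y) # ys) = f (xs @ x # ys) + f (xs @ y # ys)"
    and alt: "\<And>xs x ys zs. xs @ x # ys @ x # zs \<in> wedge_words H l \<Longrightarrow> f (xs @ x # ys @ x # zs) = 0"
    and r: "r \<in> wedge_relations H l"
  shows "frag_linear f r = 0"
  using r wedge_relations_gens_subset[OF assms(1), of l] unfolding wedge_relations_def
proof (induction rule: generate.induct)
  case (incl h)
  then show ?case by (auto simp: add alt)
next
  case (inv h)
  then have "Poly_Mapping.keys h \<subseteq> wedge_words H l"
    by (meson carrier_free_Abelian_group_iff subsetD)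
  then show ?case
    using inv(1) by (auto simp: add alt)
qed auto

text \<open>
  A free abelian group of finite rank, given by a basis \<open>e\<close> together with its coordinate functions.
  Generation is expressed by subgroups, so that a property of all elements follows once it is
  closed under the group operations and holds for the basis.
\<close>

locale based_group = comm_group G for G (structure) +
  fixes b :: nat and e :: "nat \<Rightarrow> 'a" and co :: "nat \<Rightarrow> 'a \<Rightarrow> int"
  assumes basis_closed: "i < b \<Longrightarrow> e i \<in> carrier G"
    and coord_mult: "i < b \<Longrightarrow> x \<in> carrier G \<Longrightarrow> y \<in> carrier G \<Longrightarrow> co i (x \<otimes> y) = co i x + co i y"
    and coord_basis: "i < b \<Longrightarrow> j < b \<Longrightarrow> co i (e j) = (if i = j then 1 else 0)"
    and basis_generates: "\<And>K. subgroup K G \<Longrightarrow> (\<And>i. i < b \<Longrightarrow> e i \<in> K) \<Longrightarrow> carrier G \<subseteq> K"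
begin

definition index_sets :: "int \<Rightarrow> nat set set" where
  "index_sets l = {S. S \<subseteq> {..<b} \<and> int (card S) = l}"

definition basis_word :: "nat set \<Rightarrow> 'a list" where
  "basis_word S = map e (sorted_list_of_set S)"

definition word_coords :: "'a list \<Rightarrow> fock" where
  "word_coords xs = foldr (\<lambda>x. create b (\<lambda>i. co i x)) xs vacuum"

definition chain_coords :: "('a list \<Rightarrow>\<^sub>0 int) \<Rightarrow> fock" where
  "chain_coords c = (\<lambda>S. frag_linear (\<lambda>xs. word_coords xs S) c)"

lemma finite_index_sets [simp]: "finite (index_sets l)"
  by (simp add: index_sets_def)

lemma basis_word_in_words: "S \<in> index_sets l \<Longrightarrow> basis_word S \<in> wedge_words G l"
  using basis_closed finite_subset[of S "{..<b}"]
  by (auto simp: index_sets_def basis_word_def wedge_words_def subset_iff)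

lemma chain_coords_simps [simp]:
  "chain_coords 0 = 0" "chain_coords (c + d) = chain_coords c + chain_coords d"
  "chain_coords (c - d) = chain_coords c - chain_coords d"
  "chain_coords (- c) = - chain_coords c"
  "chain_coords (frag_of xs) = word_coords xs"
  by (auto simp: chain_coords_def fun_eq_iff)

lemma word_coords_support:
  assumes "word_coords xs S \<noteq> 0"
  shows "S \<subseteq> {..<b} \<and> card S = length xs"
  using assms
proof (induction xs arbitrary: S)
  case Nil
  then show ?case by (auto simp: word_coords_def vacuum_def split: if_splits)
next
  case (Cons x xs)
  then obtain i where i: "i < b" "i \<in> S" "word_coords xs (S - {i}) \<noteq> 0"
    by (auto simp: word_coords_def create_def elim!: sum.not_neutral_contains_not_neutral split: if_splits)
  then have *: "S - {i} \<subseteq> {..<b}" "card (S - {i}) = length xs"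
    using Cons.IH by auto
  then have "S \<subseteq> {..<b}"
    using i by auto
  moreover from this have "finite S"
    using finite_subset by blast
  ultimately show ?case
    using * i card_Suc_Diff1 by fastforce
qed

lemma chain_coords_support:
  assumes "Poly_Mapping.keys c \<subseteq> wedge_words G l" "chain_coords c S \<noteq> 0"
  shows "S \<in> index_sets l"
proof -
  obtain xs where "xs \<in> Poly_Mapping.keys c" "word_coords xs S \<noteq> 0"
    using assms(2) unfolding chain_coords_def frag_linear_def
    by (auto elim!: sum.not_neutral_contains_not_neutral)
  then show ?thesis
    using assms(1) word_coords_support[of xs S] by (auto simp: index_sets_def wedge_words_def)
qed

text \<open>
  An increasing basis word is created in front of larger indices only, so no sign occurs and the
  coordinates are those of a single \<open>e\<^sub>S\<close>.
\<close>

lemma word_coords_basis: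
  assumes "S \<subseteq> {..<b}"
  shows "word_coords (basis_word S) = (\<lambda>T. if T = S then 1 else 0)"
proof -
  have "word_coords (map e is) = (\<lambda>T. if T = set is then 1 else 0)"
    if "sorted_wrt (<) is" "set is \<subseteq> {..<b}" for "is"
    using that
  proof (induction "is")
    case Nil
    then show ?case by (simp add: word_coords_def vacuum_def)
  next
    case (Cons i "is")
    have IH: "word_coords (map e is) = (\<lambda>T. if T = set is then 1 else 0)"
      using Cons by simp
    show ?case
    proof
      fix T
      have "word_coords (map e (i # is)) T =
          (\<Sum>j<b. of_int (co j (e i)) * (if j \<in> T then shuffle_sign j T * word_coords (map e is) (T - {j}) else 0))"
        unfolding word_coords_def by (simp add: create_def cong: if_cong)
      also have "\<dots> = (\<Sum>j<b. if j = i then (if i \<in> T then shuffle_sign i T * word_coords (map e is) (T - {i}) else 0) else 0)"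
        using Cons.prems by (intro sum.cong) (auto simp: coord_basis)
      also have "\<dots> = (if i \<in> T then shuffle_sign i T * word_coords (map e is) (T - {i}) else 0)"
        using Cons.prems by simp
      also have "\<dots> = (if T = set (i # is) then 1 else 0)"
      proof (cases "T = set (i # is)")
        case True
        have "{j \<in> T. j < i} = {}"
          using Cons.prems True by auto
        then have "shuffle_sign i T = 1"
          unfolding shuffle_sign_def by (simp only: card.empty power_0)
        moreover have "T - {i} = set is"
          using Cons.prems True by auto
        ultimately show ?thesis
          using True by (simp add: IH)
      qed (auto simp: IH)
      finally show "word_coords (map e (i # is)) T = (if T = set (i # is) then 1 else 0)" .
    qed
  qed
  from this[of "sorted_list_of_set S"] show ?thesis
    using assms finite_subset[of S "{..<b}"] by (simp add: basis_word_def)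
qed

lemma create_coord_mult:
  assumes "x \<in> carrier G" "y \<in> carrier G"
  shows "create b (\<lambda>i. co i (x \<otimes> y)) F = create b (\<lambda>i. co i x) F + create b (\<lambda>i. co i y) F"
  using assms by (auto simp: create_def fun_eq_iff coord_mult distrib_right simp flip: sum.distrib)

lemma chain_coords_relation:
  assumes "r \<in> wedge_relations G l"
  shows "chain_coords r = 0"
proof
  fix S
  have foldr_add: "foldr (\<lambda>x. create b (\<lambda>i. co i x)) xs (F + F') =
      foldr (\<lambda>x. create b (\<lambda>i. co i x)) xs F + foldr (\<lambda>x. create b (\<lambda>i. co i x)) xs F'" for xs F F'
    by (induction xs) (simp_all only: foldr.simps id_apply o_apply create_add)
  show "chain_coords r S = 0 S"
    unfolding chain_coords_def zero_fun_apply
  proof (rule frag_linear_wedge_relation[OF is_monoid _ _ assms])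
    fix xs x y ys assume *: "xs @ x # ys \<in> wedge_words G l" "xs @ y # ys \<in> wedge_words G l"
    then have "word_coords (xs @ (x \<otimes> y) # ys) = word_coords (xs @ x # ys) + word_coords (xs @ y # ys)"
      by (auto simp: word_coords_def create_coord_mult wedge_words_def foldr_add)
    then show "word_coords (xs @ (x \<otimes> y) # ys) S = word_coords (xs @ x # ys) S + word_coords (xs @ y # ys) S"
      by simp
  next
    fix xs x ys zs
    show "word_coords (xs @ x # ys @ x # zs) S = 0"
      unfolding word_coords_def
      by (subst foldr_repeated_letter) (auto intro: create_create_swap)
  qed
qed

text \<open>
  The class of \<open>c\<close> is an integral combination of increasing basis words. All chains have this
  property; since the coordinates read off the coefficients, they determine the class.
\<close>

definition reducible :: "int \<Rightarrow> ('a list \<Rightarrow>\<^sub>0 int) \<Rightarrow> bool" where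
  "reducible l c \<longleftrightarrow> (\<exists>n. c - (\<Sum>S\<in>index_sets l. frag_cmul (n S) (frag_of (basis_word S))) \<in> wedge_relations G l)"

lemma reducible_relation: "c \<in> wedge_relations G l \<Longrightarrow> reducible l c"
  unfolding reducible_def by (rule exI[of _ "\<lambda>_. 0"]) simp

lemma reducible_diff:
  assumes "reducible l c" "reducible l d"
  shows "reducible l (c - d)"
proof -
  obtain m n where
    "c - (\<Sum>S\<in>index_sets l. frag_cmul (m S) (frag_of (basis_word S))) \<in> wedge_relations G l"
    "d - (\<Sum>S\<in>index_sets l. frag_cmul (n S) (frag_of (basis_word S))) \<in> wedge_relations G l"
    using assms unfolding reducible_def by blast
  then have "(c - (\<Sum>S\<in>index_sets l. frag_cmul (m S) (frag_of (basis_word S))))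
    - (d - (\<Sum>S\<in>index_sets l. frag_cmul (n S) (frag_of (basis_word S)))) \<in> wedge_relations G l"
    by (rule wedge_relations_closed[OF is_monoid])
  then show ?thesis
    unfolding reducible_def
    by (intro exI[of _ "\<lambda>S. m S - n S"]) (simp add: frag_cmul_diff_distrib sum_subtractf algebra_simps)
qed

lemma reducible_neg: "reducible l c \<Longrightarrow> reducible l (- c)"
  using reducible_diff[of l 0 c] reducible_relation wedge_relations_closed(1)[OF is_monoid] by force

lemma reducible_add: "reducible l c \<Longrightarrow> reducible l d \<Longrightarrow> reducible l (c + d)"
  using reducible_diff[of l c "- d"] reducible_neg by force

lemma reducible_cong:
  assumes "c - d \<in> wedge_relations G l" "reducible l d"
  shows "reducible l c"
  using reducible_add[OF reducible_relation[OF assms(1)] assms(2)] by simp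

lemma reducible_basis_word:
  assumes "S \<in> index_sets l"
  shows "reducible l (frag_of (basis_word S))"
proof -
  have "(\<Sum>T\<in>index_sets l. frag_cmul (if T = S then 1 else 0) (frag_of (basis_word T))) =
      (\<Sum>T\<in>index_sets l. if T = S then frag_of (basis_word T) else 0)"
    by (intro sum.cong) auto
  also have "\<dots> = frag_of (basis_word S)"
    using assms by simp
  finally show ?thesis
    unfolding reducible_def
    by (intro exI[of _ "\<lambda>T. if T = S then 1 else 0"])
      (simp add: wedge_relations_closed(1)[OF is_monoid])
qed

lemma add_relation:
  assumes "xs @ x # ys \<in> wedge_words G l" "xs @ y # ys \<in> wedge_words G l"
  shows "frag_of (xs @ (x \<otimes> y) # ys) - frag_of (xs @ x # ys) - frag_of (xs @ y # ys) \<in> wedge_relations G l"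
  unfolding wedge_relations_def using assms by (intro generate.incl) blast

lemma alt_relation:
  assumes "xs @ x # ys @ x # zs \<in> wedge_words G l"
  shows "frag_of (xs @ x # ys @ x # zs) \<in> wedge_relations G l"
  unfolding wedge_relations_def using assms by (intro generate.incl) blast

text \<open>
  Expand the word with both letters replaced by \<open>x \<otimes> y\<close>, which is a relation.
\<close>

lemma swap_relation:
  assumes "xs @ x # y # ys \<in> wedge_words G l"
  shows "frag_of (xs @ x # y # ys) + frag_of (xs @ y # x # ys) \<in> wedge_relations G l"
proof -
  note closed = wedge_relations_closed[OF is_monoid]
  have words: "xs @ u # v # ys \<in> wedge_words G l" if "u \<in> {x, y, x \<otimes> y}" "v \<in> {x, y, x \<otimes> y}" for u v
    using that assms by (auto simp: wedge_words_def)
  have 0: "frag_of (xs @ u # u # ys) \<in> wedge_relations G l" if "u \<in> {x, y, x \<otimes> y}" for u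
    using alt_relation[of xs u "[]" ys l] words[OF that that] by simp
  have 1: "frag_of (xs @ (x \<otimes> y) # v # ys) - frag_of (xs @ x # v # ys) - frag_of (xs @ y # v # ys)
      \<in> wedge_relations G l" if "v \<in> {x, y, x \<otimes> y}" for v
    using add_relation[of xs x "v # ys" l y] words that by simp
  have 2: "frag_of (xs @ u # (x \<otimes> y) # ys) - frag_of (xs @ u # x # ys) - frag_of (xs @ u # y # ys)
      \<in> wedge_relations G l" if "u \<in> {x, y, x \<otimes> y}" for u
    using add_relation[of "xs @ [u]" x "ys" l y] words that by simp
  let ?c = "\<lambda>u v. frag_of (xs @ u # v # ys)"
  let ?z = "x \<otimes> y"
  \<comment> \<open>A combination of relations that telescopes to the sum of the two orders.\<close>
  have "?c ?z ?z - (?c ?z ?z - ?c x ?z - ?c y ?z) - (?c x ?z - ?c x x - ?c x y)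
      - (?c y ?z - ?c y x - ?c y y) - ?c x x - ?c y y \<in> wedge_relations G l"
    by (intro closed(5) 0 1 2) auto
  then show ?thesis by (simp add: algebra_simps)
qed

text \<open>
  Adjacent letters may be exchanged at the cost of a sign, so insertion sort brings a basis word
  into increasing order, unless it repeats a letter and vanishes.
\<close>

lemma reducible_index_word:
  assumes "set is \<subseteq> {..<b}" "int (length is) = l"
  shows "reducible l (frag_of (map e is))"
proof -
  define P where "P is \<longleftrightarrow> set is \<subseteq> {..<b} \<and> int (length is) = l \<longrightarrow> reducible l (frag_of (map e is))" for "is"
  have words: "map e is \<in> wedge_words G l" if "set is \<subseteq> {..<b} \<and> int (length is) = l" for "is"
    using that basis_closed by (auto simp: wedge_words_def)
  have swap: "P (pre @ x # y # zs)" if "P (pre @ y # x # zs)" for pre x y zs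
    unfolding P_def
  proof
    assume *: "set (pre @ x # y # zs) \<subseteq> {..<b} \<and> int (length (pre @ x # y # zs)) = l"
    have "frag_of (map e (pre @ x # y # zs)) - (- frag_of (map e (pre @ y # x # zs))) \<in> wedge_relations G l"
      using swap_relation[of "map e pre" "e x" "e y" "map e zs" l] words[OF *] by simp
    moreover have "reducible l (- frag_of (map e (pre @ y # x # zs)))"
      using * that by (intro reducible_neg) (simp add: P_def)
    ultimately show "reducible l (frag_of (map e (pre @ x # y # zs)))"
      by (rule reducible_cong)
  qed
  have insort: "P (pre @ x # zs)" if "P (pre @ insort x zs)" for pre x zs
    using that
  proof (induction zs arbitrary: pre)
    case (Cons z zs)
    show ?case
    proof (cases "x \<le> z")
      case False
      then have "P ((pre @ [z]) @ insort x zs)"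
        using Cons.prems by simp
      then have "P (pre @ z # x # zs)"
        using Cons.IH by fastforce
      then show ?thesis by (rule swap)
    qed (use Cons in simp)
  qed simp
  have sort: "P (pre @ is)" if "P (pre @ sort is)" for pre "is"
    using that
  proof (induction "is" arbitrary: pre)
    case (Cons i "is")
    then have "P (pre @ i # sort is)"
      by (intro insort) simp
    then show ?case
      using Cons.IH[of "pre @ [i]"] by simp
  qed simp
  have "P (sort is)"
    unfolding P_def
  proof
    assume *: "set (sort is) \<subseteq> {..<b} \<and> int (length (sort is)) = l"
    show "reducible l (frag_of (map e (sort is)))"
    proof (cases "distinct is")
      case True
      then have "map e (sort is) = basis_word (set is)"
        by (simp add: basis_word_def sorted_list_of_set_sort_remdups distinct_remdups_id)
      moreover have "set is \<in> index_sets l"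
        using * True by (simp add: index_sets_def distinct_card)
      ultimately show ?thesis
        by (simp add: reducible_basis_word)
    next
      case False
      then obtain xs x ys zs where "sort is = xs @ [x] @ ys @ [x] @ zs"
        using not_distinct_decomp[of "sort is"] by auto
      then have "map e (sort is) = map e xs @ e x # map e ys @ e x # map e zs"
        by simp
      then show ?thesis
        using words[OF *] alt_relation reducible_relation by metis
    qed
  qed
  then show ?thesis
    using sort[of "[]" "is"] assms by (simp add: P_def)
qed

text \<open>
  The letters are expanded from left to right; the elements admissible in the next place form a
  subgroup containing the basis.
\<close>

lemma reducible_word:
  assumes "set is \<subseteq> {..<b}" "set xs \<subseteq> carrier G" "int (length is + length xs) = l"
  shows "reducible l (frag_of (map e is @ xs))"
  using assms
proof (induction xs arbitrary: "is")
  case Nil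
  then show ?case using reducible_index_word by simp
next
  case (Cons x xs)
  let ?w = "\<lambda>y. frag_of (map e is @ y # xs)"
  define K where "K = {y \<in> carrier G. reducible l (?w y)}"
  have words: "map e is @ y # xs \<in> wedge_words G l" if "y \<in> carrier G" for y
    using that Cons.prems basis_closed by (auto simp: wedge_words_def)
  have add: "?w (y \<otimes> z) - (?w y + ?w z) \<in> wedge_relations G l" if "y \<in> carrier G" "z \<in> carrier G" for y z
    using add_relation[OF words words, OF that] by (simp add: algebra_simps)
  have one: "?w \<one> \<in> wedge_relations G l"
    using wedge_relations_closed(4)[OF is_monoid add[OF one_closed one_closed]] by simp
  have "subgroup K G"
  proof (rule subgroupI)
    show "K \<noteq> {}"
      using one reducible_relation by (auto simp: K_def)
    show "y \<otimes> z \<in> K" if "y \<in> K" "z \<in> K" for y z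
      using that reducible_cong[OF add reducible_add] by (simp add: K_def)
    show "inv y \<in> K" if "y \<in> K" for y
    proof -
      have y: "y \<in> carrier G" "reducible l (?w y)"
        using that by (auto simp: K_def)
      have "?w \<one> - (?w y + ?w (inv y)) \<in> wedge_relations G l"
        using add[of y "inv y"] y by simp
      then have "?w \<one> - (?w \<one> - (?w y + ?w (inv y))) \<in> wedge_relations G l"
        using one wedge_relations_closed(5)[OF is_monoid] by blast
      then have "?w (inv y) - (- ?w y) \<in> wedge_relations G l"
        by (simp add: algebra_simps)
      then show ?thesis
        using reducible_cong[OF _ reducible_neg[OF y(2)]] y(1) by (simp add: K_def)
    qed
  qed (auto simp: K_def)
  moreover have "e i \<in> K" if "i < b" for i
    using Cons.IH[of "is @ [i]"] Cons.prems that basis_closed by (simp add: K_def)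
  ultimately have "carrier G \<subseteq> K"
    by (rule basis_generates)
  then show ?case
    using Cons.prems by (auto simp: K_def)
qed

lemma reducible_chain:
  assumes "Poly_Mapping.keys c \<subseteq> wedge_words G l"
  shows "reducible l c"
  using assms
proof (induction rule: frag_induction)
  case zero
  show ?case
    by (intro reducible_relation wedge_relations_closed is_monoid)
next
  case (one xs)
  then show ?case
    using reducible_word[of "[]" xs l] by (simp add: wedge_words_def)
next
  case (diff c d)
  then show ?case by (simp add: reducible_diff)
qed

text \<open>
  Exterior powers embed into Fock space. In particular they are free of the expected rank, although
  they are defined by generators and relations.
\<close>

lemma chain_coords_eq_0_iff:
  assumes "Poly_Mapping.keys c \<subseteq> wedge_words G l"
  shows "chain_coords c = 0 \<longleftrightarrow> c \<in> wedge_relations G l"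
proof
  assume zero: "chain_coords c = 0"
  obtain n where n: "c - (\<Sum>S\<in>index_sets l. frag_cmul (n S) (frag_of (basis_word S))) \<in> wedge_relations G l"
    using reducible_chain[OF assms] by (auto simp: reducible_def)
  have "n T = 0" if T: "T \<in> index_sets l" for T
  proof -
    have "0 = chain_coords (\<Sum>S\<in>index_sets l. frag_cmul (n S) (frag_of (basis_word S))) T"
      using fun_cong[OF chain_coords_relation[OF n], of T] zero by simp
    also have "\<dots> = (\<Sum>S\<in>index_sets l. of_int (n S) * word_coords (basis_word S) T)"
      by (simp add: chain_coords_def frag_linear_sum)
    also have "\<dots> = (\<Sum>S\<in>index_sets l. if S = T then of_int (n T) else 0)"
      by (intro sum.cong) (auto simp: word_coords_basis index_sets_def)
    also have "\<dots> = of_int (n T)"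
      using T by simp
    finally show ?thesis by simp
  qed
  then show "c \<in> wedge_relations G l"
    using n by simp
qed (rule chain_coords_relation)

end

section \<open>Duals and contractions\<close>

lemma mult_dual_group: "\<phi> \<otimes>\<^bsub>dual_group G\<^esub> \<psi> = (\<lambda>x\<in>carrier G. \<phi> x + \<psi> x)"
  and one_dual_group: "\<one>\<^bsub>dual_group G\<^esub> = (\<lambda>x\<in>carrier G. 0)"
  and carrier_dual_group: "carrier (dual_group G) = hom G integer_group \<inter> extensional (carrier G)"
  by (simp_all add: dual_group_def)

lemma dual_group_add:
  "\<phi> \<in> carrier (dual_group G) \<Longrightarrow> x \<in> carrier G \<Longrightarrow> y \<in> carrier G \<Longrightarrow> \<phi> (x \<otimes>\<^bsub>G\<^esub> y) = \<phi> x + \<phi> y"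
  by (auto simp: carrier_dual_group hom_def integer_group_def)

lemma dual_groupI:
  assumes "\<And>x y. x \<in> carrier G \<Longrightarrow> y \<in> carrier G \<Longrightarrow> \<phi> (x \<otimes>\<^bsub>G\<^esub> y) = \<phi> x + \<phi> y"
    and "\<phi> \<in> extensional (carrier G)"
  shows "\<phi> \<in> carrier (dual_group G)"
  using assms by (auto simp: carrier_dual_group hom_def integer_group_def)

lemma comm_group_dual_group:
  assumes "group G"
  shows "comm_group (dual_group G)"
proof -
  interpret group G by (fact assms)
  have closed: "\<phi> \<otimes>\<^bsub>dual_group G\<^esub> \<psi> \<in> carrier (dual_group G)"
    if "\<phi> \<in> carrier (dual_group G)" "\<psi> \<in> carrier (dual_group G)" for \<phi> \<psi>
    using that by (intro dual_groupI) (auto simp: mult_dual_group dual_group_add)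
  have one: "\<one>\<^bsub>dual_group G\<^esub> \<in> carrier (dual_group G)"
    by (intro dual_groupI) (auto simp: one_dual_group)
  have ext: "\<phi> \<in> extensional (carrier G)" if "\<phi> \<in> carrier (dual_group G)" for \<phi>
    using that by (simp add: carrier_dual_group)
  show ?thesis
  proof (rule comm_groupI)
    fix \<phi> assume \<phi>: "\<phi> \<in> carrier (dual_group G)"
    let ?n = "\<lambda>x\<in>carrier G. - \<phi> x"
    have "?n \<in> carrier (dual_group G)"
      using \<phi> by (intro dual_groupI) (auto simp: dual_group_add)
    moreover have "?n \<otimes>\<^bsub>dual_group G\<^esub> \<phi> = \<one>\<^bsub>dual_group G\<^esub>"
      by (auto simp: mult_dual_group one_dual_group)
    ultimately show "\<exists>\<psi>\<in>carrier (dual_group G). \<psi> \<otimes>\<^bsub>dual_group G\<^esub> \<phi> = \<one>\<^bsub>dual_group G\<^esub>"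
      by blast
    show "\<one>\<^bsub>dual_group G\<^esub> \<otimes>\<^bsub>dual_group G\<^esub> \<phi> = \<phi>"
      using ext[OF \<phi>] by (auto simp: mult_dual_group one_dual_group fun_eq_iff extensional_def)
  next
    fix \<phi> \<psi> assume "\<phi> \<in> carrier (dual_group G)" "\<psi> \<in> carrier (dual_group G)"
    then show "\<phi> \<otimes>\<^bsub>dual_group G\<^esub> \<psi> \<in> carrier (dual_group G)"
      by (rule closed)
  qed (auto simp: one mult_dual_group)
qed

lemma dual_group_one:
  assumes "group G" "\<phi> \<in> carrier (dual_group G)"
  shows "\<phi> \<one>\<^bsub>G\<^esub> = 0"
  using dual_group_add[OF assms(2), of "\<one>\<^bsub>G\<^esub>" "\<one>\<^bsub>G\<^esub>"] assms(1)
  by (simp add: group.is_monoid)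

lemma dual_group_inv:
  assumes "group G" "\<phi> \<in> carrier (dual_group G)" "x \<in> carrier G"
  shows "\<phi> (inv\<^bsub>G\<^esub> x) = - \<phi> x"
  using dual_group_add[OF assms(2), of x "inv\<^bsub>G\<^esub> x"] assms dual_group_one[OF assms(1,2)]
  by (simp add: group.r_inv group.inv_closed)

lemma keys_interior:
  assumes "Poly_Mapping.keys c \<subseteq> wedge_words H l"
  shows "Poly_Mapping.keys (interior \<omega> c) \<subseteq> wedge_words H (l - 1)"
proof -
  have "take i xs @ drop (Suc i) xs \<in> wedge_words H (l - 1)"
    if "xs \<in> wedge_words H l" "i < length xs" for xs i
    using that by (auto simp: wedge_words_def dest: in_set_takeD in_set_dropD)
  then have "Poly_Mapping.keys (\<Sum>i<length xs. frag_cmul ((-1) ^ i * \<omega> (xs ! i)) (frag_of (take i xs @ drop (Suc i) xs)))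
      \<subseteq> wedge_words H (l - 1)" if "xs \<in> wedge_words H l" for xs
    using that by (intro order.trans[OF keys_sum]) (auto split: if_splits)
  then show ?thesis
    unfolding interior_def using assms by (intro order.trans[OF keys_frag_extend]) blast
qed

lemma keys_foldr_interior:
  assumes "Poly_Mapping.keys c \<subseteq> wedge_words H l"
  shows "Poly_Mapping.keys (foldr interior \<omega>s c) \<subseteq> wedge_words H (l - int (length \<omega>s))"
proof (induction \<omega>s)
  case (Cons \<omega> \<omega>s)
  then show ?case
    using keys_interior[OF Cons, of \<omega>] by (simp add: algebra_simps)
qed (use assms in simp)

lemma keys_contract_chain:
  assumes "Poly_Mapping.keys c \<subseteq> wedge_words H k" "Poly_Mapping.keys m \<subseteq> wedge_words H' p"
  shows "Poly_Mapping.keys (contract_chain m c) \<subseteq> wedge_words H (k - p)"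
  unfolding contract_chain_def
proof (intro order.trans[OF keys_frag_extend] UN_least)
  fix \<omega>s assume "\<omega>s \<in> Poly_Mapping.keys m"
  then have "int (length \<omega>s) = p"
    using assms(2) by (auto simp: wedge_words_def)
  then show "Poly_Mapping.keys (foldr interior \<omega>s c) \<subseteq> wedge_words H (k - p)"
    using keys_foldr_interior[OF assms(1), of \<omega>s] by simp
qed

lemma annihilate_frag_linear:
  "annihilate b v (\<lambda>S. frag_linear (\<lambda>x. f x S) c) T = frag_linear (\<lambda>x. annihilate b v (f x) T) c"
  using subset_UNIV[of "Poly_Mapping.keys c"]
proof (induction c rule: frag_induction)
  case (diff c d)
  have "annihilate b v (\<lambda>S. frag_linear (\<lambda>x. f x S) (c - d)) T =
      annihilate b v (\<lambda>S. frag_linear (\<lambda>x. f x S) c) T - annihilate b v (\<lambda>S. frag_linear (\<lambda>x. f x S) d) T"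
    by (simp add: annihilate_def sum_subtractf[symmetric])
      (auto intro!: sum.cong simp: algebra_simps)
  then show ?case
    using diff by simp
qed (simp_all add: annihilate_def cong: if_cong)

context based_group
begin

lemma form_expansion:
  assumes "\<omega> \<in> carrier (dual_group G)" "x \<in> carrier G"
  shows "\<omega> x = (\<Sum>i<b. \<omega> (e i) * co i x)"
proof -
  have one: "co i \<one> = 0" if "i < b" for i
    using coord_mult[OF that, of \<one> \<one>] by simp
  have inv: "co i (inv y) = - co i y" if "i < b" "y \<in> carrier G" for i y
    using coord_mult[OF that(1), of y "inv y"] that one by simp
  define K where "K = {y \<in> carrier G. \<omega> y = (\<Sum>i<b. \<omega> (e i) * co i y)}"
  have "subgroup K G"
  proof (rule subgroupI)
    have "\<one> \<in> K"
      by (simp add: K_def one dual_group_one[OF is_group assms(1)])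
    then show "K \<noteq> {}" by blast
    show "inv y \<in> K" if "y \<in> K" for y
      using that by (auto simp: K_def inv dual_group_inv[OF is_group assms(1)] sum_negf)
    show "y \<otimes> z \<in> K" if "y \<in> K" "z \<in> K" for y z
      using that by (auto simp: K_def coord_mult dual_group_add[OF assms(1)] distrib_left sum.distrib)
  qed (auto simp: K_def)
  moreover have "e j \<in> K" if "j < b" for j
  proof -
    have "(\<Sum>i<b. \<omega> (e i) * co i (e j)) = (\<Sum>i<b. if i = j then \<omega> (e i) else 0)"
      using that by (intro sum.cong) (auto simp: coord_basis)
    then have "\<omega> (e j) = (\<Sum>i<b. \<omega> (e i) * co i (e j))"
      using that by simp
    then show ?thesis
      using that basis_closed unfolding K_def by blast
  qed
  ultimately have "carrier G \<subseteq> K"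
    by (rule basis_generates)
  then show ?thesis
    using assms(2) unfolding K_def by blast
qed

text \<open>
  The map sending \<open>y\<close> to the product of the \<open>e\<^sub>i\<close> raised to its coordinates is a
  homomorphism that fixes the basis, hence is the identity.
\<close>

lemma coord_separates:
  assumes "x \<in> carrier G" "\<And>i. i < b \<Longrightarrow> co i x = 0"
  shows "x = \<one>"
proof -
  define f where "f y = finprod G (\<lambda>i. e i [^] co i y) {..<b}" for y
  have f_mult: "f (y \<otimes> z) = f y \<otimes> f z" if "y \<in> carrier G" "z \<in> carrier G" for y z
  proof -
    have "f (y \<otimes> z) = finprod G (\<lambda>i. e i [^] co i y \<otimes> e i [^] co i z) {..<b}"
      unfolding f_def using that basis_closed
      by (intro finprod_cong') (auto simp: coord_mult int_pow_mult)
    also have "\<dots> = f y \<otimes> f z"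
      unfolding f_def using basis_closed by (intro finprod_multf) auto
    finally show ?thesis .
  qed
  have f_closed: "f y \<in> carrier G" for y
    unfolding f_def using basis_closed by (intro finprod_closed) auto
  have f_hom: "f \<in> hom G G"
    using f_mult f_closed by (auto simp: hom_def)
  interpret f: group_hom G G f
    by unfold_locales (rule f_hom)
  define K where "K = {y \<in> carrier G. f y = y}"
  have "subgroup K G"
  proof (rule subgroupI)
    show "K \<noteq> {}"
      by (auto simp: K_def intro!: exI[of _ \<one>])
  qed (auto simp: K_def f_mult)
  moreover have "e j \<in> K" if "j < b" for j
  proof -
    have "f (e j) = finprod G (\<lambda>i. if j = i then e i else \<one>) {..<b}"
      unfolding f_def using that basis_closed by (intro finprod_cong') (auto simp: coord_basis)
    also have "\<dots> = e j"
      using that basis_closed by (intro finprod_singleton) auto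
    finally show ?thesis
      using that basis_closed by (simp add: K_def)
  qed
  ultimately have "f x = x"
    using basis_generates assms(1) by (auto simp: K_def)
  moreover have "f x = \<one>"
    unfolding f_def using assms(2) basis_closed by (intro finprod_one_eqI) simp
  ultimately show ?thesis by simp
qed

abbreviation contract_fock :: "('a \<Rightarrow> int) \<Rightarrow> fock \<Rightarrow> fock" where
  "contract_fock \<omega> \<equiv> annihilate b (\<lambda>i. \<omega> (e i))"

lemma word_coords_Cons: "word_coords (x # xs) = create b (\<lambda>i. co i x) (word_coords xs)"
  by (simp add: word_coords_def)

text \<open>
  The alternating sum that defines contraction is what is left after moving the annihilation
  operator through the creation operators of the word, one anticommutator per letter.
\<close>

lemma contract_word:
  assumes \<omega>: "\<omega> \<in> carrier (dual_group G)" and "set xs \<subseteq> carrier G"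
  shows "(\<Sum>i<length xs. of_int ((-1) ^ i * \<omega> (xs ! i)) * word_coords (take i xs @ drop (Suc i) xs) S)
    = contract_fock \<omega> (word_coords xs) S"
  using assms(2)
proof (induction xs arbitrary: S)
  case Nil
  show ?case
    by (auto simp: word_coords_def annihilate_def vacuum_def intro!: sum.neutral)
next
  case (Cons x xs)
  let ?t = "\<lambda>i. of_int ((-1) ^ i * \<omega> (xs ! i)) * word_coords (take i xs @ drop (Suc i) xs) S"
  have "create b (\<lambda>i. co i x) (contract_fock \<omega> (word_coords xs)) S =
      (\<Sum>i<length xs. of_int ((-1) ^ i * \<omega> (xs ! i)) *
        create b (\<lambda>i. co i x) (word_coords (take i xs @ drop (Suc i) xs)) S)"
  proof -
    have "contract_fock \<omega> (word_coords xs) = (\<lambda>S. \<Sum>i<length xs. of_int ((-1) ^ i * \<omega> (xs ! i)) *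
        word_coords (take i xs @ drop (Suc i) xs) S)"
      using Cons by (simp add: fun_eq_iff)
    moreover have "create b v (\<lambda>S. \<Sum>i<n. a i * F i S) T = (\<Sum>i<n. a i * create b v (F i) T)"
      for v and n :: nat and a F T
      unfolding create_def sum_distrib_left
      by (subst sum.swap) (auto intro!: sum.cong simp: sum_distrib_left mult_ac)
    ultimately show ?thesis by simp
  qed
  moreover have "of_int (\<Sum>i<b. \<omega> (e i) * co i x) = (of_int (\<omega> x) :: rat)"
    using form_expansion[OF \<omega>] Cons.prems by simp
  ultimately show ?case
    by (simp add: word_coords_Cons annihilate_create sum.lessThan_Suc_shift sum_negf del: sum.lessThan_Suc)
qed

lemma chain_coords_interior:
  assumes \<omega>: "\<omega> \<in> carrier (dual_group G)" and c: "Poly_Mapping.keys c \<subseteq> wedge_words G l"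
  shows "chain_coords (interior \<omega> c) = contract_fock \<omega> (chain_coords c)"
proof
  fix S
  have "chain_coords (interior \<omega> c) S = frag_linear (\<lambda>xs. contract_fock \<omega> (word_coords xs) S) c"
    unfolding chain_coords_def interior_def frag_linear_extend
  proof (rule frag_linear_cong)
    fix xs assume "xs \<in> Poly_Mapping.keys c"
    then have "set xs \<subseteq> carrier G"
      using c by (auto simp: wedge_words_def)
    from contract_word[OF \<omega> this, of S]
    show "frag_linear (\<lambda>xs. word_coords xs S) (\<Sum>i<length xs. frag_cmul ((- 1) ^ i * \<omega> (xs ! i))
        (frag_of (take i xs @ drop (Suc i) xs))) = contract_fock \<omega> (word_coords xs) S"
      by (simp add: frag_linear_sum)
  qed
  then show "chain_coords (interior \<omega> c) S = contract_fock \<omega> (chain_coords c) S"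
    unfolding chain_coords_def annihilate_frag_linear .
qed

text \<open>
  The operator on Fock space induced by a chain of words in the dual group.
\<close>

definition contract_operator :: "(('a \<Rightarrow> int) list \<Rightarrow>\<^sub>0 int) \<Rightarrow> fock \<Rightarrow> fock" where
  "contract_operator m F = (\<lambda>S. frag_linear (\<lambda>\<omega>s. foldr contract_fock \<omega>s F S) m)"

lemma chain_coords_contract_chain:
  assumes m: "Poly_Mapping.keys m \<subseteq> wedge_words (dual_group G) p"
    and c: "Poly_Mapping.keys c \<subseteq> wedge_words G k"
  shows "chain_coords (contract_chain m c) = contract_operator m (chain_coords c)"
proof
  fix S
  have "chain_coords (foldr interior \<omega>s c) = foldr contract_fock \<omega>s (chain_coords c)"
    if "set \<omega>s \<subseteq> carrier (dual_group G)" for \<omega>s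
    using that
  proof (induction \<omega>s)
    case (Cons \<omega> \<omega>s)
    then show ?case
      using chain_coords_interior[OF _ keys_foldr_interior[OF c], of \<omega> \<omega>s] by simp
  qed simp
  then have eq: "chain_coords (foldr interior \<omega>s c) S = foldr contract_fock \<omega>s (chain_coords c) S"
    if "\<omega>s \<in> Poly_Mapping.keys m" for \<omega>s
    using m that by (auto simp: wedge_words_def)
  have "chain_coords (contract_chain m c) S = frag_linear (\<lambda>\<omega>s. chain_coords (foldr interior \<omega>s c) S) m"
    by (simp add: contract_chain_def chain_coords_def frag_linear_extend)
  then show "chain_coords (contract_chain m c) S = contract_operator m (chain_coords c) S"
    unfolding contract_operator_def using frag_linear_cong[OF eq] by simp
qed

lemma contract_operator_relation:
  assumes "r \<in> wedge_relations (dual_group G) p"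
  shows "contract_operator r F = 0"
proof
  fix S
  interpret D: comm_group "dual_group G"
    by (rule comm_group_dual_group[OF is_group])
  have foldr_add: "foldr contract_fock xs (F + F') = foldr contract_fock xs F + foldr contract_fock xs F'" for xs F F'
    by (induction xs) (simp_all only: foldr.simps id_apply o_apply annihilate_add)
  show "contract_operator r F S = 0 S"
    unfolding contract_operator_def zero_fun_apply
  proof (rule frag_linear_wedge_relation[OF D.is_monoid _ _ assms])
    fix xs x y ys
    have "contract_fock (x \<otimes>\<^bsub>dual_group G\<^esub> y) F' = contract_fock x F' + contract_fock y F'" for F'
      using basis_closed
      by (auto simp: annihilate_def fun_eq_iff mult_dual_group distrib_right simp flip: sum.distrib
          intro!: sum.cong)
    then have "foldr contract_fock (xs @ (x \<otimes>\<^bsub>dual_group G\<^esub> y) # ys) F =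
        foldr contract_fock (xs @ x # ys) F + foldr contract_fock (xs @ y # ys) F"
      by (simp only: foldr_append foldr.simps o_apply foldr_add)
    then show "foldr contract_fock (xs @ (x \<otimes>\<^bsub>dual_group G\<^esub> y) # ys) F S =
        foldr contract_fock (xs @ x # ys) F S + foldr contract_fock (xs @ y # ys) F S"
      by simp
  next
    fix xs x ys zs
    show "foldr contract_fock (xs @ x # ys @ x # zs) F S = 0"
      by (subst foldr_repeated_letter) (auto intro: annihilate_annihilate_swap)
  qed
qed

text \<open>
  Contraction is well defined: in coordinates it depends on the chain of forms only through its
  operator and on the chain of vectors only through its coordinates.
\<close>

lemma contraction_class:
  assumes m: "Poly_Mapping.keys m \<subseteq> wedge_words (dual_group G) p"
    and c: "Poly_Mapping.keys c \<subseteq> wedge_words G k"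
  shows "contraction G p k (wedge_class (dual_group G) p m) (wedge_class G k c)
    = wedge_class G (k - p) (contract_chain m c)"
proof -
  interpret D: comm_group "dual_group G"
    by (rule comm_group_dual_group[OF is_group])
  have eq: "wedge_class G (k - p) (contract_chain m' c') = wedge_class G (k - p) (contract_chain m c)"
    if m': "m' \<in> wedge_class (dual_group G) p m" and c': "c' \<in> wedge_class G k c" for m' c'
  proof -
    have rel: "m' - m \<in> wedge_relations (dual_group G) p" "c' - c \<in> wedge_relations G k"
      using m' c' mem_wedge_class D.is_monoid is_monoid by blast+
    have m'k: "Poly_Mapping.keys m' \<subseteq> wedge_words (dual_group G) p"
      using wedge_relations_closed(2)[OF D.is_monoid rel(1)] m keys_add[of "m' - m" m] by auto
    have c'k: "Poly_Mapping.keys c' \<subseteq> wedge_words G k"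
      using wedge_relations_closed(2)[OF is_monoid rel(2)] c keys_add[of "c' - c" c] by auto
    have "chain_coords c' = chain_coords c"
      using chain_coords_relation[OF rel(2)] by simp
    moreover have "contract_operator m' F = contract_operator m F" for F
      using contract_operator_relation[OF rel(1), of F] by (simp add: contract_operator_def fun_eq_iff)
    ultimately have "chain_coords (contract_chain m' c' - contract_chain m c) = 0"
      by (simp add: chain_coords_contract_chain[OF m'k c'k] chain_coords_contract_chain[OF m c])
    moreover have "Poly_Mapping.keys (contract_chain m' c' - contract_chain m c) \<subseteq> wedge_words G (k - p)"
      using keys_contract_chain[OF c'k m'k] keys_contract_chain[OF c m] by (intro order.trans[OF keys_diff]) auto
    ultimately show ?thesis
      using chain_coords_eq_0_iff wedge_class_eq_iff[OF is_monoid] by blast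
  qed
  have "m \<in> wedge_class (dual_group G) p m" "c \<in> wedge_class G k c"
    using mem_wedge_class[OF D.is_monoid] mem_wedge_class[OF is_monoid]
      wedge_relations_closed(1)[OF D.is_monoid] wedge_relations_closed(1)[OF is_monoid] by auto
  then have "{wedge_relations G (k - p) #>\<^bsub>wedge_chains G (k - p)\<^esub> contract_chain m' c' | m' c'.
       m' \<in> wedge_class (dual_group G) p m \<and> c' \<in> wedge_class G k c} =
      {wedge_class G (k - p) (contract_chain m c)}"
    using eq unfolding wedge_class_def[of G "k - p", symmetric] by blast
  then show ?thesis
    unfolding contraction_def by simp
qed

end

section \<open>Subsets counted by cardinality, and the rank of a contraction\<close>

definition fock_scale :: "rat \<Rightarrow> fock \<Rightarrow> fock" where
  "fock_scale q F = (\<lambda>S. q * F S)"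

interpretation fock: rational_space fock_scale
  by unfold_locales (auto simp: fock_scale_def fun_eq_iff algebra_simps)

definition supported_on :: "nat set set \<Rightarrow> fock set" where
  "supported_on A = {F. \<forall>S. F S \<noteq> 0 \<longrightarrow> S \<in> A}"

definition unit_fock :: "nat set \<Rightarrow> fock" where
  "unit_fock S = (\<lambda>T. if T = S then 1 else 0)"

lemma subspace_supported_on: "fock.subspace (supported_on A)"
  by (auto simp: fock.subspace_def supported_on_def fock_scale_def) (metis add.left_neutral)

lemma supported_onD: "F \<in> supported_on A \<Longrightarrow> S \<notin> A \<Longrightarrow> F S = 0"
  by (auto simp: supported_on_def)

lemma supported_on_mono: "A \<subseteq> B \<Longrightarrow> supported_on A \<subseteq> supported_on B"
  by (auto simp: supported_on_def)

lemma fock_sum_apply: "(\<Sum>x\<in>A. f x) T = (\<Sum>x\<in>A. f x T)" for f :: "'x \<Rightarrow> fock"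
  by (induction A rule: infinite_finite_induct) auto

lemma fock_expansion:
  assumes "finite A" "F \<in> supported_on A"
  shows "F = (\<Sum>S\<in>A. fock_scale (F S) (unit_fock S))"
proof
  fix T
  have "(\<Sum>S\<in>A. fock_scale (F S) (unit_fock S)) T = (\<Sum>S\<in>A. if S = T then F T else 0)"
    unfolding fock_sum_apply by (intro sum.cong) (auto simp: fock_scale_def unit_fock_def)
  then show "F T = (\<Sum>S\<in>A. fock_scale (F S) (unit_fock S)) T"
    using assms by (auto simp: supported_on_def)
qed

lemma span_unit_fock:
  assumes "finite A"
  shows "fock.span (unit_fock ` A) = supported_on A"
proof (rule fock.span_unique[symmetric, symmetric])
  show "unit_fock ` A \<subseteq> supported_on A"
    by (auto simp: unit_fock_def supported_on_def split: if_splits)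
  show "fock.subspace (supported_on A)"
    by (rule subspace_supported_on)
  fix V assume V: "unit_fock ` A \<subseteq> V" "fock.subspace V"
  show "supported_on A \<subseteq> V"
  proof
    fix F assume "F \<in> supported_on A"
    then have "F = (\<Sum>S\<in>A. fock_scale (F S) (unit_fock S))"
      using fock_expansion assms by blast
    also have "\<dots> \<in> V"
      using V by (intro fock.subspace_sum fock.subspace_scale) auto
    finally show "F \<in> V" .
  qed
qed

lemma dim_supported_on:
  assumes "finite A"
  shows "fock.dim (supported_on A) = card A"
proof -
  have "\<forall>S\<in>A. q S = 0" if "(\<Sum>S\<in>A. fock_scale (q S) (unit_fock S)) = 0" for q
  proof
    fix T assume T: "T \<in> A"
    have "(\<Sum>S\<in>A. fock_scale (q S) (unit_fock S)) T = (\<Sum>S\<in>A. if S = T then q T else 0)"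
      unfolding fock_sum_apply by (intro sum.cong) (auto simp: fock_scale_def unit_fock_def)
    then show "q T = 0"
      using that T assms by simp
  qed
  from fock.independent_family[OF assms this]
  have "inj_on unit_fock A" "fock.independent (unit_fock ` A)" by blast+
  then show ?thesis
    using span_unit_fock[OF assms] by (metis fock.dim_span_eq_card_independent card_image)
qed

definition residue_sets :: "nat \<Rightarrow> int \<Rightarrow> int \<Rightarrow> nat set set" where
  "residue_sets b q j = {S. S \<subseteq> {..<b} \<and> int (card S) mod q = j mod q}"

lemma finite_residue_sets [simp]: "finite (residue_sets b q j)"
  by (simp add: residue_sets_def)

lemma residue_sets_cong: "j mod q = j' mod q \<Longrightarrow> residue_sets b q j = residue_sets b q j'"
  by (simp add: residue_sets_def)

text \<open>
  Pascal's rule.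
\<close>

lemma card_residue_sets_Suc:
  "card (residue_sets (Suc b) q j) = card (residue_sets b q j) + card (residue_sets b q (j - 1))"
proof -
  have fin: "finite S" if "S \<subseteq> {..<b}" for S
    using that finite_subset by blast
  have notin: "b \<notin> S" if "S \<subseteq> {..<b}" for S
    using that by auto
  have mod_Suc: "(1 + x) mod q = j mod q \<longleftrightarrow> x mod q = (j - 1) mod q" for x
    by (simp add: mod_eq_dvd_iff algebra_simps)
  have "residue_sets (Suc b) q j = residue_sets b q j \<union> insert b ` residue_sets b q (j - 1)"
  proof (intro equalityI subsetI)
    fix S assume S: "S \<in> residue_sets (Suc b) q j"
    show "S \<in> residue_sets b q j \<union> insert b ` residue_sets b q (j - 1)"
    proof (cases "b \<in> S")
      case False
      then have "S \<subseteq> {..<b}"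
        using S by (auto simp: residue_sets_def less_Suc_eq subset_iff)
      then show ?thesis
        using S by (auto simp: residue_sets_def)
    next
      case True
      have sub: "S - {b} \<subseteq> {..<b}"
        using S by (auto simp: residue_sets_def less_Suc_eq subset_iff)
      have "card S = Suc (card (S - {b}))"
        using True fin[OF sub] by (metis card_Suc_Diff1 finite_insert insert_Diff)
      then have "S - {b} \<in> residue_sets b q (j - 1)"
        using S sub mod_Suc[of "int (card (S - {b}))"] by (simp add: residue_sets_def)
      then show ?thesis
        using True by (metis UnI2 imageI insert_Diff)
    qed
  next
    fix S assume "S \<in> residue_sets b q j \<union> insert b ` residue_sets b q (j - 1)"
    then show "S \<in> residue_sets (Suc b) q j"
    proof
      assume "S \<in> insert b ` residue_sets b q (j - 1)"
      then obtain T where T: "T \<in> residue_sets b q (j - 1)" "S = insert b T" by auto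
      then have "int (card S) = 1 + int (card T)"
        using fin notin by (simp add: residue_sets_def)
      then show ?thesis
        using T mod_Suc[of "int (card T)"] by (auto simp: residue_sets_def)
    qed (auto simp: residue_sets_def)
  qed
  moreover have "residue_sets b q j \<inter> insert b ` residue_sets b q (j - 1) = {}"
    using notin by (auto simp: residue_sets_def)
  moreover have "inj_on (insert b) (residue_sets b q (j - 1))"
  proof (rule inj_on_inverseI)
    fix S assume "S \<in> residue_sets b q (j - 1)"
    then show "insert b S - {b} = S"
      using notin[of S] by (auto simp: residue_sets_def)
  qed
  ultimately show ?thesis
    by (simp add: card_Un_disjoint card_image)
qed

lemma card_parity_sets:
  assumes "b \<ge> 1"
  shows "card (residue_sets b 2 j) = 2 ^ (b - 1)"
  using assms
proof (induction b arbitrary: j rule: dec_induct)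
  case base
  have 0: "residue_sets 0 2 j = (if even j then {{}} else {})" for j
    by (auto simp: residue_sets_def even_iff_mod_2_eq_zero)
  show ?case
    using card_residue_sets_Suc[of 0 2 j] by (simp add: 0)
next
  case (step b)
  then obtain a where "b = Suc a"
    by (cases b) auto
  then show ?case
    unfolding card_residue_sets_Suc[of b] step.IH by simp
qed

text \<open>
  The Euler characteristic of the two-periodic complex that contraction with a trivector forms from
  the degrees congruent to \<open>j\<close> and to \<open>j + 3\<close> modulo 6.
\<close>

definition excess :: "nat \<Rightarrow> int \<Rightarrow> int" where
  "excess b j = int (card (residue_sets b 6 j)) - int (card (residue_sets b 6 (j + 3)))"

text \<open>
  Pascal's rule together with \<open>excess b (j + 3) = - excess b j\<close>, which produces the minus sign.
\<close>

lemma excess_Suc: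
  "excess (Suc b) 0 = excess b 0 - excess b 2"
  "excess (Suc b) 1 = excess b 1 + excess b 0"
  "excess (Suc b) 2 = excess b 2 + excess b 1"
proof -
  have "residue_sets b 6 (-1) = residue_sets b 6 5"
    by (rule residue_sets_cong) simp
  then show "excess (Suc b) 0 = excess b 0 - excess b 2"
    "excess (Suc b) 1 = excess b 1 + excess b 0"
    "excess (Suc b) 2 = excess b 2 + excess b 1"
    by (simp_all add: excess_def card_residue_sets_Suc)
qed

lemma excess_0: "excess 0 0 = 1" "excess 0 1 = 0" "excess 0 2 = 0"
proof -
  have "residue_sets 0 6 j = (if j mod 6 = 0 then {{}} else {})" for j
    by (auto simp: residue_sets_def)
  then show "excess 0 0 = 1" "excess 0 1 = 0" "excess 0 2 = 0"
    by (simp_all add: excess_def)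
qed

text \<open>
  From one element on, the alternating sum of all binomial coefficients vanishes.
\<close>

lemma excess_balanced: "excess (Suc b) 1 = excess (Suc b) 0 + excess (Suc b) 2"
  by (simp add: excess_Suc)

text \<open>
  Two steps of the recursion permute the three values up to sign and multiply them by 3; this is the
  origin of the powers of 3 in the lower bound.
\<close>

lemma sum_abs_excess:
  "\<bar>excess (Suc b) 0\<bar> + \<bar>excess (Suc b) 1\<bar> + \<bar>excess (Suc b) 2\<bar> = 2 * (if even b then 3 ^ (b div 2) else 2 * 3 ^ (b div 2))"
proof (induction b rule: nat_induct2)
  case (step b)
  have *: "excess (Suc b) 1 = excess (Suc b) 0 + excess (Suc b) 2"
    by (rule excess_balanced)
  have 0: "excess (Suc (b + 2)) 0 = 3 * (- excess (Suc b) 2)"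
    using * excess_Suc[of "Suc b"] excess_Suc[of "Suc (Suc b)"] by (simp add: algebra_simps)
  have 1: "excess (Suc (b + 2)) 1 = 3 * excess (Suc b) 0"
    using * excess_Suc[of "Suc b"] excess_Suc[of "Suc (Suc b)"] by (simp add: algebra_simps)
  have 2: "excess (Suc (b + 2)) 2 = 3 * excess (Suc b) 1"
    using * excess_Suc[of "Suc b"] excess_Suc[of "Suc (Suc b)"] by (simp add: algebra_simps)
  define t :: "nat \<Rightarrow> int" where "t b = (if even b then 3 ^ (b div 2) else 2 * 3 ^ (b div 2))" for b
  have "t (b + 2) = 3 * t b"
    by (simp add: t_def)
  moreover have "\<bar>excess (Suc b) 0\<bar> + \<bar>excess (Suc b) 1\<bar> + \<bar>excess (Suc b) 2\<bar> = 2 * t b"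
    using step unfolding t_def .
  ultimately show ?case
    unfolding 0 1 2 t_def[symmetric] by linarith
qed (simp_all add: excess_Suc excess_0)

lemma cup_rank_bound_excess:
  assumes "b \<ge> 1"
  shows "2 * cup_rank_bound b = real_of_int (\<bar>excess b 0\<bar> + \<bar>excess b 1\<bar> + \<bar>excess b 2\<bar>)"
proof -
  obtain a where a: "b = Suc a"
    using assms by (cases b) auto
  show ?thesis
  proof (cases "even a")
    case True
    then show ?thesis
      unfolding a sum_abs_excess by (simp add: cup_rank_bound_def)
  next
    case False
    then have "Suc a div 2 - 1 = a div 2"
      by (auto elim!: oddE)
    then show ?thesis
      using False unfolding a sum_abs_excess by (simp add: cup_rank_bound_def)
  qed
qed

lemma sum_card_residue_sets:
  "(\<Sum>j<6. card (residue_sets b 6 (int j))) = 2 ^ b"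
proof -
  have "(\<Sum>j<6. card (residue_sets b 6 (int j))) = card (\<Union>j<6::nat. residue_sets b 6 (int j))"
    by (rule card_UN_disjoint[symmetric]) (auto simp: residue_sets_def)
  also have "(\<Union>j<6::nat. residue_sets b 6 (int j)) = Pow {..<b}"
  proof (intro equalityI subsetI)
    fix S assume "S \<in> Pow {..<b}"
    then have "S \<in> residue_sets b 6 (int (card S mod 6))"
      by (simp add: residue_sets_def zmod_int)
    then show "S \<in> (\<Union>j<6::nat. residue_sets b 6 (int j))"
      by (intro UN_I[of "card S mod 6"]) auto
  qed (auto simp: residue_sets_def)
  finally show ?thesis
    by (simp add: card_Pow)
qed

lemma shuffle_sign_singleton [simp]: "shuffle_sign i {i} = 1"
proof -
  have "{j \<in> {i}. j < i} = {}"
    by auto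
  then show ?thesis
    by (simp only: shuffle_sign_def card.empty power_0)
qed

lemma annihilate_cong:
  assumes "\<And>i. i \<notin> S \<Longrightarrow> F (insert i S) = F' (insert i S)"
  shows "annihilate b v F S = annihilate b v F' S"
  unfolding annihilate_def using assms by (intro sum.cong) auto

lemma foldr_annihilate_cong:
  assumes "\<And>T. S \<subseteq> T \<Longrightarrow> finite (T - S) \<Longrightarrow> card (T - S) = length \<omega>s \<Longrightarrow> F T = F' T"
  shows "foldr (\<lambda>\<omega>. annihilate b (w \<omega>)) \<omega>s F S = foldr (\<lambda>\<omega>. annihilate b (w \<omega>)) \<omega>s F' S"
  using assms
proof (induction \<omega>s arbitrary: S)
  case (Cons \<omega> \<omega>s)
  have "foldr (\<lambda>\<omega>. annihilate b (w \<omega>)) \<omega>s F (insert i S) = foldr (\<lambda>\<omega>. annihilate b (w \<omega>)) \<omega>s F' (insert i S)"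
    if "i \<notin> S" for i
  proof (rule Cons.IH)
    fix T assume T: "insert i S \<subseteq> T" "finite (T - insert i S)" "card (T - insert i S) = length \<omega>s"
    have TS: "T - S = insert i (T - insert i S)"
      using T(1) that by auto
    show "F T = F' T"
    proof (rule Cons.prems)
      show "finite (T - S)"
        using TS T(2) by (metis finite_insert)
      show "card (T - S) = length (\<omega> # \<omega>s)"
        by (subst TS) (use T in simp)
    qed (use T in auto)
  qed
  then show ?case
    unfolding foldr.simps o_apply by (rule annihilate_cong)
qed simp

lemma foldr_annihilate_frag_linear:
  "foldr (\<lambda>\<omega>. annihilate b (w \<omega>)) \<omega>s (\<lambda>S. frag_linear (\<lambda>x. f x S) c) T =
    frag_linear (\<lambda>x. foldr (\<lambda>\<omega>. annihilate b (w \<omega>)) \<omega>s (f x) T) c"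
proof (induction \<omega>s arbitrary: T)
  case (Cons \<omega> \<omega>s)
  then have "foldr (\<lambda>\<omega>. annihilate b (w \<omega>)) \<omega>s (\<lambda>S. frag_linear (\<lambda>x. f x S) c) =
    (\<lambda>T. frag_linear (\<lambda>x. foldr (\<lambda>\<omega>. annihilate b (w \<omega>)) \<omega>s (f x) T) c)" by blast
  then show ?case
    by (simp add: annihilate_frag_linear)
qed simp

lemma frag_linear_swap:
  "frag_linear (\<lambda>x. frag_linear (\<lambda>y. f x y) c) d = frag_linear (\<lambda>y. frag_linear (\<lambda>x. f x y) d) c"
  unfolding frag_linear_def sum_distrib_left
  by (subst sum.swap) (simp add: mult_ac)

text \<open>
  Moving three operators past three others needs nine exchanges, an odd number.
\<close>

lemma annihilate_triple_swap:
  assumes "length \<omega>s = 3" "length \<eta>s = 3"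
  shows "foldr (\<lambda>\<omega>. annihilate b (w \<omega>)) \<omega>s (foldr (\<lambda>\<omega>. annihilate b (w \<omega>)) \<eta>s F) =
    - foldr (\<lambda>\<omega>. annihilate b (w \<omega>)) \<eta>s (foldr (\<lambda>\<omega>. annihilate b (w \<omega>)) \<omega>s F)"
proof -
  let ?a = "\<lambda>\<omega>. annihilate b (w \<omega>)"
  obtain p q r where \<eta>: "\<eta>s = [p, q, r]"
    using assms(2) by (auto simp: length_Suc_conv numeral_3_eq_3)
  obtain x y z where \<omega>: "\<omega>s = [x, y, z]"
    using assms(1) by (auto simp: length_Suc_conv numeral_3_eq_3)
  have one: "?a u (?a p (?a q (?a r G))) = - ?a p (?a q (?a r (?a u G)))" for u G
  proof -
    have "?a u (?a p (?a q (?a r G))) = - ?a p (?a u (?a q (?a r G)))"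
      by (rule annihilate_annihilate_swap)
    also have "?a u (?a q (?a r G)) = - ?a q (?a u (?a r G))"
      by (rule annihilate_annihilate_swap)
    also have "?a u (?a r G) = - ?a r (?a u G)"
      by (rule annihilate_annihilate_swap)
    finally show ?thesis
      by (simp only: annihilate_uminus minus_minus)
  qed
  show ?thesis
    unfolding \<eta> \<omega> by (simp only: foldr.simps o_apply id_apply one annihilate_uminus minus_minus)
qed

lemma parity_imp_mod_6:
  fixes x k :: int
  assumes "x mod 2 = k mod 2"
  shows "x mod 6 = k mod 6 \<or> x mod 6 = (k + 2) mod 6 \<or> x mod 6 = (k + 4) mod 6"
proof -
  obtain t where t: "x - k = 2 * t"
    using assms unfolding mod_eq_dvd_iff by (rule dvdE)
  have "3 dvd t \<or> 3 dvd t - 1 \<or> 3 dvd t - 2"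
    by presburger
  then obtain r where r: "r = 0 \<or> r = 1 \<or> r = 2" "3 dvd t - r"
    by (metis diff_zero)
  have e: "x - (k + 2 * r) = 2 * (t - r)"
    using t by simp
  have "2 * 3 dvd 2 * (t - r)"
    by (rule mult_dvd_mono[OF dvd_refl r(2)])
  then have "6 dvd x - (k + 2 * r)"
    unfolding e by simp
  then show ?thesis
    unfolding mod_eq_dvd_iff using r(1) by (elim disjE) simp_all
qed

context based_group
begin

lemma contract_operator_linear: "Vector_Spaces.linear fock_scale fock_scale (contract_operator m)"
proof -
  have add: "foldr contract_fock xs (F + F') = foldr contract_fock xs F + foldr contract_fock xs F'" for xs F F'
    by (induction xs) (simp_all only: foldr.simps id_apply o_apply annihilate_add)
  have "contract_fock \<omega> (fock_scale q F) = fock_scale q (contract_fock \<omega> F)" for \<omega> q F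
    by (auto simp: annihilate_def fock_scale_def fun_eq_iff sum_distrib_left intro!: sum.cong)
  then have scale: "foldr contract_fock xs (fock_scale q F) = fock_scale q (foldr contract_fock xs F)" for xs q F
    by (induction xs) (simp_all only: foldr.simps id_apply o_apply)
  show ?thesis
    unfolding Vector_Spaces.linear_iff contract_operator_def add scale
    using fock.vector_space_axioms
    by (auto simp: fun_eq_iff fock_scale_def frag_linear_def sum.distrib distrib_left sum_distrib_left mult_ac)
qed

lemma contract_operator_cong:
  assumes m: "Poly_Mapping.keys m \<subseteq> wedge_words (dual_group G) 3"
    and "\<And>T. S \<subseteq> T \<Longrightarrow> finite (T - S) \<Longrightarrow> card (T - S) = 3 \<Longrightarrow> F T = F' T"
  shows "contract_operator m F S = contract_operator m F' S"
  unfolding contract_operator_def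
proof (rule frag_linear_cong)
  fix \<omega>s assume "\<omega>s \<in> Poly_Mapping.keys m"
  then have "length \<omega>s = 3"
    using m by (auto simp: wedge_words_def)
  then show "foldr contract_fock \<omega>s F S = foldr contract_fock \<omega>s F' S"
    using assms(2) by (intro foldr_annihilate_cong) auto
qed

lemma contract_operator_zero: "contract_operator m 0 = 0"
  using contract_operator_linear[of m] by (simp add: Vector_Spaces.linear_iff) (metis add_cancel_left_left)

lemma contract_operator_supported:
  assumes m: "Poly_Mapping.keys m \<subseteq> wedge_words (dual_group G) 3"
    and F: "F \<in> supported_on A"
    and AB: "\<And>S T. T \<in> A \<Longrightarrow> S \<subseteq> T \<Longrightarrow> finite (T - S) \<Longrightarrow> card (T - S) = 3 \<Longrightarrow> S \<in> B"
  shows "contract_operator m F \<in> supported_on B"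
  unfolding supported_on_def
proof (intro CollectI allI impI)
  fix S assume nz: "contract_operator m F S \<noteq> 0"
  have "\<exists>T. S \<subseteq> T \<and> finite (T - S) \<and> card (T - S) = 3 \<and> F T \<noteq> 0"
  proof (rule ccontr)
    assume "\<not> ?thesis"
    then have "contract_operator m F S = contract_operator m 0 S"
      by (intro contract_operator_cong[OF m]) auto
    then show False
      using nz by (simp only: contract_operator_zero zero_fun_apply)
  qed
  then show "S \<in> B"
    using F AB by (auto simp: supported_on_def)
qed

text \<open>
  Contraction with a trivector squares to zero because it has odd degree.
\<close>

lemma contract_operator_square:
  assumes m: "Poly_Mapping.keys m \<subseteq> wedge_words (dual_group G) 3"
  shows "contract_operator m (contract_operator m F) = 0"
proof
  fix S
  let ?t = "\<lambda>\<omega>s \<eta>s. foldr contract_fock \<omega>s (foldr contract_fock \<eta>s F) S"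
  have len: "length \<omega>s = 3" if "\<omega>s \<in> Poly_Mapping.keys m" for \<omega>s
    using that m by (auto simp: wedge_words_def)
  have anti: "?t \<omega>s \<eta>s = - ?t \<eta>s \<omega>s" if "\<omega>s \<in> Poly_Mapping.keys m" "\<eta>s \<in> Poly_Mapping.keys m" for \<omega>s \<eta>s
    using fun_cong[OF annihilate_triple_swap[OF len len, OF that, of b "\<lambda>\<omega> i. \<omega> (e i)" F], of S] by simp
  have X: "contract_operator m (contract_operator m F) S = frag_linear (\<lambda>\<omega>s. frag_linear (\<lambda>\<eta>s. ?t \<omega>s \<eta>s) m) m"
    unfolding contract_operator_def foldr_annihilate_frag_linear ..
  also have "\<dots> = frag_linear (\<lambda>\<eta>s. frag_linear (\<lambda>\<omega>s. ?t \<omega>s \<eta>s) m) m"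
    by (rule frag_linear_swap)
  also have "\<dots> = frag_linear (\<lambda>\<eta>s. frag_linear (\<lambda>\<omega>s. - ?t \<eta>s \<omega>s) m) m"
    by (intro frag_linear_cong anti)
  also have "\<dots> = - frag_linear (\<lambda>\<omega>s. frag_linear (\<lambda>\<eta>s. ?t \<omega>s \<eta>s) m) m"
    by (simp add: frag_linear_def sum_negf)
  finally show "contract_operator m (contract_operator m F) S = 0 S"
    by (simp add: X)
qed

definition contract_rank :: "(('a \<Rightarrow> int) list \<Rightarrow>\<^sub>0 int) \<Rightarrow> nat set set \<Rightarrow> nat" where
  "contract_rank m A = fock.dim (contract_operator m ` supported_on A)"

lemma supported_on_residue_span: "supported_on (residue_sets b q j) \<subseteq> fock.span (unit_fock ` Pow {..<b})"
  unfolding span_unit_fock[OF finite_Pow_iff[THEN iffD2, OF finite_lessThan]]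
  by (rule supported_on_mono) (auto simp: residue_sets_def)

lemma contract_operator_residue:
  assumes m: "Poly_Mapping.keys m \<subseteq> wedge_words (dual_group G) 3"
    and F: "F \<in> supported_on (residue_sets b q j)"
  shows "contract_operator m F \<in> supported_on (residue_sets b q (j - 3))"
proof (rule contract_operator_supported[OF m F])
  fix S T assume T: "T \<in> residue_sets b q j" "S \<subseteq> T" "finite (T - S)" "card (T - S) = 3"
  then have "finite T"
    using finite_subset by (auto simp: residue_sets_def)
  then have "card T = card S + 3"
    using T by (metis add.commute card_Diff_subset card_mono finite_subset le_add_diff_inverse)
  then have "int (card S) - (j - 3) = int (card T) - j"
    by simp
  then have "int (card S) mod q = (j - 3) mod q"
    using T by (simp only: residue_sets_def mod_eq_dvd_iff mem_Collect_eq)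
  then show "S \<in> residue_sets b q (j - 3)"
    using T by (auto simp: residue_sets_def)
qed

lemma contract_rank_nullity:
  "fock.dim {F \<in> supported_on (residue_sets b q j). contract_operator m F = 0}
    + contract_rank m (residue_sets b q j) = card (residue_sets b q j)"
  unfolding contract_rank_def dim_supported_on[OF finite_residue_sets, symmetric]
  by (rule fock.rank_nullity[OF contract_operator_linear subspace_supported_on supported_on_residue_span]) simp

text \<open>
  The image of one class lies in the kernel on the other class.
\<close>

lemma contract_rank_pair:
  assumes m: "Poly_Mapping.keys m \<subseteq> wedge_words (dual_group G) 3"
  shows "contract_rank m (residue_sets b 6 j) + contract_rank m (residue_sets b 6 (j - 3))
    \<le> card (residue_sets b 6 (j - 3))"
proof -
  have "contract_operator m ` supported_on (residue_sets b 6 j)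
      \<subseteq> {F \<in> supported_on (residue_sets b 6 (j - 3)). contract_operator m F = 0}"
    using contract_operator_residue[OF m] contract_operator_square[OF m] by auto
  then have "contract_rank m (residue_sets b 6 j)
      \<le> fock.dim {F \<in> supported_on (residue_sets b 6 (j - 3)). contract_operator m F = 0}"
    unfolding contract_rank_def using supported_on_residue_span[of 6 "j - 3"]
    by (intro fock.dim_mono_finite[where W = "unit_fock ` Pow {..<b}"])
      (auto intro: fock.span_base)
  then show ?thesis
    using contract_rank_nullity[of 6 "j - 3" m] by linarith
qed

lemma contract_rank_parity_le:
  "contract_rank m (residue_sets b 2 k) \<le> contract_rank m (residue_sets b 6 k)
    + contract_rank m (residue_sets b 6 (k + 2)) + contract_rank m (residue_sets b 6 (k + 4))"
proof -
  let ?R = "\<lambda>j. supported_on (residue_sets b 6 j)"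
  let ?D = "contract_operator m"
  interpret D: Vector_Spaces.linear fock_scale fock_scale ?D
    by (rule contract_operator_linear)
  let ?W = "?D ` unit_fock ` Pow {..<b}"
  have W: "?D ` ?R j \<subseteq> fock.span ?W" for j
    using supported_on_residue_span[of 6 j] by (auto simp: D.span_image)
  have "?D ` supported_on (residue_sets b 2 k) \<subseteq> fock.span (?D ` ?R k \<union> ?D ` ?R (k + 2) \<union> ?D ` ?R (k + 4))"
  proof (rule image_subsetI)
    fix F assume F: "F \<in> supported_on (residue_sets b 2 k)"
    \<comment> \<open>The components of \<open>F\<close> in the three classes modulo 6 that make up a class modulo 2.\<close>
    define part where "part j = (\<lambda>S. if int (card S) mod 6 = j mod 6 then F S else 0)" for j
    have "F = part k + part (k + 2) + part (k + 4)"
    proof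
      fix S
      show "F S = (part k + part (k + 2) + part (k + 4)) S"
      proof (cases "F S = 0")
        case False
        then have "int (card S) mod 2 = k mod 2"
          using F by (auto simp: supported_on_def residue_sets_def)
        then have "int (card S) mod 6 = k mod 6 \<or> int (card S) mod 6 = (k + 2) mod 6
            \<or> int (card S) mod 6 = (k + 4) mod 6"
          by (rule parity_imp_mod_6)
        moreover have "(k + 2) mod 6 \<noteq> k mod 6" "(k + 4) mod 6 \<noteq> k mod 6" "(k + 4) mod 6 \<noteq> (k + 2) mod 6"
          by (simp_all add: mod_eq_dvd_iff)
        moreover have "f = (if c = p then f else 0) + (if c = q then f else 0) + (if c = r then f else 0)"
          if "c = p \<or> c = q \<or> c = r" "q \<noteq> p" "r \<noteq> p" "r \<noteq> q" for f :: rat and c p q r :: int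
          using that by auto
        ultimately show ?thesis
          unfolding part_def plus_fun_apply by blast
      qed (simp add: part_def)
    qed
    then have "?D F = ?D (part k + part (k + 2) + part (k + 4))"
      by (rule arg_cong)
    then have "?D F = ?D (part k) + ?D (part (k + 2)) + ?D (part (k + 4))"
      unfolding D.add .
    moreover have "part j \<in> ?R j" for j
      using F by (auto simp: part_def supported_on_def residue_sets_def)
    ultimately show "?D F \<in> fock.span (?D ` ?R k \<union> ?D ` ?R (k + 2) \<union> ?D ` ?R (k + 4))"
      by (auto intro!: fock.span_add intro: fock.span_base)
  qed
  then have "contract_rank m (residue_sets b 2 k) \<le> fock.dim (?D ` ?R k \<union> ?D ` ?R (k + 2) \<union> ?D ` ?R (k + 4))"
    unfolding contract_rank_def using W by (intro fock.dim_mono_finite[where W = ?W]) auto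
  also have "\<dots> \<le> fock.dim (?D ` ?R k \<union> ?D ` ?R (k + 2)) + fock.dim (?D ` ?R (k + 4))"
    using W by (intro fock.dim_Un_le[where W = ?W]) auto
  also have "\<dots> \<le> fock.dim (?D ` ?R k) + fock.dim (?D ` ?R (k + 2)) + fock.dim (?D ` ?R (k + 4))"
    using W by (intro add_mono fock.dim_Un_le[where W = ?W]) auto
  finally show ?thesis
    by (simp add: contract_rank_def)
qed

text \<open>
  In each of the three pairs of classes modulo 6, the sum of the two ranks is at most the
  smaller of the two dimensions, which is half of their sum minus half of the absolute value of
  their difference. Summing over the pairs leaves half of the sum of the absolute excesses.
\<close>

lemma contract_rank_bound:
  assumes m: "Poly_Mapping.keys m \<subseteq> wedge_words (dual_group G) 3" and "b \<ge> 1"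
  shows "real (contract_rank m (residue_sets b 2 0) + contract_rank m (residue_sets b 2 1)) + cup_rank_bound b
    \<le> 2 ^ (b - 1)"
proof -
  let ?r = "\<lambda>j. int (contract_rank m (residue_sets b 6 j))"
  let ?n = "\<lambda>j. int (card (residue_sets b 6 j))"
  \<comment> \<open>The partner class \<open>j - 3\<close> of \<open>j\<close> is the class \<open>j + 3\<close>.\<close>
  have shift: "residue_sets b 6 (-3) = residue_sets b 6 3" "residue_sets b 6 (-2) = residue_sets b 6 4"
    "residue_sets b 6 (-1) = residue_sets b 6 5"
    by (auto intro!: residue_sets_cong)
  have pair: "?r j + ?r (j - 3) \<le> ?n (j - 3)" for j
    using contract_rank_pair[OF m, of j] by linarith
  have "2 * (?r j + ?r (j + 3)) + \<bar>excess b j\<bar> \<le> ?n j + ?n (j + 3)"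
    if "residue_sets b 6 (j - 3) = residue_sets b 6 (j + 3)" for j
    using pair[of j] pair[of "j + 3"] that by (simp add: excess_def)
  from this[of 0] this[of 1] this[of 2] shift
  have "2 * (?r 0 + ?r 3 + ?r 1 + ?r 4 + ?r 2 + ?r 5) + (\<bar>excess b 0\<bar> + \<bar>excess b 1\<bar> + \<bar>excess b 2\<bar>)
      \<le> ?n 0 + ?n 3 + ?n 1 + ?n 4 + ?n 2 + ?n 5"
    by simp
  moreover have "?n 0 + ?n 3 + ?n 1 + ?n 4 + ?n 2 + ?n 5 = 2 ^ b"
    using arg_cong[OF sum_card_residue_sets[of b], of int] by (simp add: eval_nat_numeral)
  moreover have "(2::int) ^ b = 2 * 2 ^ (b - 1)"
    using \<open>b \<ge> 1\<close> by (simp flip: power_Suc)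
  moreover have "int (contract_rank m (residue_sets b 2 0)) \<le> ?r 0 + ?r 2 + ?r 4"
    using contract_rank_parity_le[of m 0] by simp
  moreover have "int (contract_rank m (residue_sets b 2 1)) \<le> ?r 1 + ?r 3 + ?r 5"
    using contract_rank_parity_le[of m 1] by simp
  ultimately have "2 * int (contract_rank m (residue_sets b 2 0) + contract_rank m (residue_sets b 2 1))
      + (\<bar>excess b 0\<bar> + \<bar>excess b 1\<bar> + \<bar>excess b 2\<bar>) \<le> 2 * 2 ^ (b - 1)"
    by simp
  then have "real_of_int (2 * int (contract_rank m (residue_sets b 2 0) + contract_rank m (residue_sets b 2 1))
      + (\<bar>excess b 0\<bar> + \<bar>excess b 1\<bar> + \<bar>excess b 2\<bar>)) \<le> real_of_int (2 * 2 ^ (b - 1))"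
    by (simp only: of_int_le_iff)
  then show ?thesis
    using cup_rank_bound_excess[OF \<open>b \<ge> 1\<close>] by simp
qed

end

section \<open>The rank of the homology of the cup complex\<close>

text \<open>
  The homology of the cup complex of an arbitrary group and trivector; for first cohomology and
  the triple cup product it is \<open>cup_homology\<close>.
\<close>

definition homology_of_cup_complex where
  "homology_of_cup_complex H \<mu> k =
     subgroup_generated (cup_complex H k)
         (kernel (cup_complex H k) (cup_complex H (k - 1)) (cup_differential H \<mu> k))
       Mod (cup_differential H \<mu> (k + 1) ` carrier (cup_complex H (k + 1)))"

context based_group
begin

definition class_coords :: "('a list \<Rightarrow>\<^sub>0 int) set \<Rightarrow> fock" where
  "class_coords A = chain_coords (SOME c. c \<in> A)"

lemma class_coords_class: "class_coords (wedge_class G l c) = chain_coords c"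
proof -
  let ?c = "SOME c'. c' \<in> wedge_class G l c"
  have "c \<in> wedge_class G l c"
    using mem_wedge_class[OF is_monoid] wedge_relations_closed(1)[OF is_monoid] by simp
  then have "?c \<in> wedge_class G l c"
    by (rule someI)
  then have "?c - c \<in> wedge_relations G l"
    using mem_wedge_class[OF is_monoid] by blast
  from chain_coords_relation[OF this] have "chain_coords ?c = chain_coords c"
    by simp
  then show ?thesis
    by (simp add: class_coords_def)
qed

lemma class_coords_one: "class_coords \<one>\<^bsub>ext_power G l\<^esub> = 0"
  by (simp add: one_ext_power[OF is_monoid] class_coords_class)

lemma class_coords_mult:
  assumes "A \<in> carrier (ext_power G l)" "B \<in> carrier (ext_power G l)"
  shows "class_coords (A \<otimes>\<^bsub>ext_power G l\<^esub> B) = class_coords A + class_coords B"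
  using assms by (auto elim!: ext_powerE simp: mult_wedge_class[OF is_monoid] class_coords_class)

lemma class_coords_support:
  assumes "A \<in> carrier (ext_power G l)" "class_coords A S \<noteq> 0"
  shows "S \<in> index_sets l"
  using assms chain_coords_support by (auto elim!: ext_powerE simp: class_coords_class)

lemma class_coords_inj:
  assumes "A \<in> carrier (ext_power G l)" "B \<in> carrier (ext_power G l)"
    and "class_coords A = class_coords B"
  shows "A = B"
proof -
  obtain c d where c: "Poly_Mapping.keys c \<subseteq> wedge_words G l" "A = wedge_class G l c"
    and d: "Poly_Mapping.keys d \<subseteq> wedge_words G l" "B = wedge_class G l d"
    using assms by (auto elim!: ext_powerE)
  have "chain_coords (c - d) = 0"
    using assms(3) by (simp add: c d class_coords_class)
  moreover have "Poly_Mapping.keys (c - d) \<subseteq> wedge_words G l"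
    using keys_diff[of c d] c d by auto
  ultimately show ?thesis
    using chain_coords_eq_0_iff wedge_class_eq_iff[OF is_monoid] c(2) d(2) by blast
qed

lemma class_coords_contraction:
  assumes "Poly_Mapping.keys m \<subseteq> wedge_words (dual_group G) p" "A \<in> carrier (ext_power G k)"
  shows "contraction G p k (wedge_class (dual_group G) p m) A \<in> carrier (ext_power G (k - p))"
    and "class_coords (contraction G p k (wedge_class (dual_group G) p m) A)
      = contract_operator m (class_coords A)"
proof -
  obtain c where c: "Poly_Mapping.keys c \<subseteq> wedge_words G k" "A = wedge_class G k c"
    using assms(2) by (rule ext_powerE)
  show "contraction G p k (wedge_class (dual_group G) p m) A \<in> carrier (ext_power G (k - p))"
    unfolding c(2) contraction_class[OF assms(1) c(1)]
    by (rule wedge_class_in_ext_power[OF keys_contract_chain[OF c(1) assms(1)]])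
  show "class_coords (contraction G p k (wedge_class (dual_group G) p m) A)
      = contract_operator m (class_coords A)"
    unfolding c(2) contraction_class[OF assms(1) c(1)] class_coords_class
    by (rule chain_coords_contract_chain[OF assms(1) c(1)])
qed

lemma carrier_cup_complex:
  "carrier (cup_complex G k) = {\<alpha>. (\<forall>n. \<alpha> n \<in> carrier (ext_power G (k + 2 * n)))
    \<and> finite {n. \<alpha> n \<noteq> \<one>\<^bsub>ext_power G (k + 2 * n)\<^esub>}}"
proof -
  have "group (ext_power G l)" for l
    using comm_group_ext_power[OF is_monoid] by (simp add: comm_group_def)
  then show ?thesis
    unfolding cup_complex_def by (subst carrier_sum_group) (auto simp: PiE_def)
qed

lemma mult_cup_complex:
  "(\<alpha> \<otimes>\<^bsub>cup_complex G k\<^esub> \<beta>) n = \<alpha> n \<otimes>\<^bsub>ext_power G (k + 2 * n)\<^esub> \<beta> n"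
  and one_cup_complex: "\<one>\<^bsub>cup_complex G k\<^esub> n = \<one>\<^bsub>ext_power G (k + 2 * n)\<^esub>"
  by (simp_all add: cup_complex_def)

lemma comm_group_cup_complex: "comm_group (cup_complex G k)"
proof -
  have ext: "comm_group (ext_power G l)" for l
    by (rule comm_group_ext_power[OF is_monoid])
  then have "group (cup_complex G k)"
    unfolding cup_complex_def by (intro sum_group) (simp add: comm_group_def)
  then show ?thesis
  proof (rule group.group_comm_groupI)
    fix \<alpha> \<beta> assume "\<alpha> \<in> carrier (cup_complex G k)" "\<beta> \<in> carrier (cup_complex G k)"
    then show "\<alpha> \<otimes>\<^bsub>cup_complex G k\<^esub> \<beta> = \<beta> \<otimes>\<^bsub>cup_complex G k\<^esub> \<alpha>"
      by (intro HOL.ext) (simp add: mult_cup_complex carrier_cup_complex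
          comm_monoid.m_comm[OF comm_group.axioms(1)[OF ext]])
  qed
qed

text \<open>
  In degree \<open>k\<close> the exterior degree determines the power of \<open>U\<close>, so the coordinates of all
  components fit into one function on index sets, supported where the cardinality has the parity
  of \<open>k\<close>. This absorbs the variable \<open>U\<close>.
\<close>

definition complex_coords :: "int \<Rightarrow> (int \<Rightarrow> ('a list \<Rightarrow>\<^sub>0 int) set) \<Rightarrow> fock" where
  "complex_coords k \<alpha> = (\<lambda>S. if even (int (card S) - k)
     then class_coords (\<alpha> ((int (card S) - k) div 2)) S else 0)"

lemma complex_coords_at:
  assumes "int (card S) = k + 2 * n"
  shows "complex_coords k \<alpha> S = class_coords (\<alpha> n) S"
proof -
  have "int (card S) - k = 2 * n"
    using assms by simp
  then show ?thesis
    unfolding complex_coords_def by simp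
qed

lemma complex_coords_odd: "odd (int (card S) - k) \<Longrightarrow> complex_coords k \<alpha> S = 0"
  unfolding complex_coords_def by (rule if_not_P)

lemma degree_parity_cases:
  obtains n where "int (card S) = k + 2 * n" | "odd (int (card S) - k)"
  by (metis evenE diff_add_cancel add.commute)

lemma complex_coords_mult:
  assumes "\<alpha> \<in> carrier (cup_complex G k)" "\<beta> \<in> carrier (cup_complex G k)"
  shows "complex_coords k (\<alpha> \<otimes>\<^bsub>cup_complex G k\<^esub> \<beta>) = complex_coords k \<alpha> + complex_coords k \<beta>"
proof
  fix S
  show "complex_coords k (\<alpha> \<otimes>\<^bsub>cup_complex G k\<^esub> \<beta>) S = (complex_coords k \<alpha> + complex_coords k \<beta>) S"
  proof (rule degree_parity_cases[of S k])
    fix n assume n: "int (card S) = k + 2 * n"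
    have "\<alpha> n \<in> carrier (ext_power G (k + 2 * n))" "\<beta> n \<in> carrier (ext_power G (k + 2 * n))"
      using assms by (auto simp: carrier_cup_complex)
    then show ?thesis
      by (simp add: complex_coords_at[OF n] mult_cup_complex class_coords_mult)
  qed (simp add: complex_coords_odd)
qed

lemma complex_coords_one: "complex_coords k \<one>\<^bsub>cup_complex G k\<^esub> = 0"
proof
  fix S
  show "complex_coords k \<one>\<^bsub>cup_complex G k\<^esub> S = 0 S"
  proof (rule degree_parity_cases[of S k])
    fix n assume n: "int (card S) = k + 2 * n"
    show ?thesis
      by (simp add: complex_coords_at[OF n] one_cup_complex class_coords_one)
  qed (simp add: complex_coords_odd)
qed

lemma complex_coords_supported:
  assumes "\<alpha> \<in> carrier (cup_complex G k)"
  shows "complex_coords k \<alpha> \<in> supported_on (residue_sets b 2 k)"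
  unfolding supported_on_def
proof (intro CollectI allI impI)
  fix S assume nz: "complex_coords k \<alpha> S \<noteq> 0"
  then obtain n where n: "int (card S) = k + 2 * n"
    using degree_parity_cases[of S k] complex_coords_odd by metis
  then have "S \<in> index_sets (k + 2 * n)"
    using nz assms by (auto simp: complex_coords_at carrier_cup_complex intro: class_coords_support)
  then show "S \<in> residue_sets b 2 k"
    by (simp add: index_sets_def residue_sets_def)
qed

lemma complex_coords_inj:
  assumes "\<alpha> \<in> carrier (cup_complex G k)" "\<beta> \<in> carrier (cup_complex G k)"
    and eq: "complex_coords k \<alpha> = complex_coords k \<beta>"
  shows "\<alpha> = \<beta>"
proof
  fix n
  have ext: "\<alpha> n \<in> carrier (ext_power G (k + 2 * n))" "\<beta> n \<in> carrier (ext_power G (k + 2 * n))"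
    using assms(1,2) by (auto simp: carrier_cup_complex)
  have "class_coords (\<alpha> n) S = class_coords (\<beta> n) S" for S
  proof (cases "int (card S) = k + 2 * n")
    case True
    then show ?thesis
      using fun_cong[OF eq, of S] by (simp add: complex_coords_at)
  next
    case False
    then have "S \<notin> index_sets (k + 2 * n)"
      by (simp add: index_sets_def)
    then show ?thesis
      using class_coords_support[OF ext(1)] class_coords_support[OF ext(2)] by metis
  qed
  then show "\<alpha> n = \<beta> n"
    using class_coords_inj[OF ext] by blast
qed

lemma complex_coords_surj:
  assumes v: "v \<in> supported_on (residue_sets b 2 k)" and int: "\<And>S. S \<subseteq> {..<b} \<Longrightarrow> v S = of_int (n S)"
  obtains \<alpha> where "\<alpha> \<in> carrier (cup_complex G k)" "complex_coords k \<alpha> = v"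
proof -
  define c where "c l = (\<Sum>S\<in>index_sets l. frag_cmul (n S) (frag_of (basis_word S)))" for l
  define \<alpha> where "\<alpha> j = wedge_class G (k + 2 * j) (c (k + 2 * j))" for j
  have keys: "Poly_Mapping.keys (c l) \<subseteq> wedge_words G l" for l
    unfolding c_def using basis_word_in_words by (intro order.trans[OF keys_sum]) auto
  have coords: "chain_coords (c l) S = (if S \<in> index_sets l then v S else 0)" for l S
  proof -
    have "chain_coords (c l) S = (\<Sum>T\<in>index_sets l. of_int (n T) * word_coords (basis_word T) S)"
      by (simp add: c_def chain_coords_def frag_linear_sum)
    also have "\<dots> = (\<Sum>T\<in>index_sets l. if T = S then v S else 0)"
      using int by (intro sum.cong) (auto simp: word_coords_basis index_sets_def)
    finally show ?thesis by simp
  qed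
  \<comment> \<open>Exterior degrees above the rank contribute nothing, whence the finite support.\<close>
  have "{j. \<alpha> j \<noteq> \<one>\<^bsub>ext_power G (k + 2 * j)\<^esub>} \<subseteq> (\<lambda>l. (l - k) div 2) ` {0..int b}"
  proof
    fix j assume "j \<in> {j. \<alpha> j \<noteq> \<one>\<^bsub>ext_power G (k + 2 * j)\<^esub>}"
    then have "index_sets (k + 2 * j) \<noteq> {}"
      by (auto simp: \<alpha>_def c_def one_ext_power[OF is_monoid])
    then obtain S where "S \<subseteq> {..<b}" "int (card S) = k + 2 * j"
      by (auto simp: index_sets_def)
    then have "k + 2 * j \<in> {0..int b}"
      using card_mono[of "{..<b}" S] by simp
    then show "j \<in> (\<lambda>l. (l - k) div 2) ` {0..int b}"
      by (rule rev_image_eqI) simp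
  qed
  then have "finite {j. \<alpha> j \<noteq> \<one>\<^bsub>ext_power G (k + 2 * j)\<^esub>}"
    using finite_subset by blast
  then have "\<alpha> \<in> carrier (cup_complex G k)"
    using keys by (simp add: carrier_cup_complex \<alpha>_def wedge_class_in_ext_power)
  moreover have "complex_coords k \<alpha> = v"
  proof
    fix S
    show "complex_coords k \<alpha> S = v S"
    proof (cases "S \<in> residue_sets b 2 k")
      case True
      then have "2 dvd int (card S) - k"
        by (simp add: residue_sets_def mod_eq_dvd_iff)
      then obtain j where j: "int (card S) = k + 2 * j"
        by (metis dvdE add_diff_cancel_left' diff_add_cancel add.commute)
      then have "S \<in> index_sets (k + 2 * j)"
        using True by (simp add: index_sets_def residue_sets_def)
      then show ?thesis
        by (simp add: complex_coords_at[OF j] \<alpha>_def class_coords_class coords)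
    next
      case False
      then have "v S = 0"
        using v by (auto simp: supported_on_def)
      moreover have "complex_coords k \<alpha> S = 0"
        using False complex_coords_supported[OF \<open>\<alpha> \<in> _\<close>] by (auto simp: supported_on_def)
      ultimately show ?thesis by simp
    qed
  qed
  ultimately show thesis
    by (rule that)
qed

text \<open>
  Every integral vector of the right parity consists of the coordinates of an element, so a positive
  multiple of every rational one does.
\<close>

lemma clear_denominators:
  assumes "v \<in> supported_on (residue_sets b 2 k)"
  obtains N \<alpha> where "N > 0" "\<alpha> \<in> carrier (cup_complex G k)"
    "complex_coords k \<alpha> = fock_scale (of_int N) v"
proof -
  obtain N m where Nm: "N > 0" "\<And>S. S \<in> Pow {..<b} \<Longrightarrow> of_int N * v S = of_int (m S)"
    using common_denominator[of "Pow {..<b}" v] by auto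
  have "fock_scale (of_int N) v \<in> supported_on (residue_sets b 2 k)"
    by (intro fock.subspace_scale subspace_supported_on assms)
  moreover have "fock_scale (of_int N) v S = of_int (m S)" if "S \<subseteq> {..<b}" for S
    using Nm(2) that by (simp add: fock_scale_def)
  ultimately obtain \<alpha> where "\<alpha> \<in> carrier (cup_complex G k)"
      "complex_coords k \<alpha> = fock_scale (of_int N) v"
    using complex_coords_surj by blast
  then show thesis
    using that Nm(1) by blast
qed

lemma complex_coords_differential:
  assumes m: "Poly_Mapping.keys m \<subseteq> wedge_words (dual_group G) 3" "\<mu> = wedge_class (dual_group G) 3 m"
    and \<alpha>: "\<alpha> \<in> carrier (cup_complex G k)"
  shows "cup_differential G \<mu> k \<alpha> \<in> carrier (cup_complex G (k - 1))"
    and "complex_coords (k - 1) (cup_differential G \<mu> k \<alpha>) = contract_operator m (complex_coords k \<alpha>)"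
proof -
  let ?d = "cup_differential G \<mu> k \<alpha>"
  have ext: "\<alpha> n \<in> carrier (ext_power G (k + 2 * n))" for n
    using \<alpha> by (simp add: carrier_cup_complex)
  \<comment> \<open>The differential lowers the exterior degree by 3 and the total degree by 1, so the index drops by 1.\<close>
  have shift: "k + 2 * (n + 1) - 3 = k - 1 + 2 * n" for n
    by simp
  have d: "?d n \<in> carrier (ext_power G (k - 1 + 2 * n))"
    "class_coords (?d n) = contract_operator m (class_coords (\<alpha> (n + 1)))" for n
    using class_coords_contraction[OF m(1) ext[of "n + 1"]]
    unfolding shift cup_differential_def m(2) by auto
  have "{n. ?d n \<noteq> \<one>\<^bsub>ext_power G (k - 1 + 2 * n)\<^esub>} \<subseteq> (\<lambda>n. n - 1) ` {n. \<alpha> n \<noteq> \<one>\<^bsub>ext_power G (k + 2 * n)\<^esub>}"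
  proof
    fix n assume n: "n \<in> {n. ?d n \<noteq> \<one>\<^bsub>ext_power G (k - 1 + 2 * n)\<^esub>}"
    have "\<alpha> (n + 1) \<noteq> \<one>\<^bsub>ext_power G (k + 2 * (n + 1))\<^esub>"
    proof
      assume "\<alpha> (n + 1) = \<one>\<^bsub>ext_power G (k + 2 * (n + 1))\<^esub>"
      then have "class_coords (?d n) = class_coords \<one>\<^bsub>ext_power G (k - 1 + 2 * n)\<^esub>"
        by (simp only: d(2) class_coords_one contract_operator_zero)
      then have "?d n = \<one>\<^bsub>ext_power G (k - 1 + 2 * n)\<^esub>"
        using class_coords_inj[OF d(1)] comm_group_ext_power[OF is_monoid]
        by (metis comm_group_def group.is_monoid monoid.one_closed)
      then show False
        using n by simp
    qed
    then show "n \<in> (\<lambda>n. n - 1) ` {n. \<alpha> n \<noteq> \<one>\<^bsub>ext_power G (k + 2 * n)\<^esub>}"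
      by (intro rev_image_eqI[of "n + 1"]) auto
  qed
  then have "finite {n. ?d n \<noteq> \<one>\<^bsub>ext_power G (k - 1 + 2 * n)\<^esub>}"
    using \<alpha> finite_subset by (fastforce simp: carrier_cup_complex)
  then show closed: "?d \<in> carrier (cup_complex G (k - 1))"
    using d(1) by (simp add: carrier_cup_complex)
  show "complex_coords (k - 1) ?d = contract_operator m (complex_coords k \<alpha>)"
  proof
    fix S
    show "complex_coords (k - 1) ?d S = contract_operator m (complex_coords k \<alpha>) S"
    proof (cases "S \<in> residue_sets b 2 (k - 1)")
      case True
      then have "2 dvd int (card S) - (k - 1)"
        by (simp only: residue_sets_def mod_eq_dvd_iff mem_Collect_eq)
      then obtain n where n: "int (card S) = k - 1 + 2 * n"
        by (metis dvdE add_diff_cancel_left' diff_add_cancel add.commute)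
      have "finite S"
        using True finite_subset by (auto simp: residue_sets_def)
      have "contract_operator m (class_coords (\<alpha> (n + 1))) S = contract_operator m (complex_coords k \<alpha>) S"
      proof (rule contract_operator_cong[OF m(1)])
        fix T assume T: "S \<subseteq> T" "finite (T - S)" "card (T - S) = 3"
        then have "card T = card S + 3"
          using \<open>finite S\<close> by (metis add.commute card_Diff_subset card_mono finite_Diff2 le_add_diff_inverse)
        then have "int (card T) = k + 2 * (n + 1)"
          using n by simp
        then show "class_coords (\<alpha> (n + 1)) T = complex_coords k \<alpha> T"
          by (simp only: complex_coords_at)
      qed
      then show ?thesis
        by (simp add: complex_coords_at[OF n] d(2))
    next
      case False
      have "contract_operator m (complex_coords k \<alpha>) \<in> supported_on (residue_sets b 2 (k - 3))"
        by (rule contract_operator_residue[OF m(1) complex_coords_supported[OF \<alpha>]])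
      also have "residue_sets b 2 (k - 3) = residue_sets b 2 (k - 1)"
        by (rule residue_sets_cong) (simp add: mod_eq_dvd_iff)
      finally have "contract_operator m (complex_coords k \<alpha>) S = 0"
        using False by (rule supported_onD)
      moreover have "complex_coords (k - 1) ?d S = 0"
        using complex_coords_supported[OF closed] False by (rule supported_onD)
      ultimately show ?thesis by simp
    qed
  qed
qed

text \<open>
  Cycles modulo boundaries embed rationally into Fock space by a linear projection \<open>p\<close> whose kernel
  is the image of the operator: a cycle with coordinates in that image becomes a boundary after
  multiplication with a common denominator. The formula is then rank-nullity, once for \<open>p\<close> on
  the kernel of the operator and once for the operator itself.
\<close>

lemma group_rank_cup_homology:
  assumes m: "Poly_Mapping.keys m \<subseteq> wedge_words (dual_group G) 3" "\<mu> = wedge_class (dual_group G) 3 m"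
  obtains h where "group_rank (homology_of_cup_complex G \<mu> k) = enat h"
    and "h + contract_rank m (residue_sets b 2 k) + contract_rank m (residue_sets b 2 (k + 1))
      = card (residue_sets b 2 k)"
proof -
  let ?D = "contract_operator m" and ?V = "\<lambda>k. supported_on (residue_sets b 2 k)"
  let ?d = "cup_differential G \<mu>" and ?C = "cup_complex G" and ?\<Phi> = "complex_coords"
  interpret D: Vector_Spaces.linear fock_scale fock_scale ?D
    by (rule contract_operator_linear)
  interpret C: comm_group "?C k"
    by (rule comm_group_cup_complex)
  note diff = complex_coords_differential[OF m]
  define Z where "Z = kernel (?C k) (?C (k - 1)) (?d k)"
  define B where "B = ?d (k + 1) ` carrier (?C (k + 1))"
  have Z: "Z = {\<alpha> \<in> carrier (?C k). ?D (?\<Phi> k \<alpha>) = 0}"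
  proof -
    have "?d k \<alpha> = \<one>\<^bsub>?C (k - 1)\<^esub> \<longleftrightarrow> ?D (?\<Phi> k \<alpha>) = 0" if "\<alpha> \<in> carrier (?C k)" for \<alpha>
    proof -
      have "\<one>\<^bsub>?C (k - 1)\<^esub> \<in> carrier (?C (k - 1))"
        using comm_group_cup_complex by (simp add: comm_group_def group.is_monoid monoid.one_closed)
      then show ?thesis
        using complex_coords_inj[OF diff(1)[OF that], of "\<one>\<^bsub>?C (k - 1)\<^esub>"] diff(2)[OF that]
        by (metis complex_coords_one)
    qed
    then show ?thesis
      by (auto simp: Z_def kernel_def)
  qed
  have ZC: "\<alpha> \<in> carrier (?C k)" if "\<alpha> \<in> Z" for \<alpha>
    using that Z by simp
  have \<Phi>_inv: "?\<Phi> k (inv\<^bsub>?C k\<^esub> \<alpha>) = - ?\<Phi> k \<alpha>" if "\<alpha> \<in> carrier (?C k)" for \<alpha>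
    using complex_coords_mult[of \<alpha> k "inv\<^bsub>?C k\<^esub> \<alpha>"] that complex_coords_one[of k]
    by (simp add: eq_neg_iff_add_eq_0 add.commute del: plus_fun_apply)
  have subZ: "subgroup Z (?C k)"
  proof (rule C.subgroupI)
    show "Z \<noteq> {}"
      using complex_coords_one[of k] D.zero by (force simp: Z)
    show "inv\<^bsub>?C k\<^esub> \<alpha> \<in> Z" if "\<alpha> \<in> Z" for \<alpha>
      using that \<Phi>_inv[of \<alpha>] D.neg[of "?\<Phi> k \<alpha>"] by (simp add: Z)
    show "\<alpha> \<otimes>\<^bsub>?C k\<^esub> \<beta> \<in> Z" if "\<alpha> \<in> Z" "\<beta> \<in> Z" for \<alpha> \<beta>
      using that complex_coords_mult[of \<alpha> k \<beta>] D.add[of "?\<Phi> k \<alpha>" "?\<Phi> k \<beta>"] by (simp add: Z)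
  qed (auto simp: Z)
  let ?Z = "subgroup_generated (?C k) Z"
  have carZ: "carrier ?Z = Z"
    by (rule subgroup.carrier_subgroup_generated_subgroup[OF subZ])
  interpret Z: comm_group ?Z
    by (rule C.abelian_subgroup_generated[OF comm_group_cup_complex])
  have diffB: "?d (k + 1) \<beta> \<in> carrier (?C k)" "?\<Phi> k (?d (k + 1) \<beta>) = ?D (?\<Phi> (k + 1) \<beta>)"
    if "\<beta> \<in> carrier (?C (k + 1))" for \<beta>
    using diff[OF that] by simp_all
  have BZ: "B \<subseteq> Z"
    using diffB contract_operator_square[OF m(1)] by (auto simp: B_def Z)
  have "subgroup B (?C k)"
  proof -
    interpret C1: comm_group "?C (k + 1)"
      by (rule comm_group_cup_complex)
    have hom: "?d (k + 1) \<in> hom (?C (k + 1)) (?C k)"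
    proof (rule homI)
      fix \<alpha> \<beta> assume ab: "\<alpha> \<in> carrier (?C (k + 1))" "\<beta> \<in> carrier (?C (k + 1))"
      have "?\<Phi> k (?d (k + 1) (\<alpha> \<otimes>\<^bsub>?C (k + 1)\<^esub> \<beta>)) = ?D (?\<Phi> (k + 1) \<alpha> + ?\<Phi> (k + 1) \<beta>)"
        by (simp only: diffB(2) C1.m_closed ab complex_coords_mult)
      also have "\<dots> = ?\<Phi> k (?d (k + 1) \<alpha>) + ?\<Phi> k (?d (k + 1) \<beta>)"
        by (simp only: D.add diffB(2) ab)
      also have "\<dots> = ?\<Phi> k (?d (k + 1) \<alpha> \<otimes>\<^bsub>?C k\<^esub> ?d (k + 1) \<beta>)"
        by (simp only: complex_coords_mult diffB(1) ab)
      finally show "?d (k + 1) (\<alpha> \<otimes>\<^bsub>?C (k + 1)\<^esub> \<beta>) = ?d (k + 1) \<alpha> \<otimes>\<^bsub>?C k\<^esub> ?d (k + 1) \<beta>"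
        using ab diffB(1) by (intro complex_coords_inj[of _ k]) auto
    qed (use diffB(1) in auto)
    interpret h: group_hom "?C (k + 1)" "?C k" "?d (k + 1)"
      by unfold_locales (rule hom)
    show ?thesis
      unfolding B_def by (rule h.img_is_subgroup)
  qed
  then have subB: "subgroup B ?Z"
    using BZ by (simp add: C.subgroup_of_subgroup_generated)
  then have normB: "B \<lhd> ?Z"
    using Z.normal_iff_subgroup by blast
  define Q where "Q = ?Z Mod B"
  have "comm_group Q"
    unfolding Q_def by (rule Z.abelian_FactGroup[OF subB])
  have subU: "fock.subspace (?D ` ?V (k + 1))"
    by (rule D.subspace_image[OF subspace_supported_on])
  obtain p where p: "Vector_Spaces.linear fock_scale fock_scale p" "\<And>F. p F = 0 \<longleftrightarrow> F \<in> ?D ` ?V (k + 1)"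
    using fock.exists_linear_kernel[OF subU] by blast
  interpret p: Vector_Spaces.linear fock_scale fock_scale p
    by (rule p(1))
  define \<Psi> where "\<Psi> A = p (?\<Phi> k (SOME z. z \<in> A))" for A
  have carQ: "carrier Q = (\<lambda>z. B #>\<^bsub>?Z\<^esub> z) ` Z"
    by (auto simp: Q_def FactGroup_def RCOSETS_def carZ)
  have \<Psi>_coset: "\<Psi> (B #>\<^bsub>?Z\<^esub> z) = p (?\<Phi> k z)" if "z \<in> Z" for z
  proof -
    have "z \<in> B #>\<^bsub>?Z\<^esub> z"
      using Z.rcos_self[OF _ subB] that carZ by blast
    then have "(SOME y. y \<in> B #>\<^bsub>?Z\<^esub> z) \<in> B #>\<^bsub>?Z\<^esub> z"
      by (rule someI[where P = "\<lambda>y. y \<in> B #>\<^bsub>?Z\<^esub> z"])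
    then obtain \<beta> where \<beta>: "\<beta> \<in> carrier (?C (k + 1))" "(SOME y. y \<in> B #>\<^bsub>?Z\<^esub> z) = ?d (k + 1) \<beta> \<otimes>\<^bsub>?C k\<^esub> z"
      by (auto simp: r_coset_def B_def)
    have "?\<Phi> k (?d (k + 1) \<beta> \<otimes>\<^bsub>?C k\<^esub> z) = ?D (?\<Phi> (k + 1) \<beta>) + ?\<Phi> k z"
      using that diffB[OF \<beta>(1)] Z by (simp add: complex_coords_mult del: plus_fun_apply)
    moreover have "p (?D (?\<Phi> (k + 1) \<beta>)) = 0"
      using p(2) complex_coords_supported[OF \<beta>(1)] by blast
    ultimately show ?thesis
      by (simp add: \<Psi>_def \<beta>(2) p.add del: plus_fun_apply)
  qed
  have rank: "group_rank Q = enat (fock.dim (\<Psi> ` carrier Q))"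
  proof (rule fock.group_rank_eq_dim[OF \<open>comm_group Q\<close>])
    fix X Y assume "X \<in> carrier Q" "Y \<in> carrier Q"
    then obtain x y where xy: "x \<in> Z" "y \<in> Z" "X = B #>\<^bsub>?Z\<^esub> x" "Y = B #>\<^bsub>?Z\<^esub> y"
      by (auto simp: carQ)
    have "X \<otimes>\<^bsub>Q\<^esub> Y = B #>\<^bsub>?Z\<^esub> (x \<otimes>\<^bsub>?Z\<^esub> y)"
      using normal.rcos_sum[OF normB] xy by (simp add: Q_def carZ)
    moreover have "x \<otimes>\<^bsub>?Z\<^esub> y \<in> Z"
      using xy Z.m_closed carZ by blast
    ultimately show "\<Psi> (X \<otimes>\<^bsub>Q\<^esub> Y) = \<Psi> X + \<Psi> Y"
      using xy ZC by (simp add: \<Psi>_coset complex_coords_mult p.add del: plus_fun_apply)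
  next
    fix X assume "X \<in> carrier Q" and zero: "\<Psi> X = 0"
    then obtain x where x: "x \<in> Z" "X = B #>\<^bsub>?Z\<^esub> x"
      by (auto simp: carQ)
    then obtain v where v: "v \<in> ?V (k + 1)" "?\<Phi> k x = ?D v"
      using zero p(2) by (auto simp: \<Psi>_coset)
    obtain N \<beta> where N: "N > 0" "\<beta> \<in> carrier (?C (k + 1))" "?\<Phi> (k + 1) \<beta> = fock_scale (of_int N) v"
      using clear_denominators[OF v(1)] by blast
    have xC: "x \<in> carrier (?C k)"
      using x(1) Z by blast
    have npow: "?\<Phi> k (x [^]\<^bsub>?C k\<^esub> (n::nat)) = fock_scale (of_nat n) (?\<Phi> k x)" for n
    proof (induction n)
      case 0
      then show ?case
        by (simp add: complex_coords_one del: zero_fun_apply)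
    next
      case (Suc n)
      have "?\<Phi> k (x [^]\<^bsub>?C k\<^esub> Suc n) = fock_scale (of_nat n) (?\<Phi> k x) + ?\<Phi> k x"
        using xC by (simp add: complex_coords_mult Suc del: plus_fun_apply)
      then show ?case
        by (auto simp: fock_scale_def fun_eq_iff algebra_simps)
    qed
    obtain n where n: "N = int n"
      using N(1) zero_le_imp_eq_int[of N] by auto
    have "?\<Phi> k (x [^]\<^bsub>?C k\<^esub> n) = ?D (fock_scale (of_int N) v)"
      unfolding npow v(2) D.scale n by simp
    also have "\<dots> = ?\<Phi> k (?d (k + 1) \<beta>)"
      by (simp only: diffB(2)[OF N(2)] N(3))
    finally have "x [^]\<^bsub>?C k\<^esub> n = ?d (k + 1) \<beta>"
      using xC diffB(1)[OF N(2)] by (intro complex_coords_inj[of _ k]) auto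
    then have "x [^]\<^bsub>?Z\<^esub> n \<in> B"
      using N(2) by (simp add: pow_subgroup_generated B_def)
    moreover have "X [^]\<^bsub>Q\<^esub> n = B #>\<^bsub>?Z\<^esub> (x [^]\<^bsub>?Z\<^esub> n)"
      using hom_nat_pow[OF normal.r_coset_hom_Mod[OF normB], of x n] x \<open>comm_group Q\<close>
      by (simp add: Q_def carZ comm_group_def)
    ultimately have "X [^]\<^bsub>Q\<^esub> n = \<one>\<^bsub>Q\<^esub>"
      using Z.coset_join2[of _ B] subB by (simp add: Q_def subgroup.mem_carrier)
    then show "\<exists>n>0. X [^]\<^bsub>Q\<^esub> (n::int) = \<one>\<^bsub>Q\<^esub>"
      using N(1) n by (intro exI[of _ N]) (simp add: int_pow_int)
  next
    show "\<Psi> ` carrier Q \<subseteq> fock.span (p ` unit_fock ` Pow {..<b})"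
    proof (rule subsetI)
      fix F assume "F \<in> \<Psi> ` carrier Q"
      then obtain z where z: "z \<in> Z" "F = p (?\<Phi> k z)"
        by (auto simp: carQ \<Psi>_coset)
      then have "?\<Phi> k z \<in> fock.span (unit_fock ` Pow {..<b})"
        using complex_coords_supported[OF ZC] supported_on_residue_span[of 2 k] by blast
      then show "F \<in> fock.span (p ` unit_fock ` Pow {..<b})"
        unfolding p.span_image z(2) by (rule imageI)
    qed
    show "finite (p ` unit_fock ` Pow {..<b})"
      by simp
  qed
  define K where "K = {F \<in> ?V k. ?D F = 0}"
  have subK: "fock.subspace K"
    using subspace_supported_on[of "residue_sets b 2 k"]
    by (auto simp: K_def fock.subspace_def D.zero D.add D.scale simp del: plus_fun_apply zero_fun_apply)
  have spanZ: "fock.span (?\<Phi> k ` Z) = K"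
  proof (rule fock.span_subspace[OF _ _ subK])
    show "?\<Phi> k ` Z \<subseteq> K"
      using complex_coords_supported by (auto simp: Z K_def)
    show "K \<subseteq> fock.span (?\<Phi> k ` Z)"
    proof
      fix F assume F: "F \<in> K"
      then obtain N \<alpha> where N: "N > 0" "\<alpha> \<in> carrier (?C k)" "?\<Phi> k \<alpha> = fock_scale (of_int N) F"
        using clear_denominators[of F k] by (auto simp: K_def)
      have "\<alpha> \<in> Z"
        using N F by (simp add: Z D.scale K_def)
      moreover have "F = fock_scale (1 / of_int N) (?\<Phi> k \<alpha>)"
        using N(1,3) by (simp add: fock_scale_def fun_eq_iff)
      ultimately show "F \<in> fock.span (?\<Phi> k ` Z)"
        using fock.span_scale[OF fock.span_base] by (metis imageI)
    qed
  qed
  have "\<Psi> ` carrier Q = p ` ?\<Phi> k ` Z"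
    by (force simp: carQ \<Psi>_coset image_image)
  then have "fock.dim (\<Psi> ` carrier Q) = fock.dim (fock.span (p ` ?\<Phi> k ` Z))"
    by simp
  also have "\<dots> = fock.dim (p ` K)"
    by (simp only: p.span_image spanZ)
  finally have dimQ: "fock.dim (\<Psi> ` carrier Q) = fock.dim (p ` K)" .
  have DK: "?D ` ?V (k + 1) \<subseteq> K"
  proof -
    have "residue_sets b 2 (k + 1 - 3) = residue_sets b 2 k"
      by (rule residue_sets_cong) (simp add: mod_eq_dvd_iff)
    then show ?thesis
      using contract_operator_residue[OF m(1), of _ 2 "k + 1"] contract_operator_square[OF m(1)]
      by (auto simp: K_def)
  qed
  have Kspan: "K \<subseteq> fock.span (unit_fock ` Pow {..<b})"
    using supported_on_residue_span[of 2 k] by (auto simp: K_def)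
  have "{F \<in> K. p F = 0} = ?D ` ?V (k + 1)"
    using DK p(2) by auto
  then have "contract_rank m (residue_sets b 2 (k + 1)) + fock.dim (p ` K) = fock.dim K"
    using fock.rank_nullity[OF p(1) subK Kspan] by (simp add: contract_rank_def)
  moreover have "fock.dim K + contract_rank m (residue_sets b 2 k) = card (residue_sets b 2 k)"
    using contract_rank_nullity[of 2 k m] by (simp add: K_def)
  ultimately have "fock.dim (\<Psi> ` carrier Q) + contract_rank m (residue_sets b 2 k)
      + contract_rank m (residue_sets b 2 (k + 1)) = card (residue_sets b 2 k)"
    by (simp add: dimQ)
  moreover have "homology_of_cup_complex G \<mu> k = Q"
    by (simp add: homology_of_cup_complex_def Q_def Z_def B_def)
  ultimately show thesis
    using rank that by metis
qed

text \<open>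
  The operator ranks in degrees \<open>k\<close> and \<open>k + 1\<close> are those of the two parities in some order, which
  makes the rank independent of \<open>k\<close>.
\<close>

lemma cup_homology_rank_bounds:
  assumes \<mu>: "\<mu> \<in> carrier (ext_power (dual_group G) 3)" and "b \<ge> 1"
  obtains h where "\<And>k. group_rank (homology_of_cup_complex G \<mu> k) = enat h"
    and "cup_rank_bound b \<le> real h" "real h \<le> 2 ^ (b - 1)"
proof -
  obtain m where m: "Poly_Mapping.keys m \<subseteq> wedge_words (dual_group G) 3" "\<mu> = wedge_class (dual_group G) 3 m"
    using \<mu> by (rule ext_powerE)
  define r where "r k = contract_rank m (residue_sets b 2 k)" for k
  define h where "h = 2 ^ (b - 1) - (r 0 + r 1)"
  have parity: "r k + r (k + 1) = r 0 + r 1" for k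
  proof (cases "even k")
    case True
    then have "k mod 2 = 0 mod 2" "(k + 1) mod 2 = 1 mod 2"
      by presburger+
    then show ?thesis
      unfolding r_def by (metis residue_sets_cong)
  next
    case False
    then have "k mod 2 = 1 mod 2" "(k + 1) mod 2 = 0 mod 2"
      by presburger+
    then show ?thesis
      unfolding r_def by (metis residue_sets_cong add.commute)
  qed
  have "group_rank (homology_of_cup_complex G \<mu> k) = enat h" for k
  proof -
    obtain h' where h': "group_rank (homology_of_cup_complex G \<mu> k) = enat h'"
      "h' + r k + r (k + 1) = card (residue_sets b 2 k)"
      using group_rank_cup_homology[OF m, of k] unfolding r_def by metis
    then have "h' + (r 0 + r 1) = 2 ^ (b - 1)"
      using parity[of k] card_parity_sets[OF \<open>b \<ge> 1\<close>, of k] by simp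
    then show ?thesis
      using h'(1) by (simp add: h_def)
  qed
  moreover have bound: "real (r 0 + r 1) + cup_rank_bound b \<le> 2 ^ (b - 1)"
    unfolding r_def by (rule contract_rank_bound[OF m(1) \<open>b \<ge> 1\<close>])
  moreover have "cup_rank_bound b \<ge> 0"
    by (simp add: cup_rank_bound_def)
  moreover have "r 0 + r 1 \<le> 2 ^ (b - 1)"
  proof (rule of_nat_le_iff[where 'a = real, THEN iffD1])
    show "real (r 0 + r 1) \<le> real (2 ^ (b - 1))"
      using bound \<open>cup_rank_bound b \<ge> 0\<close> unfolding of_nat_power of_nat_numeral by linarith
  qed
  then have "real h = 2 ^ (b - 1) - real (r 0 + r 1)"
    unfolding h_def by (subst of_nat_diff) simp_all
  ultimately show thesis
    by (intro that[of h]) auto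
qed

text \<open>
  Words of length one embed the group itself into Fock space.
\<close>

lemma group_rank_based: "group_rank G = enat b"
proof -
  let ?\<Psi> = "\<lambda>x. word_coords [x]"
  have \<Psi>: "?\<Psi> x {i} = of_int (co i x)" if "i < b" for x i
  proof -
    have "?\<Psi> x {i} = (\<Sum>j<b. if j = i then of_int (co i x) else 0)"
      unfolding word_coords_def foldr.simps o_apply id_apply create_def
      by (intro sum.cong) (auto simp: vacuum_def)
    then show ?thesis
      using that by simp
  qed
  have "group_rank G = enat (fock.dim (?\<Psi> ` carrier G))"
  proof (rule fock.group_rank_eq_dim[OF comm_group_axioms])
    fix x y assume "x \<in> carrier G" "y \<in> carrier G"
    then show "?\<Psi> (x \<otimes> y) = ?\<Psi> x + ?\<Psi> y"
      by (simp add: word_coords_def create_coord_mult)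
  next
    fix x assume x: "x \<in> carrier G" "?\<Psi> x = 0"
    have "co i x = 0" if "i < b" for i
      using fun_cong[OF x(2), of "{i}"] that \<Psi>[OF that] by simp
    then have "x = \<one>"
      using coord_separates x(1) by blast
    then show "\<exists>n>0. x [^] (n::int) = \<one>"
      by (intro exI[of _ 1]) simp
  next
    show "?\<Psi> ` carrier G \<subseteq> fock.span (unit_fock ` Pow {..<b})"
      using word_coords_support
      by (subst span_unit_fock) (auto simp: supported_on_def)
  qed simp
  also have "fock.dim (?\<Psi> ` carrier G) = fock.dim (supported_on (index_sets 1))"
  proof -
    have "fock.span (?\<Psi> ` carrier G) = supported_on (index_sets 1)"
    proof (rule fock.span_subspace)
      show "?\<Psi> ` carrier G \<subseteq> supported_on (index_sets 1)"
        using word_coords_support by (auto simp: supported_on_def index_sets_def)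
      show "supported_on (index_sets 1) \<subseteq> fock.span (?\<Psi> ` carrier G)"
        unfolding span_unit_fock[OF finite_index_sets, symmetric]
      proof (rule fock.span_mono, rule image_subsetI)
        fix S assume S: "S \<in> index_sets 1"
        then obtain i where i: "S = {i}" "i < b"
          by (auto simp: index_sets_def card_1_singleton_iff)
        have "word_coords (basis_word S) = unit_fock S"
          using S by (simp add: word_coords_basis index_sets_def unit_fock_def)
        then show "unit_fock S \<in> ?\<Psi> ` carrier G"
          using i basis_closed by (auto simp: basis_word_def intro!: image_eqI[of _ _ "e i"])
      qed
    qed (rule subspace_supported_on)
    then show ?thesis
      by (metis fock.dim_span)
  qed
  also have "\<dots> = card (index_sets 1)"
    by (rule dim_supported_on) simp
  also have "index_sets 1 = (\<lambda>i. {i}) ` {..<b}"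
    by (auto simp: index_sets_def card_1_singleton_iff)
  also have "card \<dots> = b"
    by (subst card_image) (auto simp: inj_on_def)
  finally show ?thesis .
qed

end

section \<open>Alternating trilinear forms as trivectors\<close>

definition det3 :: "('h \<Rightarrow> int) list \<Rightarrow> 'h \<Rightarrow> 'h \<Rightarrow> 'h \<Rightarrow> int" where
  "det3 \<omega>s x y z = (let p = \<omega>s ! 0; q = \<omega>s ! 1; r = \<omega>s ! 2 in
    p x * q y * r z + p y * q z * r x + p z * q x * r y
    - p x * q z * r y - p y * q x * r z - p z * q y * r x)"

lemma sum_permutations_det3:
  "(\<Sum>\<pi> | \<pi> permutes {..<length [x, y, z]}.
     sign \<pi> * (\<Prod>i<length [x, y, z]. (\<omega>s ! i) ([x, y, z] ! \<pi> i))) = det3 \<omega>s x y z"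
proof -
  have f012: "finite {1::nat, 2}" "(0::nat) \<notin> {1, 2}"
    and f12: "finite {2::nat}" "(1::nat) \<notin> {2}" by auto
  have set3: "{..<length [x, y, z]} = {0, 1, 2}"
    by auto
  show ?thesis
    unfolding set3
    unfolding sum_over_permutations_insert[OF f012]
    unfolding sum_over_permutations_insert[OF f12]
    unfolding permutes_sing
    by (simp add: sign_swap_id permutation_swap_id sign_compose sign_id det3_def Let_def
        transpose_def algebra_simps)
qed

lemma frag_linear_add_fun: "frag_linear (\<lambda>x. f x + g x) c = frag_linear f c + frag_linear g c"
  by (simp add: frag_linear_def distrib_left sum.distrib)

lemma frag_linear_uminus_fun: "frag_linear (\<lambda>x. - f x) c = - frag_linear f c"
  by (simp add: frag_linear_def sum_negf)

context comm_group
begin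

lemma det3_relation:
  assumes x: "x \<in> carrier G" "y \<in> carrier G" "z \<in> carrier G"
    and r: "r \<in> wedge_relations (dual_group G) 3"
  shows "frag_linear (\<lambda>\<omega>s. det3 \<omega>s x y z) r = 0"
proof (rule frag_linear_wedge_relation[OF _ _ _ r])
  show "monoid (dual_group G)"
    using comm_group_dual_group[OF is_group] by (simp add: comm_group_def group.is_monoid)
  fix xs ys and \<phi> \<psi> :: "'a \<Rightarrow> int"
  assume "xs @ \<phi> # ys \<in> wedge_words (dual_group G) 3"
  then have "length xs + length ys = 2"
    by (simp add: wedge_words_def)
  then consider "xs = []" | u where "xs = [u]" | u v where "xs = [u, v]" "ys = []"
    by (cases xs; cases "tl xs"; cases "tl (tl xs)") auto
  then show "det3 (xs @ (\<phi> \<otimes>\<^bsub>dual_group G\<^esub> \<psi>) # ys) x y z = det3 (xs @ \<phi> # ys) x y z + det3 (xs @ \<psi> # ys) x y z"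
    by cases (simp_all add: det3_def Let_def mult_dual_group x algebra_simps)
next
  fix xs ys zs and \<phi> :: "'a \<Rightarrow> int"
  assume "xs @ \<phi> # ys @ \<phi> # zs \<in> wedge_words (dual_group G) 3"
  then have "length xs + length ys + length zs = 1"
    by (simp add: wedge_words_def)
  then consider u where "xs = [u]" "ys = []" "zs = []" | u where "xs = []" "ys = [u]" "zs = []"
    | u where "xs = []" "ys = []" "zs = [u]"
    by (cases xs; cases ys; cases zs) auto
  then show "det3 (xs @ \<phi> # ys @ \<phi> # zs) x y z = 0"
    by cases (simp_all add: det3_def Let_def algebra_simps)
qed

text \<open>
  The value of a trivector does not depend on the representing chain, as determinants are additive
  and alternating in their rows.
\<close>

lemma form_value_class:
  assumes x: "x \<in> carrier G" "y \<in> carrier G" "z \<in> carrier G"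
  shows "form_value (wedge_class (dual_group G) 3 m) [x, y, z] = frag_linear (\<lambda>\<omega>s. det3 \<omega>s x y z) m"
proof -
  have mon: "monoid (dual_group G)"
    using comm_group_dual_group[OF is_group] by (simp add: comm_group_def group.is_monoid)
  have "frag_linear (\<lambda>\<omega>s. det3 \<omega>s x y z) m' = frag_linear (\<lambda>\<omega>s. det3 \<omega>s x y z) m"
    if "m' \<in> wedge_class (dual_group G) 3 m" for m'
    using det3_relation[OF x, of "m' - m"] that mem_wedge_class[OF mon] by simp
  moreover have "m \<in> wedge_class (dual_group G) 3 m"
    using mem_wedge_class[OF mon] wedge_relations_closed(1)[OF mon] by simp
  ultimately have "{frag_linear (\<lambda>\<omega>s. det3 \<omega>s x y z) m' | m'. m' \<in> wedge_class (dual_group G) 3 m}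
      = {frag_linear (\<lambda>\<omega>s. det3 \<omega>s x y z) m}"
    by blast
  then show ?thesis
    unfolding form_value_def frag_eval_eq_linear sum_permutations_det3 by simp
qed

text \<open>
  Antisymmetry under adjacent exchanges implies vanishing on repetitions because the values are
  integers, and additivity in the other places follows from the first one.
\<close>

definition alternating_trilinear :: "('a \<Rightarrow> 'a \<Rightarrow> 'a \<Rightarrow> int) \<Rightarrow> bool" where
  "alternating_trilinear f \<longleftrightarrow>
     (\<forall>x\<in>carrier G. \<forall>x'\<in>carrier G. \<forall>y\<in>carrier G. \<forall>z\<in>carrier G. f (x \<otimes> x') y z = f x y z + f x' y z) \<and>
     (\<forall>x\<in>carrier G. \<forall>y\<in>carrier G. \<forall>z\<in>carrier G. f y x z = - f x y z \<and> f x z y = - f x y z)"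

lemma alternating_trilinearD:
  assumes "alternating_trilinear f" and x: "x \<in> carrier G" "y \<in> carrier G" "z \<in> carrier G"
  shows "x' \<in> carrier G \<Longrightarrow> f (x \<otimes> x') y z = f x y z + f x' y z"
    and "f y x z = - f x y z" and "f x z y = - f x y z"
proof -
  note A = assms(1)[unfolded alternating_trilinear_def]
  show "f (x \<otimes> x') y z = f x y z + f x' y z" if "x' \<in> carrier G"
    using bspec[OF bspec[OF bspec[OF bspec[OF conjunct1[OF A] x(1)] that] x(2)] x(3)] .
  show "f y x z = - f x y z" "f x z y = - f x y z"
    using bspec[OF bspec[OF bspec[OF conjunct2[OF A] x(1)] x(2)] x(3)] by blast+
qed

lemma alternating_trilinear_form_value:
  assumes m: "Poly_Mapping.keys m \<subseteq> wedge_words (dual_group G) 3"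
  shows "alternating_trilinear (\<lambda>x y z. frag_linear (\<lambda>\<omega>s. det3 \<omega>s x y z) m)"
  unfolding alternating_trilinear_def
proof (intro conjI ballI)
  fix x x' y z assume x: "x \<in> carrier G" "x' \<in> carrier G" "y \<in> carrier G" "z \<in> carrier G"
  show "frag_linear (\<lambda>\<omega>s. det3 \<omega>s (x \<otimes> x') y z) m =
      frag_linear (\<lambda>\<omega>s. det3 \<omega>s x y z) m + frag_linear (\<lambda>\<omega>s. det3 \<omega>s x' y z) m"
    unfolding frag_linear_add_fun[symmetric]
  proof (rule frag_linear_cong)
    fix \<omega>s assume "\<omega>s \<in> Poly_Mapping.keys m"
    then have "length \<omega>s = 3" "set \<omega>s \<subseteq> carrier (dual_group G)"
      using m by (auto simp: wedge_words_def)
    then have "\<omega>s ! i \<in> carrier (dual_group G)" if "i < 3" for i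
      using that by (metis nth_mem subsetD)
    then show "det3 \<omega>s (x \<otimes> x') y z = det3 \<omega>s x y z + det3 \<omega>s x' y z"
      using x by (simp add: det3_def Let_def dual_group_add[where G = G] algebra_simps)
  qed
next
  have swap: "det3 \<omega>s y x z = - det3 \<omega>s x y z" "det3 \<omega>s x z y = - det3 \<omega>s x y z" for \<omega>s x y z
    by (simp_all add: det3_def Let_def algebra_simps)
  show "frag_linear (\<lambda>\<omega>s. det3 \<omega>s y x z) m = - frag_linear (\<lambda>\<omega>s. det3 \<omega>s x y z) m" for x y z
    unfolding frag_linear_uminus_fun[symmetric] by (rule frag_linear_cong) (rule swap)
  show "frag_linear (\<lambda>\<omega>s. det3 \<omega>s x z y) m = - frag_linear (\<lambda>\<omega>s. det3 \<omega>s x y z) m" for x y z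
    unfolding frag_linear_uminus_fun[symmetric] by (rule frag_linear_cong) (rule swap)
qed

end

context based_group
begin

lemma additive_eq_0:
  assumes add: "\<And>x y. x \<in> carrier G \<Longrightarrow> y \<in> carrier G \<Longrightarrow> g (x \<otimes> y) = g x + (g y :: int)"
    and zero: "\<And>i. i < b \<Longrightarrow> g (e i) = 0" and x: "x \<in> carrier G"
  shows "g x = 0"
proof -
  have "restrict g (carrier G) \<in> carrier (dual_group G)"
    by (rule dual_groupI) (auto simp: add)
  from form_expansion[OF this x] have "g x = (\<Sum>i<b. restrict g (carrier G) (e i) * co i x)"
    using x by simp
  also have "\<dots> = 0"
    using basis_closed zero by (intro sum.neutral) auto
  finally show ?thesis .
qed

text \<open>
  Each basis triple is, up to sign, an increasing one or has a repetition.
\<close>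

lemma alternating_trilinear_eq_0:
  assumes f: "alternating_trilinear f"
    and zero: "\<And>i j k. i < j \<Longrightarrow> j < k \<Longrightarrow> k < b \<Longrightarrow> f (e i) (e j) (e k) = 0"
    and x: "x \<in> carrier G" "y \<in> carrier G" "z \<in> carrier G"
  shows "f x y z = 0"
proof -
  have add1: "f (x \<otimes> x') y z = f x y z + f x' y z"
    if "x \<in> carrier G" "x' \<in> carrier G" "y \<in> carrier G" "z \<in> carrier G" for x x' y z
    by (rule alternating_trilinearD(1)[OF f that(1,3,4,2)])
  have anti: "f y x z = - f x y z" "f x z y = - f x y z"
    if "x \<in> carrier G" "y \<in> carrier G" "z \<in> carrier G" for x y z
    by (rule alternating_trilinearD[OF f that])+
  have add2: "f y (x \<otimes> x') z = f y x z + f y x' z"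
    if "x \<in> carrier G" "x' \<in> carrier G" "y \<in> carrier G" "z \<in> carrier G" for x x' y z
    using add1[OF that] anti(1)[of "x \<otimes> x'" y z] anti(1)[of x y z] anti(1)[of x' y z] that by simp
  have add3: "f y z (x \<otimes> x') = f y z x + f y z x'"
    if "x \<in> carrier G" "x' \<in> carrier G" "y \<in> carrier G" "z \<in> carrier G" for x x' y z
    using add2[OF that] anti(2)[of y "x \<otimes> x'" z] anti(2)[of y x z] anti(2)[of y x' z] that by simp
  have basis: "f (e i) (e j) (e k) = 0" if "i < b" "j < b" "k < b" for i j k
  proof -
    have swap: "f (e j) (e i) (e k) = - f (e i) (e j) (e k)" "f (e i) (e k) (e j) = - f (e i) (e j) (e k)"
      if "i < b" "j < b" "k < b" for i j k
      using anti[of "e i" "e j" "e k"] basis_closed that by simp_all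
    consider "i = j" | "j = k" | "i = k" | "i < j" "j < k" | "i < k" "k < j" | "j < i" "i < k"
      | "j < k" "k < i" | "k < i" "i < j" | "k < j" "j < i"
      by linarith
    then show ?thesis
    proof cases
      case 1
      then show ?thesis using swap(1)[of i j k] that by simp
    next
      case 2
      then show ?thesis using swap(2)[of i j k] that by simp
    next
      case 3
      then show ?thesis using swap(1)[of i j k] swap(2)[of j i i] that by simp
    next
      case 4
      then show ?thesis using zero that by simp
    next
      case 5
      then show ?thesis using zero[of i k j] swap(2)[of i j k] that by simp
    next
      case 6
      then show ?thesis using zero[of j i k] swap(1)[of i j k] that by simp
    next
      case 7
      then show ?thesis using zero[of j k i] swap(1)[of i j k] swap(2)[of j i k] that by simp
    next
      case 8
      then show ?thesis using zero[of k i j] swap(2)[of i j k] swap(1)[of i k j] that by simp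
    next
      case 9
      then show ?thesis
        using zero[of k j i] swap(1)[of i j k] swap(2)[of j i k] swap(1)[of j k i] that by simp
    qed
  qed
  have 1: "f x (e j) (e k) = 0" if jk: "j < b" "k < b" and x: "x \<in> carrier G" for x j k
  proof (rule additive_eq_0[of "\<lambda>x. f x (e j) (e k)", OF _ _ x])
    show "f (x \<otimes> x') (e j) (e k) = f x (e j) (e k) + f x' (e j) (e k)"
      if "x \<in> carrier G" "x' \<in> carrier G" for x x'
      by (rule add1[OF that basis_closed[OF jk(1)] basis_closed[OF jk(2)]])
  qed (rule basis[OF _ jk])
  have 2: "f x y (e k) = 0" if k: "k < b" and x: "x \<in> carrier G" and y: "y \<in> carrier G" for x y k
  proof (rule additive_eq_0[of "\<lambda>y. f x y (e k)", OF _ _ y])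
    show "f x (y \<otimes> y') (e k) = f x y (e k) + f x y' (e k)"
      if "y \<in> carrier G" "y' \<in> carrier G" for y y'
      by (rule add2[OF that x basis_closed[OF k]])
  qed (rule 1[OF _ k x])
  show ?thesis
  proof (rule additive_eq_0[of "\<lambda>z. f x y z", OF _ _ x(3)])
    show "f x y (z \<otimes> z') = f x y z + f x y z'" if "z \<in> carrier G" "z' \<in> carrier G" for z z'
      by (rule add3[OF that x(1,2)])
  qed (rule 2[OF _ x(1,2)])
qed

definition dual_basis :: "nat \<Rightarrow> 'a \<Rightarrow> int" where
  "dual_basis i = restrict (co i) (carrier G)"

text \<open>
  A form is the combination of the coordinate functions with its values on the basis as coefficients.
\<close>

lemma based_group_dual: "based_group (dual_group G) b dual_basis (\<lambda>i \<omega>. \<omega> (e i))"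
proof -
  interpret D: comm_group "dual_group G"
    by (rule comm_group_dual_group[OF is_group])
  have closed: "dual_basis i \<in> carrier (dual_group G)" if "i < b" for i
    unfolding dual_basis_def using that by (intro dual_groupI) (auto simp: coord_mult)
  show ?thesis
  proof
    fix K assume K: "subgroup K (dual_group G)" and basis: "\<And>i. i < b \<Longrightarrow> dual_basis i \<in> K"
    interpret K: subgroup K "dual_group G" by (fact K)
    have inv: "inv\<^bsub>dual_group G\<^esub> (dual_basis i) = (\<lambda>x\<in>carrier G. - co i x)" if "i < b" for i
    proof (rule D.inv_equality[OF _ closed[OF that]])
      show "(\<lambda>x\<in>carrier G. - co i x) \<in> carrier (dual_group G)"
        using that by (intro dual_groupI) (auto simp: coord_mult)
    qed (auto simp: mult_dual_group one_dual_group dual_basis_def)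
    have mult: "(\<lambda>x\<in>carrier G. k * co i x) \<in> K" if "i < b" for i k
    proof (induction k rule: int_induct[where k = 0])
      case base
      show ?case
        using K.one_closed by (simp add: one_dual_group restrict_def)
    next
      case (step1 k)
      have "(\<lambda>x\<in>carrier G. (k + 1) * co i x) = (\<lambda>x\<in>carrier G. k * co i x) \<otimes>\<^bsub>dual_group G\<^esub> dual_basis i"
        by (auto simp: mult_dual_group dual_basis_def algebra_simps)
      then show ?case
        using K.m_closed[OF step1(2) basis[OF that]] by (simp only:)
    next
      case (step2 k)
      have "(\<lambda>x\<in>carrier G. (k - 1) * co i x) =
          (\<lambda>x\<in>carrier G. k * co i x) \<otimes>\<^bsub>dual_group G\<^esub> inv\<^bsub>dual_group G\<^esub> (dual_basis i)"
        by (auto simp: mult_dual_group inv[OF that] algebra_simps)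
      then show ?case
        using K.m_closed[OF step2(2) K.m_inv_closed[OF basis[OF that]]] by (simp only:)
    qed
    show "carrier (dual_group G) \<subseteq> K"
    proof
      fix \<omega> assume \<omega>: "\<omega> \<in> carrier (dual_group G)"
      have "n \<le> b \<Longrightarrow> (\<lambda>x\<in>carrier G. \<Sum>i<n. \<omega> (e i) * co i x) \<in> K" for n
      proof (induction n)
        case 0
        then show ?case
          using K.one_closed by (simp add: one_dual_group restrict_def)
      next
        case (Suc n)
        have "(\<lambda>x\<in>carrier G. \<Sum>i<Suc n. \<omega> (e i) * co i x) =
            (\<lambda>x\<in>carrier G. \<Sum>i<n. \<omega> (e i) * co i x) \<otimes>\<^bsub>dual_group G\<^esub> (\<lambda>x\<in>carrier G. \<omega> (e n) * co n x)"
          by (auto simp: mult_dual_group)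
        then show ?case
          using K.m_closed[OF Suc.IH mult[of n "\<omega> (e n)"]] Suc.prems by (simp only: Suc_le_eq order_less_imp_le)
      qed
      moreover have "\<omega> = (\<lambda>x\<in>carrier G. \<Sum>i<b. \<omega> (e i) * co i x)"
        using \<omega> form_expansion[OF \<omega>] by (auto simp: carrier_dual_group extensional_def fun_eq_iff)
      ultimately show "\<omega> \<in> K"
        by (metis order_refl)
    qed
  next
    show "dual_basis i \<in> carrier (dual_group G)" if "i < b" for i
      using that by (rule closed)
  qed (auto simp: mult_dual_group basis_closed dual_basis_def coord_basis)
qed

lemma index_sets_3E:
  assumes "S \<in> index_sets 3"
  obtains i j k where "i < j" "j < k" "k < b" "S = {i, j, k}" "sorted_list_of_set S = [i, j, k]"
proof -
  have S: "finite S" "S \<subseteq> {..<b}" "card S = 3"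
    using assms finite_subset[of S "{..<b}"] by (auto simp: index_sets_def)
  then have "length (sorted_list_of_set S) = 3"
    by simp
  then obtain i j k where l: "sorted_list_of_set S = [i, j, k]"
    unfolding numeral_3_eq_3 length_Suc_conv by blast
  moreover have "set (sorted_list_of_set S) = S" "sorted_wrt (<) (sorted_list_of_set S)"
    using \<open>finite S\<close> by auto
  ultimately show thesis
    using that[of i j k] \<open>S \<subseteq> {..<b}\<close> by auto
qed

lemma det3_dual_basis:
  assumes "i < j" "j < k" "k < b" "p < q" "q < r" "r < b"
  shows "det3 [dual_basis i, dual_basis j, dual_basis k] (e p) (e q) (e r)
    = (if i = p \<and> j = q \<and> k = r then 1 else 0)"
  using assms by (auto simp: det3_def Let_def dual_basis_def basis_closed coord_basis)

text \<open>
  Trivectors and alternating trilinear forms are the same over the integers. The increasing words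
  in the dual basis are dual to the increasing basis triples, so the values on those triples are
  both the prescribed and the only possible coefficients.
\<close>

lemma alternating_trilinear_form_unique:
  assumes f: "alternating_trilinear f"
  shows "\<exists>!M. M \<in> carrier (ext_power (dual_group G) 3) \<and>
    (\<forall>x\<in>carrier G. \<forall>y\<in>carrier G. \<forall>z\<in>carrier G. form_value M [x, y, z] = f x y z)"
proof -
  interpret dual: based_group "dual_group G" b dual_basis "\<lambda>i \<omega>. \<omega> (e i)"
    by (rule based_group_dual)
  have eval: "frag_linear (\<lambda>\<omega>s. det3 \<omega>s (e p) (e q) (e r))
      (\<Sum>S\<in>dual.index_sets 3. frag_cmul (n S) (frag_of (dual.basis_word S))) = n {p, q, r}"
    if pqr: "p < q" "q < r" "r < b" for p q r and n :: "nat set \<Rightarrow> int"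
  proof -
    have mem: "{p, q, r} \<in> dual.index_sets 3"
      using pqr by (auto simp: dual.index_sets_def)
    have "det3 (dual.basis_word S) (e p) (e q) (e r) = (if S = {p, q, r} then 1 else 0)"
      if "S \<in> dual.index_sets 3" for S
    proof -
      obtain i j k where S: "i < j" "j < k" "k < b" "S = {i, j, k}" "sorted_list_of_set S = [i, j, k]"
        using \<open>S \<in> dual.index_sets 3\<close> by (rule dual.index_sets_3E)
      have "S = {p, q, r} \<longleftrightarrow> i = p \<and> j = q \<and> k = r"
      proof
        assume "S = {p, q, r}"
        moreover have "sorted_list_of_set {p, q, r} = [p, q, r]"
          using pqr by simp
        ultimately show "i = p \<and> j = q \<and> k = r"
          using S(5) by simp
      qed (simp add: S(4))
      then show ?thesis
        using det3_dual_basis[OF S(1-3) pqr] by (simp add: dual.basis_word_def S(5))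
    qed
    then have "(\<Sum>S\<in>dual.index_sets 3. n S * det3 (dual.basis_word S) (e p) (e q) (e r)) =
        (\<Sum>S\<in>dual.index_sets 3. if S = {p, q, r} then n {p, q, r} else 0)"
      by (intro sum.cong) auto
    then show ?thesis
      using mem by (simp add: frag_linear_sum)
  qed
  show ?thesis
  proof (rule ex_ex1I)
    define n where "n S = (let l = sorted_list_of_set S in f (e (l ! 0)) (e (l ! 1)) (e (l ! 2)))" for S
    define m where "m = (\<Sum>S\<in>dual.index_sets 3. frag_cmul (n S) (frag_of (dual.basis_word S)))"
    have m: "Poly_Mapping.keys m \<subseteq> wedge_words (dual_group G) 3"
      unfolding m_def using dual.basis_word_in_words by (intro order.trans[OF keys_sum]) auto
    let ?h = "\<lambda>x y z. frag_linear (\<lambda>\<omega>s. det3 \<omega>s x y z) m"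
    have h: "alternating_trilinear ?h"
      by (rule alternating_trilinear_form_value[OF m])
    have "alternating_trilinear (\<lambda>x y z. ?h x y z - f x y z)"
      unfolding alternating_trilinear_def
    proof (intro conjI ballI)
      fix x y z assume x: "x \<in> carrier G" "y \<in> carrier G" "z \<in> carrier G"
      show "?h (x \<otimes> x') y z - f (x \<otimes> x') y z = ?h x y z - f x y z + (?h x' y z - f x' y z)"
        if "x' \<in> carrier G" for x'
        using alternating_trilinearD(1)[OF f x that] alternating_trilinearD(1)[OF h x that] by linarith
      show "?h y x z - f y x z = - (?h x y z - f x y z)"
        using alternating_trilinearD(2)[OF f x] alternating_trilinearD(2)[OF h x] by linarith
      show "?h x z y - f x z y = - (?h x y z - f x y z)"
        using alternating_trilinearD(3)[OF f x] alternating_trilinearD(3)[OF h x] by linarith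
    qed
    moreover have "?h (e i) (e j) (e k) - f (e i) (e j) (e k) = 0" if "i < j" "j < k" "k < b" for i j k
    proof -
      have "sorted_list_of_set {i, j, k} = [i, j, k]"
        using that by simp
      then have "n {i, j, k} = f (e i) (e j) (e k)"
        unfolding n_def Let_def by simp
      then show ?thesis
        unfolding m_def eval[OF that] by simp
    qed
    ultimately have "?h x y z - f x y z = 0" if "x \<in> carrier G" "y \<in> carrier G" "z \<in> carrier G" for x y z
      using that by (rule alternating_trilinear_eq_0)
    then show "\<exists>M. M \<in> carrier (ext_power (dual_group G) 3) \<and>
        (\<forall>x\<in>carrier G. \<forall>y\<in>carrier G. \<forall>z\<in>carrier G. form_value M [x, y, z] = f x y z)"
      using wedge_class_in_ext_power[OF m]
      by (intro exI[of _ "wedge_class (dual_group G) 3 m"]) (auto simp: form_value_class)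
  next
    fix M N
    assume M: "M \<in> carrier (ext_power (dual_group G) 3) \<and>
        (\<forall>x\<in>carrier G. \<forall>y\<in>carrier G. \<forall>z\<in>carrier G. form_value M [x, y, z] = f x y z)"
      and N: "N \<in> carrier (ext_power (dual_group G) 3) \<and>
        (\<forall>x\<in>carrier G. \<forall>y\<in>carrier G. \<forall>z\<in>carrier G. form_value N [x, y, z] = f x y z)"
    obtain m n where m: "Poly_Mapping.keys m \<subseteq> wedge_words (dual_group G) 3" "M = wedge_class (dual_group G) 3 m"
      and n: "Poly_Mapping.keys n \<subseteq> wedge_words (dual_group G) 3" "N = wedge_class (dual_group G) 3 n"
      using M N by (meson ext_powerE)
    have "Poly_Mapping.keys (m - n) \<subseteq> wedge_words (dual_group G) 3"
      using keys_diff[of m n] m n by auto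
    then obtain u where u: "m - n - (\<Sum>S\<in>dual.index_sets 3. frag_cmul (u S) (frag_of (dual.basis_word S)))
        \<in> wedge_relations (dual_group G) 3"
      using dual.reducible_chain unfolding dual.reducible_def by blast
    have "u S = 0" if S: "S \<in> dual.index_sets 3" for S
    proof -
      obtain i j k where S: "i < j" "j < k" "k < b" "S = {i, j, k}"
        using S by (rule dual.index_sets_3E)
      then have e: "e i \<in> carrier G" "e j \<in> carrier G" "e k \<in> carrier G"
        using basis_closed by auto
      have "frag_linear (\<lambda>\<omega>s. det3 \<omega>s (e i) (e j) (e k)) (m - n) = 0"
        using M N e by (simp add: m(2) n(2) form_value_class)
      then show ?thesis
        using det3_relation[OF e u] eval[OF S(1-3), of u] by (simp add: S(4))
    qed
    then have "m - n \<in> wedge_relations (dual_group G) 3"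
      using u by simp
    then show "M = N"
      unfolding m(2) n(2) using wedge_class_eq_iff[OF dual.is_monoid] by blast
  qed
qed

end

section \<open>Bases of torsionless groups of finite rank\<close>

context comm_group
begin

lemma additive_group_facts:
  fixes \<psi> :: "'a \<Rightarrow> int"
  assumes add: "\<And>x y. x \<in> carrier G \<Longrightarrow> y \<in> carrier G \<Longrightarrow> \<psi> (x \<otimes> y) = \<psi> x + \<psi> y"
  shows "\<psi> \<one> = 0"
    and "x \<in> carrier G \<Longrightarrow> \<psi> (inv x) = - \<psi> x"
    and "x \<in> carrier G \<Longrightarrow> \<psi> (x [^] (n::int)) = n * \<psi> x"
    and "finite S \<Longrightarrow> g \<in> S \<rightarrow> carrier G \<Longrightarrow> \<psi> (finprod G g S) = (\<Sum>x\<in>S. \<psi> (g x))"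
proof -
  show one: "\<psi> \<one> = 0"
    using add[of \<one> \<one>] by simp
  show inv: "\<psi> (inv x) = - \<psi> x" if "x \<in> carrier G" for x
    using add[of x "inv x"] one that by simp
  have npow: "\<psi> (x [^] (n::nat)) = int n * \<psi> x" if "x \<in> carrier G" for x n
    by (induction n) (use that in \<open>auto simp: one add algebra_simps\<close>)
  show "\<psi> (x [^] (n::int)) = n * \<psi> x" if "x \<in> carrier G" for x n
  proof (cases n)
    case (neg k)
    then show ?thesis
      using that by (simp only: int_pow_neg int_pow_int inv npow nat_pow_closed)
  qed (use that in \<open>simp add: npow int_pow_int\<close>)
  show "\<psi> (finprod G g S) = (\<Sum>x\<in>S. \<psi> (g x))" if "finite S" "g \<in> S \<rightarrow> carrier G" for g S
    using that by (induction S) (auto simp: one add Pi_iff finprod_closed)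
qed

text \<open>
  The axioms of a based group relative to a subgroup; the induction below runs over subgroups of one
  ambient group.
\<close>

definition basis_of :: "'a set \<Rightarrow> nat \<Rightarrow> (nat \<Rightarrow> 'a) \<Rightarrow> (nat \<Rightarrow> 'a \<Rightarrow> int) \<Rightarrow> bool" where
  "basis_of K m e co \<longleftrightarrow> (\<forall>i<m. e i \<in> K)
     \<and> (\<forall>i<m. \<forall>x\<in>K. \<forall>y\<in>K. co i (x \<otimes> y) = co i x + co i y)
     \<and> (\<forall>i<m. \<forall>j<m. co i (e j) = (if i = j then 1 else 0))
     \<and> (\<forall>L. subgroup L G \<longrightarrow> (\<forall>i<m. e i \<in> L) \<longrightarrow> K \<subseteq> L)"

lemma basis_of_trivial:
  assumes "\<And>x. x \<in> K \<Longrightarrow> x = \<one>"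
  shows "basis_of K 0 e co"
proof -
  have "K \<subseteq> L" if "subgroup L G" for L
    using assms subgroup.one_closed[OF that] by (metis subsetI)
  then show ?thesis
    by (simp add: basis_of_def)
qed

text \<open>
  If \<open>u\<close> generates the image of \<open>\<psi>\<close>, then \<open>K\<close> is the direct sum of the kernel of \<open>\<psi>\<close> and the
  infinite cyclic group generated by \<open>u\<close>.
\<close>

lemma basis_of_extend:
  assumes K: "subgroup K G" and "d \<noteq> 0"
    and add: "\<And>x y. x \<in> carrier G \<Longrightarrow> y \<in> carrier G \<Longrightarrow> \<psi> (x \<otimes> y) = \<psi> x + (\<psi> y :: int)"
    and u: "u \<in> K" "\<psi> u = d" and dvd: "\<And>x. x \<in> K \<Longrightarrow> d dvd \<psi> x"
    and basis: "basis_of {x \<in> K. \<psi> x = 0} m e co"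
  shows "\<exists>e co. basis_of K (Suc m) e co"
proof -
  interpret K: subgroup K G by (fact K)
  note \<psi> = additive_group_facts[of \<psi>, OF add]
  define q where "q x = \<psi> x div d" for x
  \<comment> \<open>\<open>pr\<close> is the projection to the kernel along \<open>u\<close>.\<close>
  define pr where "pr x = x \<otimes> u [^] (- q x)" for x
  have q_add: "q (x \<otimes> y) = q x + q y" if "x \<in> K" "y \<in> K" for x y
    using that dvd[of y] by (simp add: q_def add div_plus_div_distrib_dvd_right)
  have upow: "u [^] (n::int) \<in> K" for n
    by (rule subgroup_int_pow_closed[OF K u(1)])
  have pr_K: "pr x \<in> K" "\<psi> (pr x) = 0" if "x \<in> K" for x
  proof -
    show "pr x \<in> K"
      unfolding pr_def by (rule K.m_closed[OF that upow])
    have "\<psi> (pr x) = \<psi> x - q x * d"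
      unfolding pr_def using that u by (simp add: add \<psi>(3))
    then show "\<psi> (pr x) = 0"
      using dvd[OF that] by (simp add: q_def)
  qed
  have pr_add: "pr (x \<otimes> y) = pr x \<otimes> pr y" if "x \<in> K" "y \<in> K" for x y
  proof -
    have "u [^] (- q (x \<otimes> y)) = u [^] (- q x) \<otimes> u [^] (- q y)"
      using that u(1) by (simp add: q_add int_pow_mult[symmetric])
    then show ?thesis
      unfolding pr_def using that u(1) by (simp add: m_ac)
  qed
  have pr_id: "pr x = x" if "x \<in> K" "\<psi> x = 0" for x
    using that u(1) by (simp add: pr_def q_def)
  have pr_u: "pr u = \<one>"
    using u \<open>d \<noteq> 0\<close> by (simp add: pr_def q_def int_pow_neg)
  have recover: "x = pr x \<otimes> u [^] q x" if "x \<in> K" for x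
    using that u(1) by (simp add: pr_def m_assoc int_pow_mult[symmetric])
  have co_one: "co i \<one> = 0" if "i < m" for i
  proof -
    have "\<one> \<in> {x \<in> K. \<psi> x = 0}"
      using \<psi>(1) by simp
    then have "co i (\<one> \<otimes> \<one>) = co i \<one> + co i \<one>"
      using basis that unfolding basis_of_def by blast
    then show ?thesis by simp
  qed
  let ?e = "\<lambda>i. if i < m then e i else u"
  let ?co = "\<lambda>i x. if i < m then co i (pr x) else q x"
  have eK: "e i \<in> K" "\<psi> (e i) = 0" if "i < m" for i
    using basis that unfolding basis_of_def by blast+
  have "basis_of K (Suc m) ?e ?co"
    unfolding basis_of_def
  proof (intro conjI allI impI ballI)
    show "?e i \<in> K" if "i < Suc m" for i
      using eK u by simp
    show "?co i (x \<otimes> y) = ?co i x + ?co i y" if "i < Suc m" "x \<in> K" "y \<in> K" for i x y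
    proof (cases "i < m")
      case True
      have "co i (pr x \<otimes> pr y) = co i (pr x) + co i (pr y)"
        using basis[unfolded basis_of_def, THEN conjunct2, THEN conjunct1] True pr_K that by simp
      then show ?thesis
        using True that by (simp add: pr_add)
    qed (use q_add that in simp)
    show "?co i (?e j) = (if i = j then 1 else 0)" if ij: "i < Suc m" "j < Suc m" for i j
    proof -
      have q_u: "q u = 1"
        using u(2) \<open>d \<noteq> 0\<close> by (simp add: q_def)
      have e: "q (e j) = 0" "pr (e j) = e j" if "j < m"
        using eK(2)[OF that] pr_id[OF eK[OF that]] by (simp_all add: q_def)
      consider "i < m" "j < m" | "i < m" "j = m" | "i = m" "j < m" | "i = m" "j = m"
        using ij by linarith
      then show ?thesis
      proof cases
        case 1
        then have "co i (e j) = (if i = j then 1 else 0)"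
          using basis unfolding basis_of_def by blast
        then show ?thesis
          using 1 e(2) by simp
      next
        case 2
        then show ?thesis
          using co_one by (simp add: pr_u)
      next
        case 3
        then show ?thesis
          using e(1) by simp
      next
        case 4
        then show ?thesis
          by (simp add: q_u)
      qed
    qed
    fix L assume L: "subgroup L G" and eL: "\<forall>i<Suc m. ?e i \<in> L"
    have "{x \<in> K. \<psi> x = 0} \<subseteq> L"
    proof -
      have "\<forall>i<m. e i \<in> L"
      proof (intro allI impI)
        fix i assume "i < m"
        then show "e i \<in> L"
          using eL[rule_format, of i] by simp
      qed
      then show ?thesis
        using basis L unfolding basis_of_def by blast
    qed
    moreover have "u \<in> L"
      using eL[rule_format, of m] by simp
    then have "u [^] (n::int) \<in> L" for n
      using subgroup_int_pow_closed[OF L] by blast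
    ultimately have "pr x \<otimes> u [^] q x \<in> L" if "x \<in> K" for x
      using pr_K[OF that] by (intro subgroup.m_closed[OF L]) auto
    then show "K \<subseteq> L"
      using recover by (metis subsetI)
  qed
  then show ?thesis by blast
qed

text \<open>
  Splitting off an infinite cyclic summand by a nonzero homomorphism lowers the rank. Torsionless
  means that homomorphisms to the integers separate elements; being torsion-free would not
  suffice, as the additive group of rationals shows.
\<close>

lemma torsionless_finite_rank_has_basis:
  assumes torsionless: "\<And>x. x \<in> carrier G \<Longrightarrow> x \<noteq> \<one> \<Longrightarrow> \<exists>\<psi>::'a \<Rightarrow> int.
      (\<forall>x\<in>carrier G. \<forall>y\<in>carrier G. \<psi> (x \<otimes> y) = \<psi> x + \<psi> y) \<and> \<psi> x \<noteq> 0"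
    and K: "subgroup K G"
    and rank: "\<And>S. int_independent G S \<Longrightarrow> S \<subseteq> K \<Longrightarrow> card S \<le> n"
  shows "\<exists>m e co. basis_of K m e co"
  using K rank
proof (induction n arbitrary: K)
  case (0 K)
  interpret K: subgroup K G by (fact 0(1))
  have "x = \<one>" if "x \<in> K" for x
  proof (rule ccontr)
    assume "x \<noteq> \<one>"
    have x: "x \<in> carrier G" using that by simp
    obtain \<psi> :: "'a \<Rightarrow> int" where add: "\<forall>x\<in>carrier G. \<forall>y\<in>carrier G. \<psi> (x \<otimes> y) = \<psi> x + \<psi> y" and "\<psi> x \<noteq> 0"
      using torsionless[OF x \<open>x \<noteq> \<one>\<close>] by blast
    have "n x = 0" if "finprod G (\<lambda>y. y [^] n y) {x} = \<one>" for n :: "'a \<Rightarrow> int"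
    proof -
      have "x [^] n x = \<one>"
        using that x by simp
      then have "n x * \<psi> x = 0"
        using additive_group_facts(1,3)[of \<psi>] add x by metis
      then show ?thesis
        using \<open>\<psi> x \<noteq> 0\<close> by simp
    qed
    then have "int_independent G {x}"
      using x by (simp add: int_independent_def)
    then show False
      using 0(2)[of "{x}"] that by simp
  qed
  then show ?case
    using basis_of_trivial by blast
next
  case (Suc n K)
  interpret K: subgroup K G by (fact Suc(2))
  show ?case
  proof (cases "\<exists>x\<in>K. x \<noteq> \<one>")
    case False
    then show ?thesis
      using basis_of_trivial by blast
  next
    case True
    then obtain x where x: "x \<in> K" "x \<noteq> \<one>" by blast
    then obtain \<psi> :: "'a \<Rightarrow> int" where
      add: "\<And>x y. x \<in> carrier G \<Longrightarrow> y \<in> carrier G \<Longrightarrow> \<psi> (x \<otimes> y) = \<psi> x + \<psi> y" and "\<psi> x \<noteq> 0"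
      using torsionless[of x] by auto
    note \<psi> = additive_group_facts[of \<psi>, OF add]
    \<comment> \<open>The image of \<open>\<psi>\<close> is generated by its least positive element.\<close>
    define P where "P k \<longleftrightarrow> k > 0 \<and> (\<exists>y\<in>K. \<psi> y = int k)" for k
    have "P (nat \<bar>\<psi> x\<bar>)"
    proof (cases "\<psi> x > 0")
      case True
      then show ?thesis
        using x(1) by (auto simp: P_def)
    next
      case False
      then have "\<psi> (inv x) = int (nat \<bar>\<psi> x\<bar>)"
        using x(1) \<psi>(2) by simp
      then show ?thesis
        using x(1) \<open>\<psi> x \<noteq> 0\<close> by (auto simp: P_def)
    qed
    then obtain N where least: "P N" "\<And>k. P k \<Longrightarrow> N \<le> k"
      using LeastI Least_le by metis
    define d where "d = int N"
    obtain u where u: "u \<in> K" "\<psi> u = d" and "d > 0"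
      using least(1) by (auto simp: P_def d_def)
    have upow: "u [^] (n::int) \<in> K" for n
      using subgroup_int_pow_closed[OF Suc(2) u(1)] .
    have dvd: "d dvd \<psi> y" if y: "y \<in> K" for y
    proof -
      let ?r = "y \<otimes> u [^] (- (\<psi> y div d))"
      have "\<psi> ?r = \<psi> y mod d"
        using y u by (simp add: add \<psi>(3) minus_div_mult_eq_mod)
      moreover have "?r \<in> K"
        using y upow by (rule K.m_closed)
      ultimately have r': "\<psi> ?r = \<psi> y mod d" "?r \<in> K"
        by blast+
      have "\<psi> y mod d = 0"
      proof (rule ccontr)
        assume "\<psi> y mod d \<noteq> 0"
        with r' have r: "\<psi> ?r = \<psi> y mod d" "?r \<in> K" "\<psi> y mod d \<noteq> 0"
          by blast+
        have "0 < \<psi> y mod d" "\<psi> y mod d < d"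
          using r(3) pos_mod_sign[OF \<open>d > 0\<close>, of "\<psi> y"] pos_mod_bound[OF \<open>d > 0\<close>, of "\<psi> y"]
          by linarith+
        moreover from this have "P (nat (\<psi> y mod d))"
          using r(1,2) by (auto simp: P_def intro!: bexI[of _ ?r])
        ultimately show False
          using least(2)[of "nat (\<psi> y mod d)"] by (simp add: d_def)
      qed
      then show ?thesis by auto
    qed
    let ?K = "{y \<in> K. \<psi> y = 0}"
    have subK: "subgroup ?K G"
      by (rule subgroupI) (auto simp: add \<psi> intro!: exI[of _ \<one>])
    have "card S \<le> n" if S: "int_independent G S" "S \<subseteq> ?K" for S
    proof -
      have fin: "finite S" "S \<subseteq> carrier G"
        using S(1) by (auto simp: int_independent_def)
      have "u \<notin> S"
        using S(2) u(2) \<open>d > 0\<close> by auto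
      have "\<forall>y\<in>insert u S. k y = 0" if k: "finprod G (\<lambda>y. y [^] k y) (insert u S) = \<one>" for k :: "'a \<Rightarrow> int"
      proof -
        have eq: "finprod G (\<lambda>y. y [^] k y) (insert u S) = u [^] k u \<otimes> finprod G (\<lambda>y. y [^] k y) S"
          using fin \<open>u \<notin> S\<close> u(1) by (intro finprod_insert) auto
        have "0 = (\<Sum>y\<in>insert u S. \<psi> (y [^] k y))"
          using k \<psi>(1) fin u(1) by (subst \<psi>(4)[symmetric]) auto
        also have "\<dots> = k u * d + (\<Sum>y\<in>S. k y * \<psi> y)"
          using fin \<open>u \<notin> S\<close> u by (simp add: \<psi>(3) subset_iff)
        also have "(\<Sum>y\<in>S. k y * \<psi> y) = 0"
          using S(2) by (intro sum.neutral) auto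
        finally have "k u = 0"
          using \<open>d > 0\<close> by simp
        moreover from this have "finprod G (\<lambda>y. y [^] k y) S = \<one>"
          using k fin unfolding eq by (simp add: finprod_closed Pi_iff subset_iff)
        ultimately show ?thesis
          using S(1) unfolding int_independent_def by blast
      qed
      then have "int_independent G (insert u S)"
        using fin u(1) by (auto simp: int_independent_def)
      then have "card (insert u S) \<le> Suc n"
        using S(2) u(1) by (intro Suc(3)) auto
      then show ?thesis
        using fin \<open>u \<notin> S\<close> by simp
    qed
    then obtain m e co where "basis_of ?K m e co"
      using Suc.IH[OF subK] by blast
    then show ?thesis
      using basis_of_extend[OF Suc(2) _ add u dvd] \<open>d > 0\<close> by blast
  qed
qed

lemma torsionless_finite_rank_based:
  assumes torsionless: "\<And>x. x \<in> carrier G \<Longrightarrow> x \<noteq> \<one> \<Longrightarrow> \<exists>\<psi>::'a \<Rightarrow> int.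
      (\<forall>x\<in>carrier G. \<forall>y\<in>carrier G. \<psi> (x \<otimes> y) = \<psi> x + \<psi> y) \<and> \<psi> x \<noteq> 0"
    and rank: "group_rank G = enat n"
  obtains e co where "based_group G n e co"
proof -
  have "card S \<le> n" if "int_independent G S" for S
  proof -
    have "enat (card S) \<le> group_rank G"
      unfolding group_rank_def using that by (intro SUP_upper) simp
    then show ?thesis
      by (simp add: rank)
  qed
  then obtain m e co where "basis_of (carrier G) m e co"
    using torsionless_finite_rank_has_basis[OF torsionless subgroup_self] by blast
  then interpret based_group G m e co
    by unfold_locales (simp_all add: basis_of_def)
  have "m = n"
    using group_rank_based rank by simp
  then show thesis
    using that based_group_axioms by blast
qed

end

section \<open>Singular cochains and first cohomology\<close>

abbreviation cochains :: "nat \<Rightarrow> 'a topology \<Rightarrow> ('a chain \<Rightarrow> int) set" where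
  "cochains p X \<equiv> carrier (cochain_group p X)"

lemma cochain_add:
  assumes "\<phi> \<in> cochains p X" "singular_chain p X c" "singular_chain p X d"
  shows "\<phi> (c + d) = \<phi> c + \<phi> d"
  using dual_group_add[of \<phi> "chain_group p X" c d] assms by (simp add: cochain_group_def)

lemma cochain_0:
  assumes "\<phi> \<in> cochains p X"
  shows "\<phi> 0 = 0"
  using cochain_add[OF assms, of 0 0] by simp

lemma cochain_minus:
  assumes "\<phi> \<in> cochains p X" "singular_chain p X c"
  shows "\<phi> (- c) = - \<phi> c"
  using cochain_add[OF assms, of "- c"] cochain_0[OF assms(1)] assms(2) by (simp add: singular_chain_minus)

lemma cochain_diff:
  assumes "\<phi> \<in> cochains p X" "singular_chain p X c" "singular_chain p X d"
  shows "\<phi> (c - d) = \<phi> c - \<phi> d"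
  using cochain_add[OF assms(1,2), of "- d"] cochain_minus[OF assms(1,3)] assms(3)
  by (simp add: singular_chain_minus)

lemma cochainI:
  assumes "\<And>c d. singular_chain p X c \<Longrightarrow> singular_chain p X d \<Longrightarrow> \<phi> (c + d) = \<phi> c + \<phi> d"
    and "\<phi> \<in> extensional (singular_chain_set p X)"
  shows "\<phi> \<in> cochains p X"
  unfolding cochain_group_def using assms by (intro dual_groupI) auto

lemma cochain_extensional: "\<phi> \<in> cochains p X \<Longrightarrow> \<phi> \<in> extensional (singular_chain_set p X)"
  by (simp add: cochain_group_def carrier_dual_group)

lemma cochain_eval:
  assumes \<phi>: "\<phi> \<in> cochains p X" and c: "singular_chain p X c"
  shows "\<phi> c = frag_linear (\<lambda>\<sigma>. \<phi> (frag_of \<sigma>)) c"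
proof -
  have "Poly_Mapping.keys c \<subseteq> singular_simplex_set p X"
    using c by (simp add: singular_chain_def)
  then have "singular_chain p X c \<and> \<phi> c = frag_linear (\<lambda>\<sigma>. \<phi> (frag_of \<sigma>)) c"
  proof (induction rule: frag_induction)
    case (diff a b)
    then show ?case
      using cochain_diff[OF \<phi>] by (simp add: singular_chain_diff)
  qed (auto simp: cochain_0[OF \<phi>] singular_chain_of)
  then show ?thesis by blast
qed

lemma linear_cochain: "restrict (frag_linear f) (singular_chain_set p X) \<in> cochains p X"
  by (rule cochainI) (auto simp: singular_chain_add)

lemma cochain_eqI:
  assumes "\<phi> \<in> cochains p X" "\<psi> \<in> cochains p X"
    and "\<And>\<sigma>. singular_simplex p X \<sigma> \<Longrightarrow> \<phi> (frag_of \<sigma>) = \<psi> (frag_of \<sigma>)"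
  shows "\<phi> = \<psi>"
proof (rule extensionalityI[OF cochain_extensional[OF assms(1)] cochain_extensional[OF assms(2)]])
  fix c assume "c \<in> singular_chain_set p X"
  then have c: "singular_chain p X c" by simp
  show "\<phi> c = \<psi> c"
    unfolding cochain_eval[OF assms(1) c] cochain_eval[OF assms(2) c]
    using c by (intro frag_linear_cong assms(3)) (auto simp: singular_chain_def)
qed

lemma comm_group_cochain_group: "comm_group (cochain_group p X)"
  unfolding cochain_group_def by (intro comm_group_dual_group group_chain_group)

lemma mult_cochain_group: "\<phi> \<otimes>\<^bsub>cochain_group p X\<^esub> \<psi> = (\<lambda>c\<in>singular_chain_set p X. \<phi> c + \<psi> c)"
  and one_cochain_group: "\<one>\<^bsub>cochain_group p X\<^esub> = (\<lambda>c\<in>singular_chain_set p X. 0)"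
  by (simp_all add: cochain_group_def mult_dual_group one_dual_group)

lemma coboundary_apply:
  "singular_chain (Suc p) X c \<Longrightarrow> coboundary p X \<phi> c = \<phi> (chain_boundary (Suc p) c)"
  by (simp add: coboundary_def)

lemma coboundary_cochain:
  assumes "\<phi> \<in> cochains p X"
  shows "coboundary p X \<phi> \<in> cochains (Suc p) X"
proof (rule cochainI)
  fix c d assume "singular_chain (Suc p) X c" "singular_chain (Suc p) X d"
  then show "coboundary p X \<phi> (c + d) = coboundary p X \<phi> c + coboundary p X \<phi> d"
    using singular_chain_boundary_alt[of p X]
    by (simp add: coboundary_apply singular_chain_add chain_boundary_add cochain_add[OF assms])
qed (simp add: coboundary_def)

lemma coboundary_hom: "coboundary p X \<in> hom (cochain_group p X) (cochain_group (Suc p) X)"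
proof (rule homI)
  show "coboundary p X (\<phi> \<otimes>\<^bsub>cochain_group p X\<^esub> \<psi>)
      = coboundary p X \<phi> \<otimes>\<^bsub>cochain_group (Suc p) X\<^esub> coboundary p X \<psi>" for \<phi> \<psi>
    by (auto simp: coboundary_def mult_cochain_group singular_chain_boundary_alt)
qed (rule coboundary_cochain)

lemma cocycle_iff:
  "\<phi> \<in> cocycle_set p X \<longleftrightarrow> \<phi> \<in> cochains p X \<and>
     (\<forall>c. singular_chain (Suc p) X c \<longrightarrow> \<phi> (chain_boundary (Suc p) c) = 0)"
  by (auto simp: cocycle_set_def kernel_def one_cochain_group coboundary_def fun_eq_iff restrict_def)

lemma coboundary_set_Suc: "coboundary_set (Suc p) X = coboundary p X ` cochains p X"
  by (simp add: coboundary_set_def)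

lemma subgroup_coboundary_set: "subgroup (coboundary_set (Suc p) X) (cochain_group (Suc p) X)"
proof -
  interpret h: group_hom "cochain_group p X" "cochain_group (Suc p) X" "coboundary p X"
    using comm_group_cochain_group coboundary_hom
    by (intro group_hom.intro group_hom_axioms.intro) (auto simp: comm_group_def)
  show ?thesis
    unfolding coboundary_set_Suc by (rule h.img_is_subgroup)
qed

lemma subgroup_cocycle_set: "subgroup (cocycle_set p X) (cochain_group p X)"
proof -
  interpret h: group_hom "cochain_group p X" "cochain_group (Suc p) X" "coboundary p X"
    using comm_group_cochain_group coboundary_hom
    by (intro group_hom.intro group_hom_axioms.intro) (auto simp: comm_group_def)
  show ?thesis
    unfolding cocycle_set_def by (rule h.subgroup_kernel)
qed

lemma coboundary_set_subset: "coboundary_set (Suc p) X \<subseteq> cocycle_set (Suc p) X"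
proof
  fix \<phi> assume "\<phi> \<in> coboundary_set (Suc p) X"
  then obtain f where f: "f \<in> cochains p X" "\<phi> = coboundary p X f"
    by (auto simp: coboundary_set_Suc)
  show "\<phi> \<in> cocycle_set (Suc p) X"
    unfolding cocycle_iff f(2)
  proof (intro conjI allI impI coboundary_cochain f(1))
    fix c assume c: "singular_chain (Suc (Suc p)) X c"
    then have "chain_boundary (Suc p) (chain_boundary (Suc (Suc p)) c) = 0"
      by (rule chain_boundary_boundary_alt)
    then show "coboundary p X f (chain_boundary (Suc (Suc p)) c) = 0"
      using singular_chain_boundary_alt[OF c] by (simp add: coboundary_apply cochain_0[OF f(1)])
  qed
qed

definition cohomology_class :: "nat \<Rightarrow> 'a topology \<Rightarrow> ('a chain \<Rightarrow> int) \<Rightarrow> ('a chain \<Rightarrow> int) set" where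
  "cohomology_class p X \<phi> = coboundary_set p X #>\<^bsub>cochain_group p X\<^esub> \<phi>"

lemma mem_cohomology_class:
  "\<psi> \<in> cohomology_class (Suc p) X \<phi> \<longleftrightarrow>
     (\<exists>f\<in>cochains p X. \<psi> = coboundary p X f \<otimes>\<^bsub>cochain_group (Suc p) X\<^esub> \<phi>)"
  by (auto simp: cohomology_class_def r_coset_def coboundary_set_Suc)

lemma carrier_cohomology_group:
  "carrier (cohomology_group p X) = cohomology_class p X ` cocycle_set p X"
proof -
  have "carrier (subgroup_generated (cochain_group p X) (cocycle_set p X)) = cocycle_set p X"
    by (rule subgroup.carrier_subgroup_generated_subgroup[OF subgroup_cocycle_set])
  then show ?thesis
    by (auto simp: cohomology_group_def FactGroup_def RCOSETS_def cohomology_class_def r_coset_def)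
qed

lemma cohomology_subgroup:
  "subgroup (coboundary_set (Suc p) X)
     (subgroup_generated (cochain_group (Suc p) X) (cocycle_set (Suc p) X))"
proof -
  interpret C: comm_group "cochain_group (Suc p) X"
    by (rule comm_group_cochain_group)
  show ?thesis
    by (intro C.subgroup_of_subgroup_generated subgroup_coboundary_set coboundary_set_subset)
qed

lemma comm_group_cocycles: "comm_group (subgroup_generated (cochain_group p X) (cocycle_set p X))"
proof -
  interpret C: comm_group "cochain_group p X"
    by (rule comm_group_cochain_group)
  show ?thesis
    by (rule C.abelian_subgroup_generated[OF comm_group_cochain_group])
qed

lemma comm_group_cohomology_group: "comm_group (cohomology_group (Suc p) X)"
  unfolding cohomology_group_def
  by (intro comm_group.abelian_FactGroup comm_group_cocycles cohomology_subgroup)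

lemma mult_cohomology_class:
  assumes "\<phi> \<in> cocycle_set (Suc p) X" "\<psi> \<in> cocycle_set (Suc p) X"
  shows "cohomology_class (Suc p) X \<phi> \<otimes>\<^bsub>cohomology_group (Suc p) X\<^esub> cohomology_class (Suc p) X \<psi>
    = cohomology_class (Suc p) X (\<phi> \<otimes>\<^bsub>cochain_group (Suc p) X\<^esub> \<psi>)"
proof -
  let ?Z = "subgroup_generated (cochain_group (Suc p) X) (cocycle_set (Suc p) X)"
  have "coboundary_set (Suc p) X \<lhd> ?Z"
    by (rule comm_group.normal_iff_subgroup[THEN iffD2, OF comm_group_cocycles cohomology_subgroup])
  moreover have "carrier ?Z = cocycle_set (Suc p) X"
    by (rule subgroup.carrier_subgroup_generated_subgroup[OF subgroup_cocycle_set])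
  ultimately show ?thesis
    using normal.rcos_sum[of "coboundary_set (Suc p) X" ?Z \<phi> \<psi>] assms
    by (simp add: cohomology_group_def cohomology_class_def r_coset_def)
qed

lemma one_cohomology_group: "\<one>\<^bsub>cohomology_group p X\<^esub> = coboundary_set p X"
  by (simp add: cohomology_group_def)

lemma cohomology_class_eqI:
  assumes \<phi>: "\<phi> \<in> cochains (Suc p) X" and f: "f \<in> cochains p X"
    and \<psi>: "\<psi> = coboundary p X f \<otimes>\<^bsub>cochain_group (Suc p) X\<^esub> \<phi>"
  shows "cohomology_class (Suc p) X \<psi> = cohomology_class (Suc p) X \<phi>"
proof -
  interpret C: comm_group "cochain_group (Suc p) X"
    by (rule comm_group_cochain_group)
  have "\<psi> \<in> coboundary_set (Suc p) X #>\<^bsub>cochain_group (Suc p) X\<^esub> \<phi>"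
    using mem_cohomology_class[of \<psi> p X \<phi>] f \<psi> unfolding cohomology_class_def by blast
  then show ?thesis
    using C.repr_independence[OF _ \<phi> subgroup_coboundary_set] unfolding cohomology_class_def by simp
qed

lemma cohomology_class_self:
  assumes "\<phi> \<in> cochains (Suc p) X"
  shows "\<phi> \<in> cohomology_class (Suc p) X \<phi>"
proof -
  interpret C: comm_group "cochain_group (Suc p) X"
    by (rule comm_group_cochain_group)
  show ?thesis
    unfolding cohomology_class_def by (rule C.rcos_self[OF assms subgroup_coboundary_set])
qed

text \<open>
  A cocycle that vanishes on cycles is the coboundary of the function assigning to a point its value
  on a chain from the base point of its homology class to the point. The chain exists by the choice
  of the base point, and its choice is immaterial because two such chains differ by a cycle.
\<close>

lemma cocycle_vanishing_on_cycles:
  assumes \<phi>: "\<phi> \<in> cocycle_set 1 X"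
    and cyc: "\<And>z. singular_chain 1 X z \<Longrightarrow> chain_boundary 1 z = 0 \<Longrightarrow> \<phi> z = 0"
  shows "\<phi> \<in> coboundary_set 1 X"
proof -
  have \<phi>C: "\<phi> \<in> cochains 1 X"
    using \<phi> by (simp add: cocycle_iff)
  define R where "R \<sigma> = {\<tau>. singular_simplex 0 X \<tau> \<and> homologous_rel 0 X {} (frag_of \<sigma>) (frag_of \<tau>)}" for \<sigma>
  \<comment> \<open>Choosing from the whole class makes the base point depend on the homology class only.\<close>
  define r where "r \<sigma> = (SOME \<tau>. \<tau> \<in> R \<sigma>)" for \<sigma>
  define bounds where "bounds \<sigma> d \<longleftrightarrow> singular_chain 1 X d \<and> chain_boundary 1 d = frag_of \<sigma> - frag_of (r \<sigma>)" for \<sigma> d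
  define c where "c \<sigma> = (SOME d. bounds \<sigma> d)" for \<sigma>
  have c: "singular_chain 1 X (c \<sigma>)" "chain_boundary 1 (c \<sigma>) = frag_of \<sigma> - frag_of (r \<sigma>)"
    if "singular_simplex 0 X \<sigma>" for \<sigma>
  proof -
    have "\<sigma> \<in> R \<sigma>"
      using that by (simp add: R_def)
    then have "r \<sigma> \<in> R \<sigma>"
      unfolding r_def by (rule someI[where P = "\<lambda>\<tau>. \<tau> \<in> R \<sigma>"])
    then have "\<exists>d. bounds \<sigma> d"
      by (simp add: R_def homologous_rel_def singular_boundary bounds_def)
    then have "bounds \<sigma> (c \<sigma>)"
      unfolding c_def by (rule someI_ex)
    then show "singular_chain 1 X (c \<sigma>)" "chain_boundary 1 (c \<sigma>) = frag_of \<sigma> - frag_of (r \<sigma>)"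
      by (simp_all add: bounds_def)
  qed
  define f where "f = restrict (frag_linear (\<lambda>\<sigma>. \<phi> (c \<sigma>))) (singular_chain_set 0 X)"
  have fC: "f \<in> cochains 0 X"
    unfolding f_def by (rule linear_cochain)
  have "\<phi> = coboundary 0 X f"
  proof (rule cochain_eqI)
    show "\<phi> \<in> cochains 1 X" "coboundary 0 X f \<in> cochains 1 X"
      using \<phi>C coboundary_cochain[OF fC] by simp_all
    fix \<tau> assume \<tau>: "singular_simplex 1 X \<tau>"
    let ?u = "singular_face 1 0 \<tau>" and ?v = "singular_face 1 1 \<tau>"
    have uv: "singular_simplex 0 X ?u" "singular_simplex 0 X ?v"
      using singular_simplex_singular_face[OF \<tau>, of 0] singular_simplex_singular_face[OF \<tau>, of 1] by simp_all
    have bd: "chain_boundary 1 (frag_of \<tau>) = frag_of ?u - frag_of ?v"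
      by (simp add: chain_boundary_of)
    have \<tau>c: "singular_chain 1 X (frag_of \<tau>)"
      using \<tau> by (simp add: singular_chain_of)
    have "homologous_rel 0 X {} (frag_of ?u) (frag_of ?v)"
      unfolding homologous_rel_def singular_boundary using \<tau>c bd by (auto intro!: exI[of _ "frag_of \<tau>"])
    then have "R ?u = R ?v"
      unfolding R_def using homologous_rel_sym homologous_rel_trans by blast
    then have "r ?u = r ?v"
      by (simp add: r_def)
    then have "chain_boundary 1 (frag_of \<tau> - (c ?u - c ?v)) = 0"
      unfolding chain_boundary_diff bd c(2)[OF uv(1)] c(2)[OF uv(2)] by simp
    moreover have cc: "singular_chain 1 X (c ?u - c ?v)"
      using c uv by (intro singular_chain_diff) auto
    ultimately have "\<phi> (frag_of \<tau> - (c ?u - c ?v)) = 0"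
      using cyc[OF singular_chain_diff[OF \<tau>c cc]] by blast
    then have "\<phi> (frag_of \<tau>) = \<phi> (c ?u) - \<phi> (c ?v)"
      using cochain_diff[OF \<phi>C \<tau>c cc] cochain_diff[OF \<phi>C c(1)[OF uv(1)] c(1)[OF uv(2)]] by simp
    moreover have "coboundary 0 X f (frag_of \<tau>) = f (frag_of ?u - frag_of ?v)"
      using \<tau>c bd by (simp add: coboundary_apply)
    moreover have "singular_chain 0 X (frag_of ?u - frag_of ?v)"
      using uv by (intro singular_chain_diff) (simp_all add: singular_chain_of)
    ultimately show "\<phi> (frag_of \<tau>) = coboundary 0 X f (frag_of \<tau>)"
      by (simp add: f_def)
  qed
  then show ?thesis
    using fC coboundary_set_Suc[of 0 X] by auto
qed

text \<open>
  Evaluation at a cycle on which the cocycle does not vanish is the separating homomorphism.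
\<close>

lemma first_cohomology_torsionless:
  assumes A: "A \<in> carrier (cohomology_group 1 X)" "A \<noteq> \<one>\<^bsub>cohomology_group 1 X\<^esub>"
  shows "\<exists>\<psi>::_ \<Rightarrow> int. (\<forall>x\<in>carrier (cohomology_group 1 X). \<forall>y\<in>carrier (cohomology_group 1 X).
      \<psi> (x \<otimes>\<^bsub>cohomology_group 1 X\<^esub> y) = \<psi> x + \<psi> y) \<and> \<psi> A \<noteq> 0"
proof -
  obtain \<phi> where \<phi>: "\<phi> \<in> cocycle_set 1 X" "A = cohomology_class 1 X \<phi>"
    using A(1) by (auto simp: carrier_cohomology_group)
  have "\<phi> \<notin> coboundary_set 1 X"
  proof
    assume "\<phi> \<in> coboundary_set 1 X"
    then have "A = coboundary_set 1 X"
      unfolding \<phi>(2) cohomology_class_def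
      using subgroup.rcos_const[OF subgroup_coboundary_set[of 0 X]] comm_group_cochain_group[of 1 X]
      by (simp add: comm_group_def)
    then show False
      using A(2) by (simp add: one_cohomology_group)
  qed
  then obtain z where z: "singular_chain 1 X z" "chain_boundary 1 z = 0" "\<phi> z \<noteq> 0"
    using cocycle_vanishing_on_cycles[OF \<phi>(1)] by blast
  define \<psi> where "\<psi> B = (SOME \<eta>. \<eta> \<in> B) z" for B :: "('a chain \<Rightarrow> int) set"
  have \<psi>: "\<psi> (cohomology_class 1 X \<eta>) = \<eta> z" if "\<eta> \<in> cocycle_set 1 X" for \<eta>
  proof -
    let ?\<eta> = "SOME \<eta>'. \<eta>' \<in> cohomology_class 1 X \<eta>"
    have "\<eta> \<in> cohomology_class 1 X \<eta>"
      using cohomology_class_self[of \<eta> 0 X] that by (simp add: cocycle_iff)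
    then have "?\<eta> \<in> cohomology_class 1 X \<eta>"
      by (rule someI[where P = "\<lambda>\<eta>'. \<eta>' \<in> cohomology_class 1 X \<eta>"])
    then obtain f where f: "f \<in> cochains 0 X" "?\<eta> = coboundary 0 X f \<otimes>\<^bsub>cochain_group 1 X\<^esub> \<eta>"
      using mem_cohomology_class[of ?\<eta> 0 X \<eta>] by auto
    then have "?\<eta> z = f (chain_boundary 1 z) + \<eta> z"
      using z(1) by (simp add: mult_cochain_group coboundary_apply)
    then show ?thesis
      by (simp only: \<psi>_def z(2) cochain_0[OF f(1)] add_0)
  qed
  have "\<psi> (x \<otimes>\<^bsub>cohomology_group 1 X\<^esub> y) = \<psi> x + \<psi> y"
    if xy: "x \<in> carrier (cohomology_group 1 X)" "y \<in> carrier (cohomology_group 1 X)" for x y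
  proof -
    obtain \<alpha> \<beta> where ab: "\<alpha> \<in> cocycle_set 1 X" "x = cohomology_class 1 X \<alpha>"
        "\<beta> \<in> cocycle_set 1 X" "y = cohomology_class 1 X \<beta>"
      using xy by (auto simp: carrier_cohomology_group)
    have "x \<otimes>\<^bsub>cohomology_group 1 X\<^esub> y = cohomology_class 1 X (\<alpha> \<otimes>\<^bsub>cochain_group 1 X\<^esub> \<beta>)"
      using mult_cohomology_class[of \<alpha> 0 X \<beta>] ab by simp
    moreover have "\<alpha> \<otimes>\<^bsub>cochain_group 1 X\<^esub> \<beta> \<in> cocycle_set 1 X"
      using subgroup.m_closed[OF subgroup_cocycle_set] ab by blast
    ultimately have "\<psi> (x \<otimes>\<^bsub>cohomology_group 1 X\<^esub> y) = (\<alpha> \<otimes>\<^bsub>cochain_group 1 X\<^esub> \<beta>) z"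
      using \<psi> by metis
    also have "\<dots> = \<alpha> z + \<beta> z"
      using z(1) by (simp add: mult_cochain_group)
    also have "\<dots> = \<psi> x + \<psi> y"
      unfolding ab(2,4) \<psi>[OF ab(1)] \<psi>[OF ab(3)] ..
    finally show ?thesis .
  qed
  moreover have "\<psi> A \<noteq> 0"
    unfolding \<phi>(2) \<psi>[OF \<phi>(1)] by (rule z(3))
  ultimately show ?thesis by blast
qed

section \<open>The Leibniz rule and cup products of classes\<close>

text \<open>
  The affine inclusion of a simplex as the face whose vertices start at \<open>p\<close>.
\<close>

definition shift_vertices :: "nat \<Rightarrow> (nat \<Rightarrow> real) \<Rightarrow> (nat \<Rightarrow> real)" where
  "shift_vertices p x = (\<lambda>i. if i < p then 0 else x (i - p))"

lemma back_face_shift: "back_face p q \<sigma> = restrict (\<lambda>x. \<sigma> (shift_vertices p x)) (standard_simplex q)"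
  by (simp add: back_face_def shift_vertices_def)

lemma shift_vertices_simplex:
  assumes "x \<in> standard_simplex q"
  shows "shift_vertices p x \<in> standard_simplex (p + q)"
proof -
  have "(\<Sum>i\<le>p + q. shift_vertices p x i) = (\<Sum>i\<in>{p..p + q}. x (i - p))"
    unfolding shift_vertices_def by (rule sum.mono_neutral_cong_right) auto
  also have "\<dots> = (\<Sum>i\<le>q. x i)"
    by (rule sum.reindex_bij_witness[of _ "\<lambda>i. i + p" "\<lambda>i. i - p"]) auto
  finally show ?thesis
    using assms by (auto simp: standard_simplex_def shift_vertices_def)
qed

lemma simplical_face_ge:
  assumes "x \<in> standard_simplex p" "p < i"
  shows "simplical_face i x = x"
  using assms by (auto simp: standard_simplex_def simplical_face_def fun_eq_iff)

lemma simplical_face_shift_le: "i \<le> p \<Longrightarrow> simplical_face i (shift_vertices p x) = shift_vertices (Suc p) x"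
  by (auto simp: simplical_face_def shift_vertices_def fun_eq_iff)

lemma simplical_face_shift_add:
  "simplical_face (p + j) (shift_vertices p x) = shift_vertices p (simplical_face j x)"
  by (auto simp: simplical_face_def shift_vertices_def fun_eq_iff intro!: arg_cong[of _ _ x])

lemma singular_simplex_front_face:
  assumes "singular_simplex (p + q) X \<sigma>"
  shows "singular_simplex p X (front_face p \<sigma>)"
proof -
  have "continuous_map (subtopology (powertop_real UNIV) (standard_simplex p)) X \<sigma>"
  proof (rule continuous_map_from_subtopology_mono[OF _ standard_simplex_mono])
    show "continuous_map (subtopology (powertop_real UNIV) (standard_simplex (p + q))) X \<sigma>"
      using assms by (simp add: singular_simplex_def)
  qed simp
  then show ?thesis
    by (simp add: singular_simplex_def front_face_def)
qed

lemma singular_simplex_back_face: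
  assumes "singular_simplex (p + q) X \<sigma>"
  shows "singular_simplex q X (back_face p q \<sigma>)"
proof -
  let ?PT = "powertop_real (UNIV :: nat set)"
  have "continuous_map (subtopology ?PT (standard_simplex q)) (subtopology ?PT (standard_simplex (p + q)))
      (shift_vertices p)"
  proof (clarsimp simp add: continuous_map_in_subtopology continuous_map_componentwise shift_vertices_simplex)
    fix i
    have "continuous_map ?PT euclideanreal (\<lambda>x. if i < p then 0 else x (i - p))"
      by (auto intro: continuous_map_product_projection)
    then show "continuous_map (subtopology ?PT (standard_simplex q)) euclideanreal (\<lambda>x. shift_vertices p x i)"
      by (simp add: shift_vertices_def continuous_map_from_subtopology)
  qed
  moreover have "continuous_map (subtopology ?PT (standard_simplex (p + q))) X \<sigma>"
    using assms by (simp add: singular_simplex_def)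
  ultimately have "continuous_map (subtopology ?PT (standard_simplex q)) X (\<sigma> \<circ> shift_vertices p)"
    by (rule continuous_map_compose)
  then show ?thesis
    by (simp add: singular_simplex_def back_face_shift o_def)
qed

lemma front_face_of_face_le:
  assumes "i \<le> Suc p"
  shows "singular_face (Suc p) i (front_face (Suc p) \<sigma>) = front_face p (singular_face (Suc (p + q)) i \<sigma>)"
  unfolding singular_face_def front_face_def diff_Suc_Suc diff_zero
proof (rule restrict_ext)
  fix x assume "x \<in> standard_simplex p"
  then show "(restrict \<sigma> (standard_simplex (Suc p)) \<circ> simplical_face i) x
      = restrict (\<sigma> \<circ> simplical_face i) (standard_simplex (p + q)) x"
    using simplical_face_in_standard_simplex[of "Suc p" i x] assms standard_simplex_mono[of p "p + q"] by auto
qed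


lemma front_face_of_face_gt:
  assumes "p < i"
  shows "front_face p (singular_face (Suc (p + q)) i \<sigma>) = front_face p \<sigma>"
  unfolding singular_face_def front_face_def
proof (rule restrict_ext)
  fix x assume "x \<in> standard_simplex p"
  then show "restrict (\<sigma> \<circ> simplical_face i) (standard_simplex (Suc (p + q) - Suc 0)) x = \<sigma> x"
    using standard_simplex_mono[of p "p + q"] simplical_face_ge[OF _ assms] by auto
qed

lemma back_face_of_face_le:
  assumes "i \<le> p"
  shows "back_face p q (singular_face (Suc (p + q)) i \<sigma>) = back_face (Suc p) q \<sigma>"
  unfolding singular_face_def back_face_shift
proof (rule restrict_ext)
  fix x assume "x \<in> standard_simplex q"
  then show "restrict (\<sigma> \<circ> simplical_face i) (standard_simplex (Suc (p + q) - Suc 0)) (shift_vertices p x)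
      = \<sigma> (shift_vertices (Suc p) x)"
    using shift_vertices_simplex[of x q p] simplical_face_shift_le[OF assms] by simp
qed

lemma back_face_of_face_add:
  assumes "j \<le> Suc q"
  shows "back_face p q (singular_face (Suc (p + q)) (p + j) \<sigma>) = singular_face (Suc q) j (back_face p (Suc q) \<sigma>)"
  unfolding singular_face_def back_face_shift diff_Suc_Suc diff_zero
proof (rule restrict_ext)
  fix x assume x: "x \<in> standard_simplex q"
  have "simplical_face j x \<in> standard_simplex (Suc q)"
    using simplical_face_in_standard_simplex[of "Suc q" j x] assms x by simp
  then show "restrict (\<sigma> \<circ> simplical_face (p + j)) (standard_simplex (p + q)) (shift_vertices p x)
      = (restrict (\<lambda>x. \<sigma> (shift_vertices p x)) (standard_simplex (Suc q)) \<circ> simplical_face j) x"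
    using shift_vertices_simplex[OF x, of p] simplical_face_shift_add[of p j x] by simp
qed

lemma front_face_front_face: "front_face p (front_face (p + q) \<sigma>) = front_face p \<sigma>"
  unfolding front_face_def
  using standard_simplex_mono[of p "p + q"] by (intro restrict_ext) auto

lemma back_face_front_face:
  "back_face p q (front_face (p + q) \<sigma>) = front_face q (back_face p (q + r) \<sigma>)"
  unfolding front_face_def back_face_shift
proof (rule restrict_ext)
  fix x assume x: "x \<in> standard_simplex q"
  then have "x \<in> standard_simplex (q + r)"
    using standard_simplex_mono[of q "q + r"] by auto
  then show "restrict \<sigma> (standard_simplex (p + q)) (shift_vertices p x) =
      restrict (\<lambda>x. \<sigma> (shift_vertices p x)) (standard_simplex (q + r)) x"
    using shift_vertices_simplex[OF x, of p] by simp
qed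

lemma back_face_back_face: "back_face q r (back_face p (q + r) \<sigma>) = back_face (p + q) r \<sigma>"
  unfolding back_face_shift
proof (rule restrict_ext)
  fix x assume x: "x \<in> standard_simplex r"
  have "shift_vertices p (shift_vertices q x) = shift_vertices (p + q) x"
    by (auto simp: shift_vertices_def fun_eq_iff)
  then show "restrict (\<lambda>x. \<sigma> (shift_vertices p x)) (standard_simplex (q + r)) (shift_vertices q x)
      = \<sigma> (shift_vertices (p + q) x)"
    using shift_vertices_simplex[OF x, of q] by simp
qed

lemma singular_face_0: "singular_face (Suc q) 0 \<sigma> = back_face 1 q \<sigma>"
proof -
  have "simplical_face 0 x = shift_vertices 1 x" for x
    by (auto simp: simplical_face_def shift_vertices_def fun_eq_iff)
  then show ?thesis
    by (simp add: singular_face_def back_face_shift o_def)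
qed

lemma singular_face_last: "singular_face (Suc p) (Suc p) \<sigma> = front_face p \<sigma>"
  unfolding singular_face_def front_face_def diff_Suc_Suc diff_zero
  by (rule restrict_ext) (simp add: simplical_face_ge)

lemma cup_cochain_closed: "cup_cochain p q X \<phi> \<psi> \<in> cochains (p + q) X"
  unfolding cup_cochain_def frag_eval_eq_linear carrier_chain_group by (rule linear_cochain)

lemma cup_cochain_apply:
  "singular_chain (p + q) X c \<Longrightarrow> cup_cochain p q X \<phi> \<psi> c =
    frag_linear (\<lambda>\<sigma>. \<phi> (frag_of (front_face p \<sigma>)) * \<psi> (frag_of (back_face p q \<sigma>))) c"
  by (simp add: cup_cochain_def frag_eval_eq_linear)

lemma cup_cochain_simplex:
  "singular_simplex (p + q) X \<sigma> \<Longrightarrow> cup_cochain p q X \<phi> \<psi> (frag_of \<sigma>) =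
    \<phi> (frag_of (front_face p \<sigma>)) * \<psi> (frag_of (back_face p q \<sigma>))"
  by (simp add: cup_cochain_apply singular_chain_of)

lemma cup_cochain_cong:
  assumes "\<And>\<sigma>. singular_simplex p X \<sigma> \<Longrightarrow> \<phi> (frag_of \<sigma>) = \<phi>' (frag_of \<sigma>)"
    and "\<And>\<sigma>. singular_simplex q X \<sigma> \<Longrightarrow> \<psi> (frag_of \<sigma>) = \<psi>' (frag_of \<sigma>)"
  shows "cup_cochain p q X \<phi> \<psi> = cup_cochain p q X \<phi>' \<psi>'"
proof (rule cochain_eqI[OF cup_cochain_closed cup_cochain_closed])
  fix \<sigma> assume "singular_simplex (p + q) X \<sigma>"
  then show "cup_cochain p q X \<phi> \<psi> (frag_of \<sigma>) = cup_cochain p q X \<phi>' \<psi>' (frag_of \<sigma>)"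
    using assms singular_simplex_front_face singular_simplex_back_face
    by (metis cup_cochain_simplex)
qed

lemma cup_cochain_add_left:
  assumes "singular_chain (p + q) X c"
  shows "cup_cochain p q X (\<phi> \<otimes>\<^bsub>cochain_group p X\<^esub> \<phi>') \<psi> c
    = cup_cochain p q X \<phi> \<psi> c + cup_cochain p q X \<phi>' \<psi> c"
  unfolding cup_cochain_apply[OF assms] frag_linear_add_fun[symmetric]
proof (rule frag_linear_cong)
  fix \<sigma> assume "\<sigma> \<in> Poly_Mapping.keys c"
  then have "singular_simplex (p + q) X \<sigma>"
    using assms by (auto simp: singular_chain_def)
  then have "singular_chain p X (frag_of (front_face p \<sigma>))"
    using singular_simplex_front_face by (simp add: singular_chain_of)
  then show "(\<phi> \<otimes>\<^bsub>cochain_group p X\<^esub> \<phi>') (frag_of (front_face p \<sigma>)) * \<psi> (frag_of (back_face p q \<sigma>)) =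
      \<phi> (frag_of (front_face p \<sigma>)) * \<psi> (frag_of (back_face p q \<sigma>)) +
      \<phi>' (frag_of (front_face p \<sigma>)) * \<psi> (frag_of (back_face p q \<sigma>))"
    by (simp add: mult_cochain_group algebra_simps)
qed

lemma cup_cochain_add_right:
  assumes "singular_chain (p + q) X c"
  shows "cup_cochain p q X \<phi> (\<psi> \<otimes>\<^bsub>cochain_group q X\<^esub> \<psi>') c
    = cup_cochain p q X \<phi> \<psi> c + cup_cochain p q X \<phi> \<psi>' c"
  unfolding cup_cochain_apply[OF assms] frag_linear_add_fun[symmetric]
proof (rule frag_linear_cong)
  fix \<sigma> assume "\<sigma> \<in> Poly_Mapping.keys c"
  then have "singular_simplex (p + q) X \<sigma>"
    using assms by (auto simp: singular_chain_def)
  then have "singular_chain q X (frag_of (back_face p q \<sigma>))"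
    using singular_simplex_back_face by (simp add: singular_chain_of)
  then show "\<phi> (frag_of (front_face p \<sigma>)) * (\<psi> \<otimes>\<^bsub>cochain_group q X\<^esub> \<psi>') (frag_of (back_face p q \<sigma>)) =
      \<phi> (frag_of (front_face p \<sigma>)) * \<psi> (frag_of (back_face p q \<sigma>)) +
      \<phi> (frag_of (front_face p \<sigma>)) * \<psi>' (frag_of (back_face p q \<sigma>))"
    by (simp add: mult_cochain_group algebra_simps)
qed

lemma cup_cochain_zero:
  assumes "singular_chain (p + q) X c"
    and "(\<forall>\<sigma>. singular_simplex p X \<sigma> \<longrightarrow> \<phi> (frag_of \<sigma>) = 0) \<or> (\<forall>\<sigma>. singular_simplex q X \<sigma> \<longrightarrow> \<psi> (frag_of \<sigma>) = 0)"
  shows "cup_cochain p q X \<phi> \<psi> c = 0"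
proof -
  have "cup_cochain p q X \<phi> \<psi> c = frag_linear (\<lambda>\<sigma>. 0) c"
    unfolding cup_cochain_apply[OF assms(1)]
  proof (rule frag_linear_cong)
    fix \<sigma> assume "\<sigma> \<in> Poly_Mapping.keys c"
    then have "singular_simplex (p + q) X \<sigma>"
      using assms(1) by (auto simp: singular_chain_def)
    then show "\<phi> (frag_of (front_face p \<sigma>)) * \<psi> (frag_of (back_face p q \<sigma>)) = 0"
      using assms(2) singular_simplex_front_face singular_simplex_back_face by (metis mult_eq_0_iff)
  qed
  then show ?thesis
    by (simp add: frag_linear_def)
qed

lemma cocycle_coboundary_simplex:
  assumes "\<phi> \<in> cocycle_set p X" "singular_simplex (Suc p) X \<sigma>"
  shows "coboundary p X \<phi> (frag_of \<sigma>) = 0"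
  using assms by (simp add: cocycle_iff coboundary_apply singular_chain_of)

lemma coboundary_simplex:
  assumes \<phi>: "\<phi> \<in> cochains p X" and \<sigma>: "singular_simplex (Suc p) X \<sigma>"
  shows "coboundary p X \<phi> (frag_of \<sigma>) = (\<Sum>i\<le>Suc p. (-1) ^ i * \<phi> (frag_of (singular_face (Suc p) i \<sigma>)))"
proof -
  have "singular_chain p X (chain_boundary (Suc p) (frag_of \<sigma>))"
    using \<sigma> by (intro singular_chain_boundary_alt) (simp add: singular_chain_of)
  then have "\<phi> (chain_boundary (Suc p) (frag_of \<sigma>)) =
      frag_linear (\<lambda>\<sigma>. \<phi> (frag_of \<sigma>)) (chain_boundary (Suc p) (frag_of \<sigma>))"
    by (rule cochain_eval[OF \<phi>])
  also have "\<dots> = (\<Sum>i\<le>Suc p. (-1) ^ i * \<phi> (frag_of (singular_face (Suc p) i \<sigma>)))"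
    unfolding chain_boundary_of by (simp add: frag_linear_sum del: sum.atMost_Suc)
  finally show ?thesis
    using \<sigma> by (simp add: coboundary_apply singular_chain_of)
qed

text \<open>
  The faces opposite the first \<open>p + 1\<close> vertices leave the back face alone and the remaining ones
  leave the front face alone. The two coboundaries together count the product of the front \<open>p\<close>-face
  and the back \<open>q\<close>-face twice, with opposite signs.
\<close>

lemma leibniz_simplex:
  assumes \<phi>: "\<phi> \<in> cochains p X" and \<psi>: "\<psi> \<in> cochains q X" and \<sigma>: "singular_simplex (Suc (p + q)) X \<sigma>"
  shows "coboundary (p + q) X (cup_cochain p q X \<phi> \<psi>) (frag_of \<sigma>) =
    cup_cochain (Suc p) q X (coboundary p X \<phi>) \<psi> (frag_of \<sigma>)
    + (-1) ^ p * cup_cochain p (Suc q) X \<phi> (coboundary q X \<psi>) (frag_of \<sigma>)"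
proof -
  have split: "(\<Sum>i\<le>Suc (m + n). f i) = (\<Sum>i\<le>m. f i) + (\<Sum>j\<le>n. f (Suc m + j))" for m n and f :: "nat \<Rightarrow> int"
    by (induction n) auto
  let ?d = "\<lambda>i. singular_face (Suc (p + q)) i \<sigma>"
  define A where "A i = \<phi> (frag_of (front_face p (?d i)))" for i
  define B where "B i = \<psi> (frag_of (back_face p q (?d i)))" for i
  define a where "a = \<phi> (frag_of (front_face p \<sigma>))"
  define c where "c = \<psi> (frag_of (back_face (Suc p) q \<sigma>))"
  have A: "A i = a" if "p < i" for i
    using front_face_of_face_gt[OF that, of q \<sigma>] by (simp add: A_def a_def)
  have B: "B i = c" if "i \<le> p" for i
    using back_face_of_face_le[OF that, of q \<sigma>] by (simp add: B_def c_def)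
  have \<sigma>1: "singular_simplex (Suc p + q) X \<sigma>" and \<sigma>2: "singular_simplex (p + Suc q) X \<sigma>"
    using \<sigma> by simp_all
  have face: "singular_simplex (p + q) X (?d i)" if "i \<le> Suc (p + q)" for i
    using singular_simplex_singular_face[OF \<sigma>, of i] that by simp
  have lhs: "coboundary (p + q) X (cup_cochain p q X \<phi> \<psi>) (frag_of \<sigma>) =
      (\<Sum>i\<le>Suc (p + q). (-1) ^ i * (A i * B i))"
    unfolding coboundary_simplex[OF cup_cochain_closed \<sigma>]
    by (intro sum.cong) (simp_all add: cup_cochain_simplex face A_def B_def)
  have 1: "cup_cochain (Suc p) q X (coboundary p X \<phi>) \<psi> (frag_of \<sigma>) = (\<Sum>i\<le>Suc p. (-1) ^ i * A i) * c"
  proof -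
    have "coboundary p X \<phi> (frag_of (front_face (Suc p) \<sigma>)) = (\<Sum>i\<le>Suc p. (-1) ^ i * A i)"
      unfolding coboundary_simplex[OF \<phi> singular_simplex_front_face[OF \<sigma>1]] A_def
      by (intro sum.cong) (simp_all add: front_face_of_face_le[of _ p \<sigma> q])
    then show ?thesis
      by (simp add: cup_cochain_simplex[OF \<sigma>1] c_def)
  qed
  have 2: "cup_cochain p (Suc q) X \<phi> (coboundary q X \<psi>) (frag_of \<sigma>) = a * (\<Sum>j\<le>Suc q. (-1) ^ j * B (p + j))"
  proof -
    have "coboundary q X \<psi> (frag_of (back_face p (Suc q) \<sigma>)) = (\<Sum>j\<le>Suc q. (-1) ^ j * B (p + j))"
      unfolding coboundary_simplex[OF \<psi> singular_simplex_back_face[OF \<sigma>2]] B_def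
      by (intro sum.cong) (simp_all add: back_face_of_face_add[of _ q p \<sigma>])
    then show ?thesis
      by (simp add: cup_cochain_simplex[OF \<sigma>2] a_def)
  qed
  have "(\<Sum>i\<le>Suc p. (-1) ^ i * A i) * c = (\<Sum>i\<le>p. (-1) ^ i * (A i * B i)) - (-1) ^ p * (a * c)"
  proof -
    have "(\<Sum>i\<le>p. (-1) ^ i * A i) * c = (\<Sum>i\<le>p. (-1) ^ i * (A i * B i))"
      unfolding sum_distrib_right by (intro sum.cong) (simp_all add: B)
    then show ?thesis
      by (simp add: A left_diff_distrib)
  qed
  moreover have "(-1) ^ p * (a * (\<Sum>j\<le>Suc q. (-1) ^ j * B (p + j))) =
      (-1) ^ p * (a * c) + (\<Sum>j\<le>q. (-1) ^ (Suc p + j) * (A (Suc p + j) * B (Suc p + j)))"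
    unfolding sum.atMost_Suc_shift
    by (simp add: A B sum_distrib_left power_add algebra_simps)
  ultimately show ?thesis
    unfolding lhs 1 2 split by simp
qed

lemma leibniz:
  assumes \<phi>: "\<phi> \<in> cochains p X" and \<psi>: "\<psi> \<in> cochains q X" and c: "singular_chain (Suc (p + q)) X c"
  shows "cup_cochain p q X \<phi> \<psi> (chain_boundary (Suc (p + q)) c) =
    cup_cochain (Suc p) q X (coboundary p X \<phi>) \<psi> c
    + (-1) ^ p * cup_cochain p (Suc q) X \<phi> (coboundary q X \<psi>) c"
proof -
  have c1: "singular_chain (Suc p + q) X c" and c2: "singular_chain (p + Suc q) X c"
    using c by simp_all
  have "cup_cochain p q X \<phi> \<psi> (chain_boundary (Suc (p + q)) c) = coboundary (p + q) X (cup_cochain p q X \<phi> \<psi>) c"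
    using c by (simp add: coboundary_apply)
  also have "\<dots> = frag_linear (\<lambda>\<sigma>. coboundary (p + q) X (cup_cochain p q X \<phi> \<psi>) (frag_of \<sigma>)) c"
    by (rule cochain_eval[OF coboundary_cochain[OF cup_cochain_closed] c])
  also have "\<dots> = frag_linear (\<lambda>\<sigma>. cup_cochain (Suc p) q X (coboundary p X \<phi>) \<psi> (frag_of \<sigma>)
      + (-1) ^ p * cup_cochain p (Suc q) X \<phi> (coboundary q X \<psi>) (frag_of \<sigma>)) c"
    using c by (intro frag_linear_cong leibniz_simplex[OF \<phi> \<psi>]) (auto simp: singular_chain_def)
  also have "\<dots> = frag_linear (\<lambda>\<sigma>. cup_cochain (Suc p) q X (coboundary p X \<phi>) \<psi> (frag_of \<sigma>)) c
      + (-1) ^ p * frag_linear (\<lambda>\<sigma>. cup_cochain p (Suc q) X \<phi> (coboundary q X \<psi>) (frag_of \<sigma>)) c"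
    unfolding frag_linear_add_fun by (simp add: frag_linear_def sum_distrib_left mult_ac)
  finally show ?thesis
    unfolding cochain_eval[OF cup_cochain_closed c1, symmetric] cochain_eval[OF cup_cochain_closed c2, symmetric] .
qed

lemma cup_cochain_cocycle:
  assumes \<phi>: "\<phi> \<in> cocycle_set p X" and \<psi>: "\<psi> \<in> cocycle_set q X"
  shows "cup_cochain p q X \<phi> \<psi> \<in> cocycle_set (p + q) X"
  unfolding cocycle_iff
proof (intro conjI allI impI cup_cochain_closed)
  fix c assume c: "singular_chain (Suc (p + q)) X c"
  have "cup_cochain (Suc p) q X (coboundary p X \<phi>) \<psi> c = 0"
    using c cocycle_coboundary_simplex[OF \<phi>] by (intro cup_cochain_zero) auto
  moreover have "cup_cochain p (Suc q) X \<phi> (coboundary q X \<psi>) c = 0"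
    using c cocycle_coboundary_simplex[OF \<psi>] by (intro cup_cochain_zero) auto
  ultimately show "cup_cochain p q X \<phi> \<psi> (chain_boundary (Suc (p + q)) c) = 0"
    using leibniz[of \<phi> p X \<psi> q c] \<phi> \<psi> c by (simp add: cocycle_iff)
qed

lemma cup_cochain_assoc:
  assumes c: "singular_chain (p + q + r) X c"
  shows "cup_cochain (p + q) r X (cup_cochain p q X \<phi> \<psi>) \<theta> c = cup_cochain p (q + r) X \<phi> (cup_cochain q r X \<psi> \<theta>) c"
proof -
  have c': "singular_chain (p + (q + r)) X c"
    using c by (simp add: add.assoc)
  show ?thesis
    unfolding cup_cochain_apply[OF c] cup_cochain_apply[OF c']
  proof (rule frag_linear_cong)
    fix \<sigma> assume "\<sigma> \<in> Poly_Mapping.keys c"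
    then have \<sigma>: "singular_simplex (p + q + r) X \<sigma>" "singular_simplex (p + (q + r)) X \<sigma>"
      using c c' by (auto simp: singular_chain_def)
    show "cup_cochain p q X \<phi> \<psi> (frag_of (front_face (p + q) \<sigma>)) * \<theta> (frag_of (back_face (p + q) r \<sigma>)) =
        \<phi> (frag_of (front_face p \<sigma>)) * cup_cochain q r X \<psi> \<theta> (frag_of (back_face p (q + r) \<sigma>))"
      unfolding cup_cochain_simplex[OF singular_simplex_front_face[OF \<sigma>(1)]]
        cup_cochain_simplex[OF singular_simplex_back_face[OF \<sigma>(2)]]
        front_face_front_face back_face_back_face back_face_front_face[of p q \<sigma> r]
      by simp
  qed
qed

text \<open>
  If the factors change by the coboundaries of \<open>f\<close> and \<open>g\<close>, then by the Leibniz rule the product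
  changes by the coboundary of a combination of \<open>f \<union> \<psi>'\<close> and \<open>\<phi> \<union> g\<close>.
\<close>

lemma cup_product_class:
  assumes \<phi>: "\<phi> \<in> cocycle_set p X" and \<psi>: "\<psi> \<in> cocycle_set q X" and "p > 0" "q > 0"
  shows "cup_product p q X (cohomology_class p X \<phi>) (cohomology_class q X \<psi>)
    = cohomology_class (p + q) X (cup_cochain p q X \<phi> \<psi>)"
proof -
  obtain p' q' where p: "p = Suc p'" and q: "q = Suc q'"
    using \<open>p > 0\<close> \<open>q > 0\<close> gr0_conv_Suc by auto
  have \<phi>C: "\<phi> \<in> cochains p X" and \<psi>C: "\<psi> \<in> cochains q X"
    using \<phi> \<psi> by (simp_all add: cocycle_iff)
  have eq: "cohomology_class (p + q) X (cup_cochain p q X \<phi>' \<psi>') = cohomology_class (p + q) X (cup_cochain p q X \<phi> \<psi>)"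
    if mem: "\<phi>' \<in> cohomology_class p X \<phi>" "\<psi>' \<in> cohomology_class q X \<psi>" for \<phi>' \<psi>'
  proof -
    obtain f where f: "f \<in> cochains p' X" "\<phi>' = coboundary p' X f \<otimes>\<^bsub>cochain_group p X\<^esub> \<phi>"
      using mem(1) unfolding p mem_cohomology_class by blast
    obtain g where g: "g \<in> cochains q' X" "\<psi>' = coboundary q' X g \<otimes>\<^bsub>cochain_group q X\<^esub> \<psi>"
      using mem(2) unfolding q mem_cohomology_class by blast
    have "coboundary q' X g \<in> cocycle_set q X"
      unfolding q using coboundary_set_subset g(1) by (auto simp: coboundary_set_Suc)
    then have \<psi>': "\<psi>' \<in> cocycle_set q X"
      unfolding g(2) using subgroup.m_closed[OF subgroup_cocycle_set] \<psi> by blast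
    let ?f = "cup_cochain p' q X f \<psi>'" and ?g = "cup_cochain p q' X \<phi> g"
    have dims: "p' + q = Suc (p' + q')" "p + q' = Suc (p' + q')" "p + q = Suc (Suc (p' + q'))"
      by (simp_all add: p q)
    \<comment> \<open>The sign compensates the one in the Leibniz rule for \<open>?g\<close>.\<close>
    define h where "h = (\<lambda>c\<in>singular_chain_set (Suc (p' + q')) X. ?f c + (-1) ^ p * ?g c)"
    have fC: "?f \<in> cochains (Suc (p' + q')) X" and gC: "?g \<in> cochains (Suc (p' + q')) X"
      using cup_cochain_closed[of p' q X f \<psi>'] cup_cochain_closed[of p q' X \<phi> g] by (simp_all add: dims)
    have hC: "h \<in> cochains (Suc (p' + q')) X"
      unfolding h_def
      by (rule cochainI) (simp_all add: singular_chain_add cochain_add[OF fC] cochain_add[OF gC] algebra_simps)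
    have "cup_cochain p q X \<phi>' \<psi>' =
        coboundary (Suc (p' + q')) X h \<otimes>\<^bsub>cochain_group (p + q) X\<^esub> cup_cochain p q X \<phi> \<psi>"
    proof (rule extensionalityI[OF cochain_extensional[OF cup_cochain_closed]])
      fix c assume "c \<in> singular_chain_set (p + q) X"
      then have c: "singular_chain (p + q) X c" and c': "singular_chain (Suc (Suc (p' + q'))) X c"
        by (simp_all add: dims)
      have "?f (chain_boundary (Suc (p' + q)) c) = cup_cochain p q X (coboundary p' X f) \<psi>' c
          + (-1) ^ p' * cup_cochain p' (Suc q) X f (coboundary q X \<psi>') c"
        using leibniz[OF f(1), of \<psi>' q c] \<psi>' c by (simp add: p cocycle_iff)
      moreover have "cup_cochain p' (Suc q) X f (coboundary q X \<psi>') c = 0"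
        using c cocycle_coboundary_simplex[OF \<psi>'] by (intro cup_cochain_zero) (auto simp: p)
      moreover have "?g (chain_boundary (Suc (p + q')) c) = cup_cochain (Suc p) q' X (coboundary p X \<phi>) g c
          + (-1) ^ p * cup_cochain p q X \<phi> (coboundary q' X g) c"
        using leibniz[OF \<phi>C g(1), of c] c by (simp add: q)
      moreover have "cup_cochain (Suc p) q' X (coboundary p X \<phi>) g c = 0"
        using c cocycle_coboundary_simplex[OF \<phi>] by (intro cup_cochain_zero) (auto simp: q)
      moreover have "coboundary (Suc (p' + q')) X h c = ?f (chain_boundary (Suc (p' + q)) c)
          + (-1) ^ p * ?g (chain_boundary (Suc (p + q')) c)"
        using singular_chain_boundary_alt[OF c'] c' by (simp add: coboundary_apply h_def dims)
      ultimately have dh: "coboundary (Suc (p' + q')) X h c =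
          cup_cochain p q X (coboundary p' X f) \<psi>' c + cup_cochain p q X \<phi> (coboundary q' X g) c"
        by (simp add: mult.assoc[symmetric] power_mult_distrib[symmetric])
      show "cup_cochain p q X \<phi>' \<psi>' c =
          (coboundary (Suc (p' + q')) X h \<otimes>\<^bsub>cochain_group (p + q) X\<^esub> cup_cochain p q X \<phi> \<psi>) c"
      proof -
        have "cup_cochain p q X \<phi>' \<psi>' c = cup_cochain p q X (coboundary p' X f) \<psi>' c + cup_cochain p q X \<phi> \<psi>' c"
          unfolding f(2) by (rule cup_cochain_add_left[OF c])
        moreover have "cup_cochain p q X \<phi> \<psi>' c = cup_cochain p q X \<phi> (coboundary q' X g) c + cup_cochain p q X \<phi> \<psi> c"
          unfolding g(2) by (rule cup_cochain_add_right[OF c])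
        moreover have "(coboundary (Suc (p' + q')) X h \<otimes>\<^bsub>cochain_group (p + q) X\<^esub> cup_cochain p q X \<phi> \<psi>) c
            = coboundary (Suc (p' + q')) X h c + cup_cochain p q X \<phi> \<psi> c"
          using c by (simp add: mult_cochain_group)
        ultimately show ?thesis
          using dh by linarith
      qed
    qed (simp add: mult_cochain_group)
    then show ?thesis
      using cohomology_class_eqI[of "cup_cochain p q X \<phi> \<psi>" "Suc (p' + q')" X h] hC
        cup_cochain_closed[of p q X \<phi> \<psi>] unfolding dims(3) by blast
  qed
  have "\<phi> \<in> cohomology_class p X \<phi>" "\<psi> \<in> cohomology_class q X \<psi>"
    using cohomology_class_self \<phi>C \<psi>C p q by blast+
  then have "{cohomology_class (p + q) X (cup_cochain p q X \<phi>' \<psi>') | \<phi>' \<psi>'.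
      \<phi>' \<in> cohomology_class p X \<phi> \<and> \<psi>' \<in> cohomology_class q X \<psi>} = {cohomology_class (p + q) X (cup_cochain p q X \<phi> \<psi>)}"
    using eq by blast
  then show ?thesis
    unfolding cup_product_def cohomology_class_def[of "p + q", symmetric] by simp
qed

text \<open>
  Coboundaries vanish on cycles and cocycles on boundaries.
\<close>

lemma kronecker_pairing_class:
  assumes \<phi>: "\<phi> \<in> cocycle_set p X" and "p > 0"
    and z: "singular_chain p X z" "chain_boundary p z = 0"
  shows "kronecker_pairing (cohomology_class p X \<phi>) (homologous_rel_set p X {} z) = \<phi> z"
proof -
  obtain p' where p: "p = Suc p'"
    using \<open>p > 0\<close> gr0_conv_Suc by auto
  have \<phi>C: "\<phi> \<in> cochains p X"
    using \<phi> by (simp add: cocycle_iff)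
  have "\<phi>' z' = \<phi> z" if mem: "\<phi>' \<in> cohomology_class p X \<phi>" "z' \<in> homologous_rel_set p X {} z" for \<phi>' z'
  proof -
    obtain f where f: "f \<in> cochains p' X" "\<phi>' = coboundary p' X f \<otimes>\<^bsub>cochain_group p X\<^esub> \<phi>"
      using mem(1) unfolding p mem_cohomology_class by blast
    obtain w where w: "singular_chain (Suc p) X w" "chain_boundary (Suc p) w = z - z'"
      using mem(2) by (auto simp: homologous_rel_def singular_boundary)
    have z': "z' = z - chain_boundary (Suc p) w"
      using w(2) by simp
    have bw: "singular_chain p X (chain_boundary (Suc p) w)"
      by (rule singular_chain_boundary_alt[OF w(1)])
    have sz': "singular_chain p X z'"
      unfolding z' by (rule singular_chain_diff[OF z(1) bw])
    have "chain_boundary p z' = 0"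
      unfolding z' chain_boundary_diff z(2) using chain_boundary_boundary_alt[of p X w] w(1) p by simp
    then have "coboundary p' X f z' = 0"
      using sz' cochain_0[OF f(1)] by (simp add: p coboundary_apply)
    moreover have "\<phi> z' = \<phi> z"
      unfolding z' cochain_diff[OF \<phi>C z(1) bw] using \<phi> w(1) by (simp add: cocycle_iff)
    ultimately show ?thesis
      using sz' by (simp add: f(2) mult_cochain_group)
  qed
  moreover have "\<phi> \<in> cohomology_class p X \<phi>"
    using cohomology_class_self \<phi>C p by blast
  moreover have "z \<in> homologous_rel_set p X {} z"
    by simp
  ultimately have "{\<phi>' z' | \<phi>' z'. \<phi>' \<in> cohomology_class p X \<phi> \<and> z' \<in> homologous_rel_set p X {} z} = {\<phi> z}"
    by blast
  then show ?thesis
    unfolding kronecker_pairing_def by simp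
qed

section \<open>The triple cup product\<close>

text \<open>
  For cocycles of degree one, \<open>\<phi>\<close> and \<open>\<psi>\<close> are additive along the edges of a triangle. Expanding the
  product of the values on the long edge shows that the two cup products sum to minus the
  coboundary of the pointwise product.
\<close>

lemma cup_cochain_anticommute_simplex:
  assumes \<phi>: "\<phi> \<in> cocycle_set 1 X" and \<psi>: "\<psi> \<in> cocycle_set 1 X" and \<sigma>: "singular_simplex 2 X \<sigma>"
  defines "n \<equiv> restrict (frag_linear (\<lambda>\<sigma>. \<phi> (frag_of \<sigma>) * \<psi> (frag_of \<sigma>))) (singular_chain_set 1 X)"
  shows "cup_cochain 1 1 X \<phi> \<psi> (frag_of \<sigma>) + cup_cochain 1 1 X \<psi> \<phi> (frag_of \<sigma>) = - coboundary 1 X n (frag_of \<sigma>)"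
proof -
  have \<sigma>1: "singular_simplex (1 + 1) X \<sigma>" and \<sigma>': "singular_simplex (Suc 1) X \<sigma>"
    using \<sigma> by (simp_all add: numeral_2_eq_2)
  have nC: "n \<in> cochains 1 X"
    unfolding n_def by (rule linear_cochain)
  define d where "d i = singular_face (Suc 1) i \<sigma>" for i
  have d0: "back_face 1 1 \<sigma> = d 0" and d2: "front_face 1 \<sigma> = d 2"
    using singular_face_0[of 1 \<sigma>] singular_face_last[of 1 \<sigma>] by (simp_all add: d_def numeral_2_eq_2)
  have sum3: "(\<Sum>i\<le>Suc 1. f i) = f 0 + f 1 + f 2" for f :: "nat \<Rightarrow> int"
    by (simp add: numeral_2_eq_2)
  have face: "singular_simplex 1 X (d i)" if "i \<le> 2" for i
    using singular_simplex_singular_face[OF \<sigma>', of i] that by (simp add: d_def)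
  have closed: "\<eta> (frag_of (d 1)) = \<eta> (frag_of (d 0)) + \<eta> (frag_of (d 2))" if "\<eta> \<in> cocycle_set 1 X" for \<eta>
  proof -
    have "\<eta> \<in> cochains 1 X"
      using that by (simp add: cocycle_iff)
    then have "(\<Sum>i\<le>Suc 1. (-1) ^ i * \<eta> (frag_of (d i))) = 0"
      using coboundary_simplex[of \<eta> 1 X \<sigma>] \<sigma>' cocycle_coboundary_simplex[OF that \<sigma>'] unfolding d_def by metis
    then show ?thesis
      unfolding sum3 by simp
  qed
  have n: "n (frag_of (d i)) = \<phi> (frag_of (d i)) * \<psi> (frag_of (d i))" if "i \<le> 2" for i
    using face[OF that] by (simp add: n_def singular_chain_of)
  have dn: "coboundary 1 X n (frag_of \<sigma>) = n (frag_of (d 0)) - n (frag_of (d 1)) + n (frag_of (d 2))"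
    unfolding coboundary_simplex[OF nC \<sigma>'] d_def[symmetric] sum3 by simp
  have n0: "n (frag_of (d 0)) = \<phi> (frag_of (d 0)) * \<psi> (frag_of (d 0))"
    and n1: "n (frag_of (d 1)) = \<phi> (frag_of (d 1)) * \<psi> (frag_of (d 1))"
    and n2: "n (frag_of (d 2)) = \<phi> (frag_of (d 2)) * \<psi> (frag_of (d 2))"
    by (rule n, simp)+
  show ?thesis
    unfolding cup_cochain_simplex[OF \<sigma>1] d0 d2 dn n0 n1 n2 closed[OF \<phi>] closed[OF \<psi>]
    by (simp add: algebra_simps)
qed

text \<open>
  The coboundary that corrects anticommutativity stays one after the cup product with a cocycle, and
  hence vanishes on cycles.
\<close>

lemma triple_cup_swap_12:
  assumes \<phi>: "\<phi> \<in> cocycle_set 1 X" and \<psi>: "\<psi> \<in> cocycle_set 1 X" and \<theta>: "\<theta> \<in> cocycle_set 1 X"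
    and z: "singular_chain 3 X z" "chain_boundary 3 z = 0"
  shows "cup_cochain 2 1 X (cup_cochain 1 1 X \<psi> \<phi>) \<theta> z = - cup_cochain 2 1 X (cup_cochain 1 1 X \<phi> \<psi>) \<theta> z"
proof -
  define n where "n = restrict (frag_linear (\<lambda>\<sigma>. \<phi> (frag_of \<sigma>) * \<psi> (frag_of \<sigma>))) (singular_chain_set 1 X)"
  have nC: "n \<in> cochains 1 X" and \<theta>C: "\<theta> \<in> cochains 1 X"
    using linear_cochain \<theta> by (simp_all add: n_def cocycle_iff)
  have z21: "singular_chain (2 + 1) X z" and z12: "singular_chain (1 + 2) X z"
    using z(1) by (simp_all add: numeral_3_eq_3)
  have 12: "Suc 1 = 2" and 3: "Suc (1 + 1) = 3"
    by simp_all
  have "cup_cochain 2 1 X (coboundary 1 X n) \<theta> z = 0"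
  proof -
    have "cup_cochain 1 1 X n \<theta> (chain_boundary 3 z) =
        cup_cochain 2 1 X (coboundary 1 X n) \<theta> z + (-1) ^ 1 * cup_cochain 1 2 X n (coboundary 1 X \<theta>) z"
      using leibniz[OF nC \<theta>C, of z] z(1) unfolding 3 12 by blast
    moreover have "cup_cochain 1 2 X n (coboundary 1 X \<theta>) z = 0"
      using cocycle_coboundary_simplex[OF \<theta>, unfolded 12] by (intro cup_cochain_zero[OF z12]) simp
    ultimately show ?thesis
      using cochain_0[OF cup_cochain_closed[of 1 1 X n \<theta>]] unfolding z(2) power_one_right by linarith
  qed
  moreover have "cup_cochain 2 1 X (cup_cochain 1 1 X \<phi> \<psi>) \<theta> z + cup_cochain 2 1 X (cup_cochain 1 1 X \<psi> \<phi>) \<theta> z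
      = - cup_cochain 2 1 X (coboundary 1 X n) \<theta> z"
    unfolding cup_cochain_apply[OF z21] frag_linear_add_fun[symmetric] frag_linear_uminus_fun[symmetric]
  proof (rule frag_linear_cong)
    fix \<sigma> assume "\<sigma> \<in> Poly_Mapping.keys z"
    then have "singular_simplex (2 + 1) X \<sigma>"
      using z21 by (auto simp: singular_chain_def)
    from cup_cochain_anticommute_simplex[OF \<phi> \<psi> singular_simplex_front_face[OF this], folded n_def]
    show "cup_cochain 1 1 X \<phi> \<psi> (frag_of (front_face 2 \<sigma>)) * \<theta> (frag_of (back_face 2 1 \<sigma>)) +
        cup_cochain 1 1 X \<psi> \<phi> (frag_of (front_face 2 \<sigma>)) * \<theta> (frag_of (back_face 2 1 \<sigma>)) =
        - (coboundary 1 X n (frag_of (front_face 2 \<sigma>)) * \<theta> (frag_of (back_face 2 1 \<sigma>)))"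
      by (simp only: distrib_right[symmetric] minus_mult_left)
  qed
  ultimately show ?thesis by linarith
qed

text \<open>
  By associativity the exchange takes place in the last two factors.
\<close>

lemma triple_cup_swap_23:
  assumes \<phi>: "\<phi> \<in> cocycle_set 1 X" and \<psi>: "\<psi> \<in> cocycle_set 1 X" and \<theta>: "\<theta> \<in> cocycle_set 1 X"
    and z: "singular_chain 3 X z" "chain_boundary 3 z = 0"
  shows "cup_cochain 2 1 X (cup_cochain 1 1 X \<phi> \<theta>) \<psi> z = - cup_cochain 2 1 X (cup_cochain 1 1 X \<phi> \<psi>) \<theta> z"
proof -
  define n where "n = restrict (frag_linear (\<lambda>\<sigma>. \<psi> (frag_of \<sigma>) * \<theta> (frag_of \<sigma>))) (singular_chain_set 1 X)"
  have nC: "n \<in> cochains 1 X" and \<phi>C: "\<phi> \<in> cochains 1 X"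
    using linear_cochain \<phi> by (simp_all add: n_def cocycle_iff)
  have z12: "singular_chain (1 + 2) X z" and z111: "singular_chain (1 + 1 + 1) X z"
    using z(1) by (simp_all add: numeral_3_eq_3)
  have 12: "Suc 1 = 2" and 3: "Suc (1 + 1) = 3" and 2: "1 + 1 = (2 :: nat)"
    by simp_all
  have assoc: "cup_cochain 2 1 X (cup_cochain 1 1 X \<phi> \<alpha>) \<beta> z = cup_cochain 1 2 X \<phi> (cup_cochain 1 1 X \<alpha> \<beta>) z" for \<alpha> \<beta>
    using cup_cochain_assoc[OF z111, of \<phi> \<alpha> \<beta>] unfolding 2 .
  have "cup_cochain 1 2 X \<phi> (coboundary 1 X n) z = 0"
  proof -
    have "cup_cochain 1 1 X \<phi> n (chain_boundary 3 z) =
        cup_cochain 2 1 X (coboundary 1 X \<phi>) n z + (-1) ^ 1 * cup_cochain 1 2 X \<phi> (coboundary 1 X n) z"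
      using leibniz[OF \<phi>C nC, of z] z(1) unfolding 3 12 by blast
    moreover have "cup_cochain 2 1 X (coboundary 1 X \<phi>) n z = 0"
      using z(1) cocycle_coboundary_simplex[OF \<phi>, unfolded 12] by (intro cup_cochain_zero) simp_all
    ultimately show ?thesis
      using cochain_0[OF cup_cochain_closed[of 1 1 X \<phi> n]] unfolding z(2) power_one_right by linarith
  qed
  moreover have "cup_cochain 1 2 X \<phi> (cup_cochain 1 1 X \<psi> \<theta>) z + cup_cochain 1 2 X \<phi> (cup_cochain 1 1 X \<theta> \<psi>) z
      = - cup_cochain 1 2 X \<phi> (coboundary 1 X n) z"
    unfolding cup_cochain_apply[OF z12] frag_linear_add_fun[symmetric] frag_linear_uminus_fun[symmetric]
  proof (rule frag_linear_cong)
    fix \<sigma> assume "\<sigma> \<in> Poly_Mapping.keys z"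
    then have "singular_simplex (1 + 2) X \<sigma>"
      using z12 by (auto simp: singular_chain_def)
    from cup_cochain_anticommute_simplex[OF \<psi> \<theta> singular_simplex_back_face[OF this], folded n_def]
    show "\<phi> (frag_of (front_face 1 \<sigma>)) * cup_cochain 1 1 X \<psi> \<theta> (frag_of (back_face 1 2 \<sigma>)) +
        \<phi> (frag_of (front_face 1 \<sigma>)) * cup_cochain 1 1 X \<theta> \<psi> (frag_of (back_face 1 2 \<sigma>)) =
        - (\<phi> (frag_of (front_face 1 \<sigma>)) * coboundary 1 X n (frag_of (back_face 1 2 \<sigma>)))"
      by (simp only: distrib_left[symmetric] minus_mult_right)
  qed
  ultimately show ?thesis
    unfolding assoc by linarith
qed

lemma triple_cup_alternating:
  assumes \<zeta>: "\<zeta> \<in> carrier (homology_group 3 Y)"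
  shows "comm_group.alternating_trilinear (cohomology_group 1 Y)
    (\<lambda>a b c. kronecker_pairing (cup_product 2 1 Y (cup_product 1 1 Y a b) c) \<zeta>)"
proof -
  interpret H: comm_group "cohomology_group 1 Y"
    using comm_group_cohomology_group[of 0 Y] by simp
  have "\<zeta> \<in> homologous_rel_set 3 Y {} ` singular_relcycle_set 3 Y {}"
    using \<zeta> carrier_relative_homology_group[of 3 Y "{}"] by simp
  then obtain z where z: "singular_chain 3 Y z" "chain_boundary 3 z = 0" and \<zeta>z: "\<zeta> = homologous_rel_set 3 Y {} z"
    by (auto simp: singular_cycle)
  let ?f = "\<lambda>a b c. kronecker_pairing (cup_product 2 1 Y (cup_product 1 1 Y a b) c) \<zeta>"
  let ?cl = "cohomology_class 1 Y"
  have f: "?f (?cl \<phi>) (?cl \<psi>) (?cl \<theta>) = cup_cochain 2 1 Y (cup_cochain 1 1 Y \<phi> \<psi>) \<theta> z"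
    if "\<phi> \<in> cocycle_set 1 Y" "\<psi> \<in> cocycle_set 1 Y" "\<theta> \<in> cocycle_set 1 Y" for \<phi> \<psi> \<theta>
  proof -
    have 2: "1 + 1 = (2::nat)" and 3: "2 + 1 = (3::nat)"
      by simp_all
    have c2: "cup_cochain 1 1 Y \<phi> \<psi> \<in> cocycle_set 2 Y"
      using cup_cochain_cocycle[OF that(1,2)] unfolding 2 .
    have c3: "cup_cochain 2 1 Y (cup_cochain 1 1 Y \<phi> \<psi>) \<theta> \<in> cocycle_set 3 Y"
      using cup_cochain_cocycle[OF c2 that(3)] unfolding 3 .
    have "cup_product 1 1 Y (?cl \<phi>) (?cl \<psi>) = cohomology_class 2 Y (cup_cochain 1 1 Y \<phi> \<psi>)"
      using cup_product_class[OF that(1,2)] unfolding 2 by simp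
    moreover have "cup_product 2 1 Y (cohomology_class 2 Y (cup_cochain 1 1 Y \<phi> \<psi>)) (?cl \<theta>) =
        cohomology_class 3 Y (cup_cochain 2 1 Y (cup_cochain 1 1 Y \<phi> \<psi>) \<theta>)"
      using cup_product_class[OF c2 that(3)] unfolding 3 by simp
    ultimately show ?thesis
      unfolding \<zeta>z using kronecker_pairing_class[OF c3 _ z] by simp
  qed
  show ?thesis
    unfolding H.alternating_trilinear_def carrier_cohomology_group
  proof (intro conjI ballI)
    fix a a' b c assume "a \<in> ?cl ` cocycle_set 1 Y" "a' \<in> ?cl ` cocycle_set 1 Y"
      "b \<in> ?cl ` cocycle_set 1 Y" "c \<in> ?cl ` cocycle_set 1 Y"
    then obtain \<phi> \<phi>' \<psi> \<theta> where reps: "\<phi> \<in> cocycle_set 1 Y" "\<phi>' \<in> cocycle_set 1 Y" "\<psi> \<in> cocycle_set 1 Y" "\<theta> \<in> cocycle_set 1 Y"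
      and abc: "a = ?cl \<phi>" "a' = ?cl \<phi>'" "b = ?cl \<psi>" "c = ?cl \<theta>" by blast
    have sum: "\<phi> \<otimes>\<^bsub>cochain_group 1 Y\<^esub> \<phi>' \<in> cocycle_set 1 Y"
      using subgroup.m_closed[OF subgroup_cocycle_set] reps by blast
    have aa': "a \<otimes>\<^bsub>cohomology_group 1 Y\<^esub> a' = ?cl (\<phi> \<otimes>\<^bsub>cochain_group 1 Y\<^esub> \<phi>')"
      using mult_cohomology_class[of \<phi> 0 Y \<phi>'] reps(1,2) by (simp add: abc)
    have z21: "singular_chain (2 + 1) Y z"
      using z(1) by simp
    have "cup_cochain 2 1 Y (cup_cochain 1 1 Y (\<phi> \<otimes>\<^bsub>cochain_group 1 Y\<^esub> \<phi>') \<psi>) \<theta> z =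
        cup_cochain 2 1 Y (cup_cochain 1 1 Y \<phi> \<psi> \<otimes>\<^bsub>cochain_group 2 Y\<^esub> cup_cochain 1 1 Y \<phi>' \<psi>) \<theta> z"
    proof (rule fun_cong[OF cup_cochain_cong])
      fix \<sigma> assume "singular_simplex 2 Y \<sigma>"
      then have "singular_chain (1 + 1) Y (frag_of \<sigma>)" "singular_chain 2 Y (frag_of \<sigma>)"
        by (simp_all add: singular_chain_of numeral_2_eq_2)
      then show "cup_cochain 1 1 Y (\<phi> \<otimes>\<^bsub>cochain_group 1 Y\<^esub> \<phi>') \<psi> (frag_of \<sigma>) =
          (cup_cochain 1 1 Y \<phi> \<psi> \<otimes>\<^bsub>cochain_group 2 Y\<^esub> cup_cochain 1 1 Y \<phi>' \<psi>) (frag_of \<sigma>)"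
        using cup_cochain_add_left[of 1 1 Y "frag_of \<sigma>" \<phi> \<phi>' \<psi>] by (simp add: mult_cochain_group)
    qed simp
    also have "\<dots> = cup_cochain 2 1 Y (cup_cochain 1 1 Y \<phi> \<psi>) \<theta> z + cup_cochain 2 1 Y (cup_cochain 1 1 Y \<phi>' \<psi>) \<theta> z"
      by (rule cup_cochain_add_left[OF z21])
    finally show "?f (a \<otimes>\<^bsub>cohomology_group 1 Y\<^esub> a') b c = ?f a b c + ?f a' b c"
      unfolding aa' unfolding abc f[OF sum reps(3,4)] f[OF reps(1,3,4)] f[OF reps(2,3,4)] .
  next
    fix a b c assume "a \<in> ?cl ` cocycle_set 1 Y" "b \<in> ?cl ` cocycle_set 1 Y" "c \<in> ?cl ` cocycle_set 1 Y"
    then obtain \<phi> \<psi> \<theta> where reps: "\<phi> \<in> cocycle_set 1 Y" "\<psi> \<in> cocycle_set 1 Y" "\<theta> \<in> cocycle_set 1 Y"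
      and abc: "a = ?cl \<phi>" "b = ?cl \<psi>" "c = ?cl \<theta>" by blast
    show "?f b a c = - ?f a b c"
      unfolding abc f[OF reps(2,1,3)] f[OF reps] by (rule triple_cup_swap_12[OF reps z])
    show "?f a c b = - ?f a b c"
      unfolding abc f[OF reps(1,3,2)] f[OF reps] by (rule triple_cup_swap_23[OF reps z])
  qed
qed

theorem theorem1:
  fixes b :: nat and Y :: "'a topology" and \<zeta> :: "'a chain set"
  assumes "b \<ge> 1"
    and "closed_oriented_manifold 3 Y \<zeta>"
    and "betti_number 1 Y = enat b"
  shows "cup_rank_bound b \<le> cup_rank Y \<zeta> \<and> cup_rank Y \<zeta> \<le> 2 ^ (b - 1)"
proof -
  let ?H = "cohomology_group 1 Y"
  interpret H: comm_group ?H
    using comm_group_cohomology_group[of 0 Y] by simp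
  have \<zeta>: "\<zeta> \<in> carrier (homology_group 3 Y)"
    using assms(2) by (simp add: closed_oriented_manifold_def fundamental_class_def)
  have "group_rank ?H = enat b"
    using assms(3) by (simp add: betti_number_def)
  then obtain e co where "based_group ?H b e co"
    using H.torsionless_finite_rank_based[OF first_cohomology_torsionless] by metis
  then interpret based_group ?H b e co .
  have "triple_cup_form Y \<zeta> \<in> carrier (ext_power (dual_group ?H) 3)"
    using theI'[OF alternating_trilinear_form_unique[OF triple_cup_alternating[OF \<zeta>]]]
    unfolding triple_cup_form_def by blast
  then obtain h where h: "\<And>k. group_rank (homology_of_cup_complex ?H (triple_cup_form Y \<zeta>) k) = enat h"
    and bounds: "cup_rank_bound b \<le> real h" "real h \<le> 2 ^ (b - 1)"
    using cup_homology_rank_bounds[OF _ assms(1)] by metis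
  have eq: "cup_homology Y \<zeta> k = homology_of_cup_complex ?H (triple_cup_form Y \<zeta>) k" for k
    by (simp add: cup_homology_def homology_of_cup_complex_def Let_def)
  have "group_rank (cup_homology Y \<zeta> k) = enat h" for k
    unfolding eq by (rule h)
  then have "(THE r. \<forall>k. group_rank (cup_homology Y \<zeta> k) = r) = enat h"
    by (intro the_equality) auto
  moreover have "betti_number 1 Y \<noteq> 0"
    using assms(1,3) by (simp add: zero_enat_def)
  ultimately have "cup_rank Y \<zeta> = real h"
    by (simp add: cup_rank_def)
  then show ?thesis
    using bounds by simp
qed

end
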